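(* Let $n\ge2$ be an even integer, $k=n/2$, and $w_1(x)=\left(\ln\frac{\mathrm{e}}{|x|}\right)^{\frac{n}{2}}$ on the unit ball $B\subset\mathbb{R}^n$. (a) For every $u\in\Phi^{k}_{0,\mathrm{rad}}(B,w_1)$, $$\int_B \mathrm{e}^{\mathrm{e}^{|u|^{\frac{n+2}{n}}}}\,\mathrm{d}x<\infty.$$ (b) Let $\Sigma_1=\{u\in\Phi^{k}_{0,\mathrm{rad}}(B,w_1):\|u\|_{\Phi,w_1}\le1\}$. Then, for $a\in\mathbb{R}$, $$\sup_{u\in\Sigma_1}\int_B \mathrm{e}^{a\,\mathrm{e}^{c_n^{\frac{2}{n}}|u|^{\frac{n+2}{n}}}}\,\mathrm{d}x<\infty\iff a\le n.$$
   Context: $B$ is the open unit ball of $\mathbb{R}^n$ centered at $0$, $\omega_{n-1}$ is the area of the unit sphere in $\mathbb{R}^n$, and $c_n=\frac{\omega_{n-1}}{k}\binom{n-1}{k-1}$. For $u\in C^2(B)$, $S_j(D^2u)$ is the sum of all $j\times j$ principal minors of the Hessian matrix $D^2u$. A function $u\in C^2(B)\cap C^0(\overline{B})$ is $k$-admissible if $S_j(D^2u)\ge0$ in $B$ for $j=1,\dots,k$. $\Phi^k_{0,\mathrm{rad}}(B)$ is the set of radially symmetric $k$-admissible functions on $B$ vanishing on $\partial B$. For a positive radial weight $w(x)=w(r)$ and a radial function $u(x)=v(r)$, $r=|x|$, set $$\|u\|_{\Phi,w}=\Big(c_n\int_0^1 r^{n-k}|v'(r)|^{k+1}w(r)\,\mathrm{d}r\Big)^{\frac{1}{k+1}}.$$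 $\Phi^k_{0,\mathrm{rad}}(B,w)$ is the closure, with respect to $\|\cdot\|_{\Phi,w}$, of $\{u\in\Phi^k_{0,\mathrm{rad}}(B):\|u\|_{\Phi,w}<\infty\}$; its elements are identified with radial functions $u(x)=v(|x|)$, $v$ locally absolutely continuous on $(0,1)$ with $v(r)\to0$ as $r\to1$, that are limits of sequences in this set in the sense that $\|u_m-u\|_{\Phi,w}\to0$ (norm given by the same formula). *)

theory Defs
  imports "HOL-Analysis.Analysis"
begin

section \<open>Area of the unit sphere\<close>

text \<open>
  The surface measure of a subset A of the unit sphere of \<open>\<real>\<^sup>n\<close> is n times the Lebesgue measure
  of the cone \<open>{t x | 0 < t \<le> 1, x \<in> A}\<close>; this is the measure that appears in the polar
  coordinate formula.
\<close>

definition sphere_measure :: "(real ^ 'n) set \<Rightarrow> real"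
  where "sphere_measure A =
    real CARD('n) * measure lebesgue {t *\<^sub>R x | t x. 0 < t \<and> t \<le> 1 \<and> x \<in> A}"

definition sphere_area :: "'n::finite itself \<Rightarrow> real"
  where "sphere_area _ = sphere_measure (sphere (0 :: real ^ 'n) 1)"

definition hessian_const :: "'n::finite itself \<Rightarrow> nat \<Rightarrow> real"
  where "hessian_const T k =
    sphere_area T / real k * real ((CARD('n) - 1) choose (k - 1))"


section \<open>Functions of class $C^2$ and their Hessians\<close>

definition partial_deriv :: "'n \<Rightarrow> (real ^ 'n \<Rightarrow> real) \<Rightarrow> real ^ 'n \<Rightarrow> real"
  where "partial_deriv i u x = frechet_derivative u (at x) (axis i 1)"

text \<open>Meant for open S, so that the partial derivatives of u are determined near each point
  of S by the values of u on S.\<close>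

definition C2_on :: "(real ^ 'n) set \<Rightarrow> (real ^ 'n \<Rightarrow> real) \<Rightarrow> bool"
  where "C2_on S u \<longleftrightarrow>
    (\<forall>x\<in>S. u differentiable (at x)) \<and>
    (\<forall>i. \<forall>x\<in>S. partial_deriv i u differentiable (at x)) \<and>
    (\<forall>i j. continuous_on S (partial_deriv i (partial_deriv j u)))"

definition hessian :: "(real ^ 'n \<Rightarrow> real) \<Rightarrow> real ^ 'n \<Rightarrow> real ^ 'n ^ 'n"
  where "hessian u x = (\<chi> i j. partial_deriv i (partial_deriv j u) x)"

text \<open>The determinant of the submatrix with rows and columns in I, by the Leibniz formula
  used in the library for \<^const>\<open>det\<close> (which is the case \<open>I = UNIV\<close>).\<close>

definition principal_minor :: "'n set \<Rightarrow> real ^ 'n ^ 'n \<Rightarrow> real"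
  where "principal_minor I A =
    (\<Sum>p \<in> {p. p permutes I}. of_int (sign p) * (\<Prod>i\<in>I. A $ i $ p i))"

definition S_minors :: "nat \<Rightarrow> real ^ 'n ^ 'n \<Rightarrow> real"
  where "S_minors j A = (\<Sum>I \<in> {I. card I = j}. principal_minor I A)"

definition k_admissible :: "nat \<Rightarrow> (real ^ 'n \<Rightarrow> real) \<Rightarrow> bool"
  where "k_admissible k u \<longleftrightarrow>
    C2_on (ball 0 1) u \<and> continuous_on (cball 0 1) u \<and>
    (\<forall>j\<in>{1..k}. \<forall>x\<in>ball 0 1. 0 \<le> S_minors j (hessian u x))"


section \<open>Radial functions\<close>

definition radial_on :: "'a::real_normed_vector set \<Rightarrow> ('a \<Rightarrow> real) \<Rightarrow> bool"
  where "radial_on S u \<longleftrightarrow> (\<forall>x\<in>S. \<forall>y\<in>S. norm x = norm y \<longrightarrow> u x = u y)"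

text \<open>The function v with \<open>u x = v (norm x)\<close>.  For u radial on the punctured unit ball, its
  values on \<open>{0<..<1}\<close> do not depend on the choice, and only these are ever used.\<close>

definition profile :: "('a::real_normed_vector \<Rightarrow> real) \<Rightarrow> real \<Rightarrow> real"
  where "profile u r = u (SOME x. norm x = r)"

definition Phi_0_rad :: "nat \<Rightarrow> (real ^ 'n \<Rightarrow> real) set"
  where "Phi_0_rad k =
    {u. radial_on (cball 0 1) u \<and> k_admissible k u \<and> (\<forall>x\<in>sphere 0 1. u x = 0)}"


section \<open>The weighted norm and the weighted space\<close>

definition Phi_energy :: "nat \<Rightarrow> (real ^ 'n \<Rightarrow> real) \<Rightarrow> (real ^ 'n \<Rightarrow> real) \<Rightarrow> ennreal"
  where "Phi_energy k w u =
    ennreal (hessian_const TYPE('n) k) *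
      (\<integral>\<^sup>+ r\<in>{0<..<1}. ennreal (r ^ (CARD('n) - k) * \<bar>deriv (profile u) r\<bar> ^ (k + 1)
          * profile w r) \<partial>lborel)"

text \<open>The \<open>(k + 1)\<close>-th root of the energy, infinite if the energy is infinite.\<close>

definition Phi_norm :: "nat \<Rightarrow> (real ^ 'n \<Rightarrow> real) \<Rightarrow> (real ^ 'n \<Rightarrow> real) \<Rightarrow> ennreal"
  where "Phi_norm k w u =
    (if Phi_energy k w u = \<infinity> then \<infinity>
     else ennreal (enn2real (Phi_energy k w u) powr (1 / real (k + 1))))"

definition absolutely_continuous_on_Icc :: "real \<Rightarrow> real \<Rightarrow> (real \<Rightarrow> real) \<Rightarrow> bool"
  where "absolutely_continuous_on_Icc a b f \<longleftrightarrow>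
    (\<forall>\<epsilon>>0. \<exists>\<delta>>0. \<forall>D :: (real \<times> real) set.
      finite D \<and> (\<forall>(s, t)\<in>D. a \<le> s \<and> s < t \<and> t \<le> b) \<and>
      disjoint_family_on (\<lambda>(s, t). {s<..<t}) D \<and> (\<Sum>(s, t)\<in>D. t - s) < \<delta>
      \<longrightarrow> (\<Sum>(s, t)\<in>D. \<bar>f t - f s\<bar>) < \<epsilon>)"

definition locally_absolutely_continuous_on_Ioo :: "real \<Rightarrow> real \<Rightarrow> (real \<Rightarrow> real) \<Rightarrow> bool"
  where "locally_absolutely_continuous_on_Ioo a b f \<longleftrightarrow>
    (\<forall>c d. a < c \<and> c \<le> d \<and> d < b \<longrightarrow> absolutely_continuous_on_Icc c d f)"

text \<open>
  An element of the closure need not be bounded near the origin, so it is required to be radial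
  on the punctured ball only: its value at 0 (like those outside the ball) is irrelevant.
\<close>

definition Phi_0_rad_weighted :: "nat \<Rightarrow> (real ^ 'n \<Rightarrow> real) \<Rightarrow> (real ^ 'n \<Rightarrow> real) set"
  where "Phi_0_rad_weighted k w =
    {u. radial_on (ball 0 1 - {0}) u \<and>
        locally_absolutely_continuous_on_Ioo 0 1 (profile u) \<and>
        (profile u \<longlongrightarrow> 0) (at_left 1) \<and>
        (\<exists>U :: nat \<Rightarrow> real ^ 'n \<Rightarrow> real.
          (\<forall>m. U m \<in> Phi_0_rad k \<and> Phi_norm k w (U m) < \<infinity>) \<and>
          (\<lambda>m. Phi_norm k w (\<lambda>x. U m x - u x)) \<longlonglongrightarrow> 0)}"

end

theory Submission
  imports Defs "HOL-Probability.Probability"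
begin

text \<open>
  Write v for the profile of u and substitute \<open>r = exp (1 - exp s)\<close>, so that \<open>ln (ln (e / r)) = s\<close>.
  Hoelder's inequality turns the energy into the bound
  \<open>c * |v s - v t| ^ (k + 1) \<le> E(s, t) * (t - s) ^ k\<close>, where E is additive on intervals.

  For (a), u is a bounded function plus one of small energy, so the exponent
  \<open>|u| powr ((k + 1) / k)\<close> grows at most like \<open>s / 2\<close>.

  For (b) put \<open>G s = c powr (1 / k) * |v s| powr ((k + 1) / k)\<close>, so that \<open>G s \<le> s\<close> when \<open>E \<le> 1\<close>. The energy
  cannot be spent twice, so the deficit \<open>s - G s\<close> is small near at most one point. Hence, with
  \<open>y = exp s\<close>, the gap \<open>y - exp (G s)\<close> is at least a multiple of \<open>min y |y - y0|\<close> for some y0, and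
  \<open>exp (- n * (y - exp (G s)))\<close>, which is the integrand in polar coordinates for \<open>a = n\<close>, has an
  integral bounded independently of u. For \<open>a > n\<close>, smooth truncations of \<open>- ln (ln (e / |x|))\<close> at
  \<open>|x|^2 = \<epsilon>\<close>, normalized to energy at most 1, make the integral of order \<open>\<epsilon> powr ((n - a) / 2)\<close>.
\<close>


section \<open>Absolutely continuous functions on an interval\<close>

text \<open>The substitution fits because n = 2 * k: the energy density r ^ k * |v'| ^ (k + 1) * (1
  - ln r) ^ k dr is exactly |dv/ds| ^ (k + 1) ds. An element of the closure has a profile that is
  merely locally absolutely continuous, so \<open>deriv (profile u)\<close> is meaningful only
  almost everywhere. Before any inequality can start, such a profile must be shown to be
  differentiable almost everywhere, with increments controlled by the integral of the derivative.

  The obstacle in (b) is that a = n is critical: in the variable t = exp s - 1 the pointwise bound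
  \<open>G s \<le> s\<close> only makes the integrand bounded on a half-line. Some gain at almost
  every point is indispensable, and it must come from the deficit, uniformly in u.

  The sign conditions on S_j weigh on the test functions for a > n. They must be C^2 across the
  origin and satisfy these conditions up to j = k = n / 2, and they may lose only a bounded amount
  in the inner exponential. This dictates a regularization in |x|^2 rather than a cut-off of the
  logarithm.\<close>

definition interval_family :: "real \<Rightarrow> real \<Rightarrow> (real \<times> real) set \<Rightarrow> bool"
  where "interval_family a b D \<longleftrightarrow>
    finite D \<and> (\<forall>(s, t)\<in>D. a \<le> s \<and> s < t \<and> t \<le> b) \<and>
    disjoint_family_on (\<lambda>(s, t). {s<..<t}) D"

lemma interval_family_subset:
  assumes "interval_family a b D" "D' \<subseteq> D"
  shows "interval_family a b D'"
  using assms unfolding interval_family_def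
  by (auto intro: finite_subset disjoint_family_on_mono)

lemma interval_family_widen:
  assumes "interval_family a b D" "a' \<le> a" "b \<le> b'"
  shows "interval_family a' b' D"
  using assms unfolding interval_family_def by fastforce

lemma interval_family_disj:
  assumes "interval_family a b D" "(s, t) \<in> D" "(s', t') \<in> D" "(s, t) \<noteq> (s', t')"
  shows "t \<le> s' \<or> t' \<le> s"
proof (rule ccontr)
  assume "\<not> ?thesis"
  moreover have "s < t" "s' < t'"
    using assms unfolding interval_family_def by auto
  ultimately have "max s s' < min t t'" by auto
  then obtain z where "max s s' < z" "z < min t t'" using dense by blast
  then have "z \<in> {s<..<t} \<inter> {s'<..<t'}" by auto
  moreover have "{s<..<t} \<inter> {s'<..<t'} = {}"
    using assms unfolding interval_family_def disjoint_family_on_def by fastforce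
  ultimately show False by auto
qed

lemma interval_familyI:
  assumes "finite D" "\<And>s t. (s, t) \<in> D \<Longrightarrow> a \<le> s \<and> s < t \<and> t \<le> b"
    and "\<And>s t s' t'. (s, t) \<in> D \<Longrightarrow> (s', t') \<in> D \<Longrightarrow> (s, t) \<noteq> (s', t') \<Longrightarrow> t \<le> s' \<or> t' \<le> s"
  shows "interval_family a b D"
  unfolding interval_family_def disjoint_family_on_def using assms by fastforce

text \<open>Induction on the number of intervals. The member with the largest right endpoint is
  removed; all others then end at or before its left endpoint, which takes the place of
  \<open>b\<close>. This is why \<open>b\<close> varies in the induction.\<close>

lemma sum_increments_le:
  fixes g :: "real \<Rightarrow> real"
  assumes "interval_family a b D" "a \<le> b"
    and "\<And>s t. a \<le> s \<Longrightarrow> s \<le> t \<Longrightarrow> t \<le> b \<Longrightarrow> g s \<le> g t"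
  shows "(\<Sum>(s, t)\<in>D. g t - g s) \<le> g b - g a"
  using assms
proof (induction "card D" arbitrary: D b)
  case 0
  then have "D = {}" by (auto simp: interval_family_def)
  then show ?case using 0 by simp
next
  case (Suc m)
  have fin: "finite D" and ne: "D \<noteq> {}" using Suc by (auto simp: interval_family_def)
  define T where "T = Max (snd ` D)"
  have "T \<in> snd ` D" unfolding T_def using fin ne by (intro Max_in) auto
  then obtain s0 where st: "(s0, T) \<in> D" by auto
  have T: "t \<le> T" if "(s, t) \<in> D" for s t
    unfolding T_def using fin that by (intro Max_ge) force+
  have bd: "a \<le> s0" "s0 < T" "T \<le> b" using Suc.prems(1) st by (auto simp: interval_family_def)
  let ?D = "D - {(s0, T)}"
  have fam: "interval_family a s0 ?D"
  proof (rule interval_familyI)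
    show "finite ?D" using fin by auto
  next
    fix s t assume m: "(s, t) \<in> ?D"
    have "a \<le> s" "s < t" using m Suc.prems(1) by (auto simp: interval_family_def)
    moreover have "t \<le> s0 \<or> T \<le> s" using interval_family_disj[OF Suc.prems(1), of s t s0 T] m st by auto
    moreover have "t \<le> T" using T m by auto
    ultimately show "a \<le> s \<and> s < t \<and> t \<le> s0" by auto
  next
    fix s t s' t' assume "(s, t) \<in> ?D" "(s', t') \<in> ?D" "(s, t) \<noteq> (s', t')"
    then show "t \<le> s' \<or> t' \<le> s" using interval_family_disj[OF Suc.prems(1), of s t s' t'] by auto
  qed
  have "(\<Sum>(s, t)\<in>?D. g t - g s) \<le> g s0 - g a"
    using Suc.hyps(2) fin st bd Suc.prems(3) fam by (intro Suc.hyps(1)) auto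
  moreover have "(\<Sum>(s, t)\<in>D. g t - g s) = (g T - g s0) + (\<Sum>(s, t)\<in>?D. g t - g s)"
    using fin st by (subst sum.remove[of _ "(s0, T)"]) auto
  moreover have "g T \<le> g b" using Suc.prems bd by auto
  ultimately show ?case by linarith
qed

text \<open>\<open>V\<close> is the variation on [a, x], a supremum over families. Appending (s, t)
  to a family on [a, s] shows that it dominates increments. That the total is nearly attained by one
  finite family is what the differentiability argument feeds on.\<close>

lemma variation_function:
  fixes f :: "real \<Rightarrow> real"
  assumes ab: "a \<le> b"
    and B: "\<And>D. interval_family a b D \<Longrightarrow> (\<Sum>(s, t)\<in>D. \<bar>f t - f s\<bar>) \<le> B"
  obtains V where "\<And>s t. a \<le> s \<Longrightarrow> s \<le> t \<Longrightarrow> t \<le> b \<Longrightarrow> \<bar>f t - f s\<bar> \<le> V t - V s"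
    and "\<And>e. e > 0 \<Longrightarrow> \<exists>D. interval_family a b D \<and> V b - V a - e < (\<Sum>(s, t)\<in>D. \<bar>f t - f s\<bar>)"
proof -
  define X where "X x = (\<lambda>D. \<Sum>(s, t)\<in>D. \<bar>f t - f s\<bar>) ` {D. interval_family a x D}" for x
  define V where "V x = Sup (X x)" for x
  have X0: "0 \<in> X x" for x
    unfolding X_def by (rule image_eqI[of _ _ "{}"]) (auto simp: interval_family_def disjoint_family_on_def)
  have bdd: "bdd_above (X x)" if "x \<le> b" for x
  proof (rule bdd_aboveI)
    fix y assume "y \<in> X x"
    then show "y \<le> B" using B interval_family_widen[of a x _ a b] that by (auto simp: X_def)
  qed
  have near: "\<exists>D. interval_family a x D \<and> V x - e < (\<Sum>(s, t)\<in>D. \<bar>f t - f s\<bar>)"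
    if "x \<le> b" "e > 0" for x e
  proof -
    have "\<exists>y\<in>X x. V x - e < y"
      unfolding V_def using X0[of x] bdd[OF that(1)] that by (intro less_cSupD) auto
    then show ?thesis by (auto simp: X_def)
  qed
  \<comment> \<open>Only the empty family lives on a degenerate interval, so
    \<open>V b - V a\<close> is the full variation.\<close>
  have Va: "V a = 0"
  proof -
    have "D = {}" if "interval_family a a D" for D
      using that by (force simp: interval_family_def)
    then have "{D. interval_family a a D} \<subseteq> {{}}" by auto
    then have "X a \<subseteq> {0}" unfolding X_def by fastforce
    then have "X a = {0}" using X0[of a] by auto
    then show ?thesis by (simp add: V_def)
  qed
  show ?thesis
  proof (rule that[of V])
    fix s t assume st: "a \<le> s" "s \<le> t" "t \<le> b"
    show "\<bar>f t - f s\<bar> \<le> V t - V s"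
    proof (cases "s = t")
      case False
      with st have lt: "s < t" by simp
      show ?thesis
      proof (rule field_le_epsilon)
        fix e :: real assume "e > 0"
        then obtain D where D: "interval_family a s D" "V s - e < (\<Sum>(s, t)\<in>D. \<bar>f t - f s\<bar>)"
          using near[of s e] st by auto
        have fin: "finite D" using D by (auto simp: interval_family_def)
        have nin: "(s, t) \<notin> D" using D lt by (auto simp: interval_family_def)
        have "interval_family a t (insert (s, t) D)"
        proof (rule interval_familyI)
          show "finite (insert (s, t) D)" using fin by simp
        next
          fix s' t' assume "(s', t') \<in> insert (s, t) D"
          then show "a \<le> s' \<and> s' < t' \<and> t' \<le> t" using D(1) st lt unfolding interval_family_def by fastforce
        next
          fix p q p' q' assume *: "(p, q) \<in> insert (s, t) D" "(p', q') \<in> insert (s, t) D" "(p, q) \<noteq> (p', q')"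
          have "q \<le> s" if "(p, q) \<in> D" for p q using D(1) that unfolding interval_family_def by auto
          then show "q \<le> p' \<or> q' \<le> p" using * interval_family_disj[OF D(1), of p q p' q'] by auto
        qed
        then have "(\<Sum>(s, t)\<in>insert (s, t) D. \<bar>f t - f s\<bar>) \<in> X t" by (auto simp: X_def)
        then have "(\<Sum>(s, t)\<in>insert (s, t) D. \<bar>f t - f s\<bar>) \<le> V t"
          unfolding V_def using bdd st by (intro cSup_upper) auto
        then show "\<bar>f t - f s\<bar> \<le> V t - V s + e" using D(2) fin nin by simp
      qed
    qed simp
  next
    fix e :: real assume "e > 0"
    then show "\<exists>D. interval_family a b D \<and> V b - V a - e < (\<Sum>(s, t)\<in>D. \<bar>f t - f s\<bar>)"
      using near[of b e] Va by auto
  qed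
qed

section \<open>Vitali covers by intervals and differentiability almost everywhere\<close>

lemma measure_Un_negligible:
  assumes "T \<in> lmeasurable" "negligible E"
  shows "T \<union> E \<in> lmeasurable" "measure lebesgue (T \<union> E) = measure lebesgue T"
  using assms negligible_imp_measurable[OF assms(2)]
  by (intro fmeasurable.Un measure_Un_null_set; auto simp: negligible_iff_null_sets)+

text \<open>Converts a bound for finite families into one for outer measure. If intervals with
  property P shrink to every point of S, Vitali's theorem picks countably many disjoint ones that
  cover S up to a null set, and each finite part of them is an interval family obeying the
  bound.\<close>

lemma Vitali_interval_cover:
  fixes P :: "real \<Rightarrow> real \<Rightarrow> bool"
  assumes P: "\<And>s t. P s t \<Longrightarrow> a \<le> s \<and> s < t \<and> t \<le> b"
    and cov: "\<And>x d. x \<in> S \<Longrightarrow> d > 0 \<Longrightarrow> \<exists>s t. P s t \<and> s \<le> x \<and> x \<le> t \<and> t - s < d"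
    and bound: "\<And>D. interval_family a b D \<Longrightarrow> (\<And>s t. (s, t) \<in> D \<Longrightarrow> P s t) \<Longrightarrow> (\<Sum>(s, t)\<in>D. t - s) \<le> c"
  shows "\<exists>T. S \<subseteq> T \<and> T \<in> lmeasurable \<and> measure lebesgue T \<le> c"
proof -
  \<comment> \<open>The covering theorem speaks of balls, so an interval is coded by its endpoints
    and seen as the ball around its midpoint.\<close>
  let ?a = "\<lambda>(s, t). (s + t) / 2 :: real" and ?r = "\<lambda>(s, t). (t - s) / 2 :: real"
  let ?K = "{(s, t). P s t}"
  have cb: "cball (?a i) (?r i) = {fst i..snd i}" for i
    by (cases i) (auto simp: cball_eq_atLeastAtMost field_simps)
  obtain C where C: "countable C" "C \<subseteq> ?K"
     "pairwise (\<lambda>i j. disjnt (cball (?a i) (?r i)) (cball (?a j) (?r j))) C"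
     "negligible(S - (\<Union>i \<in> C. cball (?a i) (?r i)))"
  proof (rule Vitali_covering_theorem_cballs[of ?K ?r S ?a])
    show "0 < ?r i" if "i \<in> ?K" for i using that P by (cases i) auto
    show "\<exists>i. i \<in> ?K \<and> x \<in> cball (?a i) (?r i) \<and> ?r i < d" if "x \<in> S" "d > 0" for x d
    proof -
      from cov[OF that] obtain s t where "P s t" "s \<le> x" "x \<le> t" "t - s < d" by auto
      then show ?thesis using P[of s t] unfolding cb by (intro exI[of _ "(s, t)"]) auto
    qed
  qed (use that in auto)
  have Cfin: "measure lebesgue (\<Union>i\<in>D. {fst i..snd i}) \<le> c" if "D \<subseteq> C" "finite D" for D
  proof -
    have PD: "P s t" if "(s, t) \<in> D" for s t using that \<open>D \<subseteq> C\<close> C(2) by auto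
    have fam: "interval_family a b D"
    proof (rule interval_familyI)
      show "finite D" by fact
      show "a \<le> s \<and> s < t \<and> t \<le> b" if "(s, t) \<in> D" for s t using P[OF PD[OF that]] .
      fix s t s' t' assume st: "(s, t) \<in> D" "(s', t') \<in> D" "(s, t) \<noteq> (s', t')"
      then have "disjnt {s..t} {s'..t'}"
        using pairwiseD[OF C(3), of "(s, t)" "(s', t')"] \<open>D \<subseteq> C\<close> cb[of "(s, t)"] cb[of "(s', t')"] by auto
      moreover have "s < t" "s' < t'" using P[OF PD[OF st(1)]] P[OF PD[OF st(2)]] by auto
      ultimately have "\<not> max s s' \<le> min t t'" by (auto simp: disjnt_def)
      then show "t \<le> s' \<or> t' \<le> s" using \<open>s < t\<close> \<open>s' < t'\<close> by linarith
    qed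
    have "measure lebesgue (\<Union>i\<in>D. {fst i..snd i}) \<le> (\<Sum>i\<in>D. measure lebesgue {fst i..snd i})"
      using that by (intro measure_UNION_le) auto
    also have "\<dots> = (\<Sum>(s, t)\<in>D. t - s)"
    proof (intro sum.cong refl, clarify)
      fix s t assume "(s, t) \<in> D"
      then show "measure lebesgue {fst (s, t)..snd (s, t)} = t - s" using P[OF PD] by fastforce
    qed
    also have "\<dots> \<le> c" by (rule bound[OF fam PD])
    finally show ?thesis .
  qed
  let ?U = "\<Union>i\<in>C. {fst i..snd i}"
  have U: "?U \<in> lmeasurable" "measure lebesgue ?U \<le> c"
    by (rule fmeasurable_UN_bound[OF C(1) _ Cfin], simp, assumption+)
       (rule measure_UN_bound[OF C(1) _ Cfin], simp, assumption+)
  have neg: "negligible (S - ?U)" using C(4) unfolding cb .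
  then have "?U \<union> (S - ?U) \<in> lmeasurable" "measure lebesgue (?U \<union> (S - ?U)) = measure lebesgue ?U"
    using measure_Un_negligible[OF U(1) neg] by blast+
  then show ?thesis using U(2) by (intro exI[of _ "?U \<union> (S - ?U)"]) force
qed

text \<open>
  After Austin's proof of the differentiability theorem: on an interval of a family that nearly
  attains the variation, subintervals whose slope has the opposite sign raise the variation by twice
  the size of their increments, so a Vitali cover by such subintervals has small total length.
\<close>
lemma negligible_two_sided_slopes:
  fixes f :: "real \<Rightarrow> real"
  assumes ab: "a \<le> b" and \<eta>: "0 < \<eta>"
    and B: "\<And>D. interval_family a b D \<Longrightarrow> (\<Sum>(s, t)\<in>D. \<bar>f t - f s\<bar>) \<le> B"
  shows "negligible {x\<in>{a<..<b}. \<forall>d>0.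
      (\<exists>s t. s < t \<and> s \<le> x \<and> x \<le> t \<and> t - s < d \<and> f t - f s > \<eta> * (t - s)) \<and>
      (\<exists>s t. s < t \<and> s \<le> x \<and> x \<le> t \<and> t - s < d \<and> f t - f s < - \<eta> * (t - s))}"
    (is "negligible ?N")
proof -
  obtain V where V: "\<And>s t. a \<le> s \<Longrightarrow> s \<le> t \<Longrightarrow> t \<le> b \<Longrightarrow> \<bar>f t - f s\<bar> \<le> V t - V s"
    and near: "\<And>e. e > 0 \<Longrightarrow> \<exists>D. interval_family a b D \<and> V b - V a - e < (\<Sum>(s, t)\<in>D. \<bar>f t - f s\<bar>)"
    using variation_function[of a b f B] ab B by blast
  have "\<exists>T. ?N \<subseteq> T \<and> T \<in> lmeasurable \<and> measure lebesgue T \<le> e" if "e > 0" for e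
  proof -
    \<comment> \<open>Intervals inside members of D will have total length at most \<epsilon> / (2 *
      \<eta>), those clear of D at most \<epsilon> / \<eta>; together at most 2 * \<epsilon> /
      \<eta> = e.\<close>
    define \<epsilon> where "\<epsilon> = \<eta> * e / 2"
    have \<epsilon>: "\<epsilon> > 0" using that \<eta> by (simp add: \<epsilon>_def)
    obtain D where D: "interval_family a b D" and Dn: "V b - V a - \<epsilon> < (\<Sum>(s, t)\<in>D. \<bar>f t - f s\<bar>)"
      using near[OF \<epsilon>] by auto
    have finD: "finite D" using D by (auto simp: interval_family_def)
    have Dbd: "a \<le> p" "p < q" "q \<le> b" if "(p, q) \<in> D" for p q
      using D that by (auto simp: interval_family_def)
    \<comment> \<open>These endpoints form a finite, hence negligible set. Around any other point a
      short interval lies either inside one member of D or clear of all of them.\<close>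
    define E where "E = fst ` D \<union> snd ` D"
    have finE: "finite E" using finD by (simp add: E_def)
    define opp where "opp p q s t \<longleftrightarrow>
       (if f p \<le> f q then f t - f s < - \<eta> * (t - s) else f t - f s > \<eta> * (t - s))" for p q s t
    \<comment> \<open>The second alternative admits slopes of either sign: an interval clear of D
      can be added to D, and its increment then counts in full towards the variation.\<close>
    define P where "P s t \<longleftrightarrow> a \<le> s \<and> s < t \<and> t \<le> b \<and>
        ((\<exists>(p, q)\<in>D. p \<le> s \<and> t \<le> q \<and> opp p q s t) \<or>
         ((\<forall>(p, q)\<in>D. t \<le> p \<or> q \<le> s) \<and> \<bar>f t - f s\<bar> > \<eta> * (t - s)))" for s t
    have "\<exists>T. ?N - E \<subseteq> T \<and> T \<in> lmeasurable \<and> measure lebesgue T \<le> e"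
    proof (rule Vitali_interval_cover[where P=P and a=a and b=b])
      show "a \<le> s \<and> s < t \<and> t \<le> b" if "P s t" for s t using that by (auto simp: P_def)
    next
      fix x d :: real assume x: "x \<in> ?N - E" and d: "d > 0"
      obtain d1 where d1: "d1 > 0" "\<And>y. y \<in> insert a (insert b E) \<Longrightarrow> y \<noteq> x \<Longrightarrow> d1 \<le> dist x y"
        using finite_set_avoid[of "insert a (insert b E)" x] finE by auto
      have dE: "d1 \<le> \<bar>x - y\<bar>" if "y \<in> insert a (insert b E)" for y
        using d1(2)[OF that] x that by (auto simp: dist_real_def)
      have d': "min d d1 > 0" using d d1 by simp
      obtain s t where up: "s < t" "s \<le> x" "x \<le> t" "t - s < min d d1" "f t - f s > \<eta> * (t - s)"
        using x d' by blast
      obtain s' t' where dn: "s' < t'" "s' \<le> x" "x \<le> t'" "t' - s' < min d d1" "f t' - f s' < - \<eta> * (t' - s')"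
        using x d' by blast
      have ge: "a \<le> s" "t \<le> b" "a \<le> s'" "t' \<le> b" using dE[of a] dE[of b] x up dn by auto
      show "\<exists>s t. P s t \<and> s \<le> x \<and> x \<le> t \<and> t - s < d"
      proof (cases "\<exists>(p, q)\<in>D. p < x \<and> x < q")
        case True
        then obtain p q where pq: "(p, q) \<in> D" "p < x" "x < q" by auto
        then have "p \<in> E" "q \<in> E" by (force simp: E_def)+
        then have "p \<le> s" "t \<le> q" "p \<le> s'" "t' \<le> q" using dE[of p] dE[of q] up dn pq by auto
        then have "P s t \<or> P s' t'" using pq ge up dn by (auto simp: P_def opp_def)
        then show ?thesis using up dn by auto
      next
        case False
        have "t \<le> p \<or> q \<le> s" if "(p, q) \<in> D" for p q
        proof -
          have E: "p \<in> E" "q \<in> E" using that by (force simp: E_def)+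
          then have "x < p \<or> q < x" using False that x by (metis (mono_tags, lifting) DiffE case_prodI linorder_neqE_linordered_idom)
          then show ?thesis using dE[of p] dE[of q] E up by auto
        qed
        then have "P s t" using ge up by (auto simp: P_def)
        then show ?thesis using up by auto
      qed
    next
      fix F assume F: "interval_family a b F" and PF: "\<And>s t. (s, t) \<in> F \<Longrightarrow> P s t"
      have finF: "finite F" using F by (auto simp: interval_family_def)
      define G where "G = (\<lambda>(p, q). {(s, t). (s, t) \<in> F \<and> p \<le> s \<and> t \<le> q})"
      define F2 where "F2 = F - (\<Union>d\<in>D. G d)"
      have F2D: "t \<le> p \<or> q \<le> s" if "(s, t) \<in> F2" "(p, q) \<in> D" for s t p q
        using that PF[of s t] by (auto simp: F2_def G_def P_def)
      have F2s: "\<bar>f t - f s\<bar> > \<eta> * (t - s)" if "(s, t) \<in> F2" for s t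
        using that PF[of s t] by (auto simp: F2_def G_def P_def)
      have dis: "D \<inter> F2 = {}"
      proof -
        have False if "(s, t) \<in> D" "(s, t) \<in> F2" for s t
          using F2D[OF that(2,1)] Dbd[OF that(1)] by auto
        then show ?thesis by auto
      qed
      have F2F: "(s, t) \<in> F" if "(s, t) \<in> F2" for s t using that by (auto simp: F2_def)
      have Fbd: "a \<le> s" "s < t" "t \<le> b" if "(s, t) \<in> F" for s t
        using F that by (auto simp: interval_family_def)
      have fam: "interval_family a b (D \<union> F2)"
      proof (rule interval_familyI)
        show "finite (D \<union> F2)" using finD finF by (auto simp: F2_def)
        show "a \<le> s \<and> s < t \<and> t \<le> b" if "(s, t) \<in> D \<union> F2" for s t
          using that Dbd Fbd F2F by blast
        show "t \<le> s' \<or> t' \<le> s" if "(s, t) \<in> D \<union> F2" "(s', t') \<in> D \<union> F2" "(s, t) \<noteq> (s', t')" for s t s' t'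
          using that interval_family_disj[OF D, of s t s' t'] interval_family_disj[OF F, of s t s' t']
            F2D[of s t s' t'] F2D[of s' t' s t] F2F by blast
      qed
      have Vmono: "V s \<le> V t" if "a \<le> s" "s \<le> t" "t \<le> b" for s t using V[OF that] by linarith
      have "(\<Sum>(s, t)\<in>D \<union> F2. \<bar>f t - f s\<bar>) \<le> (\<Sum>(s, t)\<in>D \<union> F2. V t - V s)"
      proof (rule sum_mono, clarify)
        fix s t assume "(s, t) \<in> D \<union> F2"
        then have "a \<le> s \<and> s < t \<and> t \<le> b" using fam unfolding interval_family_def by blast
        then show "\<bar>f t - f s\<bar> \<le> V t - V s" by (intro V) auto
      qed
      also have "\<dots> \<le> V b - V a" by (rule sum_increments_le[OF fam ab Vmono])
      finally have "(\<Sum>(s, t)\<in>F2. \<bar>f t - f s\<bar>) \<le> \<epsilon>"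
        using Dn dis finD finF by (subst (asm) sum.union_disjoint) (auto simp: F2_def)
      moreover have "\<eta> * (\<Sum>(s, t)\<in>F2. t - s) \<le> (\<Sum>(s, t)\<in>F2. \<bar>f t - f s\<bar>)"
        unfolding sum_distrib_left using F2s by (intro sum_mono) (auto intro: less_imp_le)
      ultimately have b2: "\<eta> * (\<Sum>(s, t)\<in>F2. t - s) \<le> \<epsilon>" by linarith
      have G1: "2 * \<eta> * (\<Sum>(s, t)\<in>G d. t - s) \<le> (case d of (p, q) \<Rightarrow> (V q - V p) - \<bar>f q - f p\<bar>)" if "d \<in> D" for d
      proof -
        obtain p q where d: "d = (p, q)" by (cases d)
        have pq: "(p, q) \<in> D" using that d by simp
        note bd = Dbd[OF pq]
        have fG: "interval_family p q (G d)"
          using interval_family_subset[OF F, of "G d"] unfolding d G_def interval_family_def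
          by (auto simp: case_prod_beta)
        have opp: "opp p q s t" if "(s, t) \<in> G d" for s t
        proof -
          have st: "(s, t) \<in> F" "p \<le> s" "t \<le> q" using that by (auto simp: d G_def)
          have Pst: "P s t" using PF st by auto
          have "\<not> (\<forall>(p, q)\<in>D. t \<le> p \<or> q \<le> s)" using pq st Fbd[OF st(1)] by fastforce
          then obtain p' q' where pq': "(p', q') \<in> D" "p' \<le> s" "t \<le> q'" "opp p' q' s t"
            using Pst by (auto simp: P_def)
          have "(p', q') = (p, q)"
            using interval_family_disj[OF D pq'(1) pq] pq' st Fbd[OF st(1)] by fastforce
          then show ?thesis using pq' by simp
        qed
        \<comment> \<open>The sign makes c * (f q - f p) = |f q - f p|. Then V - c * f is
          nondecreasing, and across an interval of opposite slope it gains at least twice the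
          increment of f, once from V and once from - c * f.\<close>
        define c :: real where "c = (if f p \<le> f q then 1 else -1)"
        define g where "g = (\<lambda>x. V x - c * f x)"
        have "g s \<le> g t" if "p \<le> s" "s \<le> t" "t \<le> q" for s t
          using V[of s t] that bd by (auto simp: g_def c_def)
        then have "(\<Sum>(s, t)\<in>G d. g t - g s) \<le> g q - g p"
          using bd by (intro sum_increments_le[OF fG]) auto
        also have "\<dots> = (V q - V p) - \<bar>f q - f p\<bar>" by (auto simp: g_def c_def)
        finally have *: "(\<Sum>(s, t)\<in>G d. g t - g s) \<le> (V q - V p) - \<bar>f q - f p\<bar>" .
        have "2 * \<eta> * (\<Sum>(s, t)\<in>G d. t - s) \<le> (\<Sum>(s, t)\<in>G d. g t - g s)"
          unfolding sum_distrib_left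
        proof (rule sum_mono, clarify)
          fix s t assume st: "(s, t) \<in> G d"
          have stF: "(s, t) \<in> F" using st by (auto simp: d G_def)
          have "\<bar>f t - f s\<bar> \<le> V t - V s" using V Fbd[OF stF] by auto
          then show "2 * \<eta> * (t - s) \<le> g t - g s"
            using opp[OF st] by (auto simp: g_def c_def opp_def split: if_splits)
        qed
        then show ?thesis using * d by auto
      qed
      have "2 * \<eta> * (\<Sum>d\<in>D. \<Sum>(s, t)\<in>G d. t - s) \<le> (\<Sum>d\<in>D. case d of (p, q) \<Rightarrow> (V q - V p) - \<bar>f q - f p\<bar>)"
        unfolding sum_distrib_left by (rule sum_mono) (use G1 in \<open>simp add: sum_distrib_left\<close>)
      also have "\<dots> = (\<Sum>(p, q)\<in>D. V q - V p) - (\<Sum>(p, q)\<in>D. \<bar>f q - f p\<bar>)"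
        by (subst sum_subtractf[symmetric]) (auto intro!: sum.cong)
      also have "\<dots> \<le> \<epsilon>" using sum_increments_le[OF D ab, of V, OF Vmono] Dn by linarith
      finally have b1: "2 * \<eta> * (\<Sum>d\<in>D. \<Sum>(s, t)\<in>G d. t - s) \<le> \<epsilon>" .
      have "(\<Sum>(s, t)\<in>(\<Union>d\<in>D. G d). t - s) = (\<Sum>d\<in>D. \<Sum>(s, t)\<in>G d. t - s)"
      proof (rule sum.UNION_disjoint)
        show "\<forall>i\<in>D. finite (G i)" using finF by (auto simp: G_def intro: finite_subset[of _ F])
        show "\<forall>i\<in>D. \<forall>j\<in>D. i \<noteq> j \<longrightarrow> G i \<inter> G j = {}"
        proof (intro ballI impI, rule ccontr)
          fix i j assume ij: "i \<in> D" "j \<in> D" "i \<noteq> j" "G i \<inter> G j \<noteq> {}"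
          obtain p q p' q' where [simp]: "i = (p, q)" "j = (p', q')" by (metis surj_pair)
          have *: "(p, q) \<in> D" "(p', q') \<in> D" "(p, q) \<noteq> (p', q')" using ij by auto
          from ij obtain s t where "(s, t) \<in> F" "p \<le> s" "t \<le> q" "p' \<le> s" "t \<le> q'" by (auto simp: G_def)
          then show False using interval_family_disj[OF D *(1-3)] Fbd[of s t] by auto
        qed
      qed (use finD in auto)
      moreover have "F = F2 \<union> (\<Union>d\<in>D. G d)" "F2 \<inter> (\<Union>d\<in>D. G d) = {}" by (auto simp: F2_def G_def)
      then have "(\<Sum>(s, t)\<in>F. t - s) = (\<Sum>(s, t)\<in>F2. t - s) + (\<Sum>(s, t)\<in>(\<Union>d\<in>D. G d). t - s)"
        using finF by (metis (no_types, lifting) finite_Un sum.union_disjoint)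
      ultimately have "\<eta> * (\<Sum>(s, t)\<in>F. t - s) \<le> 2 * \<epsilon>"
        using b1 b2 \<epsilon> by (simp add: distrib_left)
      then show "(\<Sum>(s, t)\<in>F. t - s) \<le> e" using \<eta> by (simp add: \<epsilon>_def)
    qed
    then obtain T where T: "?N - E \<subseteq> T" "T \<in> lmeasurable" "measure lebesgue T \<le> e" by auto
    have "negligible E" using finE by (rule negligible_finite)
    then have "T \<union> E \<in> lmeasurable" "measure lebesgue (T \<union> E) = measure lebesgue T"
      using measure_Un_negligible[OF T(2)] by blast+
    then show ?thesis using T by (intro exI[of _ "T \<union> E"]) auto
  qed
  then show ?thesis by (auto simp: negligible_outer_le)
qed

text \<open>Intervals steeper than M have total length at most B / M, so the points with arbitrarily
  steep short intervals around them lie in sets of arbitrarily small measure.\<close>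

lemma negligible_unbounded_slopes:
  fixes f :: "real \<Rightarrow> real"
  assumes B: "\<And>D. interval_family a b D \<Longrightarrow> (\<Sum>(s, t)\<in>D. \<bar>f t - f s\<bar>) \<le> B"
  shows "negligible {x\<in>{a<..<b}. \<forall>M. \<forall>d>0.
      \<exists>s t. s < t \<and> s \<le> x \<and> x \<le> t \<and> t - s < d \<and> \<bar>f t - f s\<bar> > M * (t - s)}"
    (is "negligible ?N")
proof -
  have B0: "0 \<le> B" using B[of "{}"] by (simp add: interval_family_def disjoint_family_on_def)
  have "\<exists>T. ?N \<subseteq> T \<and> T \<in> lmeasurable \<and> measure lebesgue T \<le> e" if e: "e > 0" for e
  proof -
    \<comment> \<open>The + 1 keeps M positive when B = 0.\<close>
    define M where "M = (B + 1) / e"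
    have M: "M > 0" using B0 e by (simp add: M_def)
    show ?thesis
    proof (rule Vitali_interval_cover[where P="\<lambda>s t. a \<le> s \<and> s < t \<and> t \<le> b \<and> \<bar>f t - f s\<bar> > M * (t - s)"])
      fix x d :: real assume x: "x \<in> ?N" and d: "d > 0"
      define d1 where "d1 = min d (min (x - a) (b - x))"
      have "d1 > 0" using x d by (auto simp: d1_def)
      then obtain s t where "s < t" "s \<le> x" "x \<le> t" "t - s < d1" "\<bar>f t - f s\<bar> > M * (t - s)"
        using x by blast
      then show "\<exists>s t. (a \<le> s \<and> s < t \<and> t \<le> b \<and> \<bar>f t - f s\<bar> > M * (t - s)) \<and> s \<le> x \<and> x \<le> t \<and> t - s < d"
        by (intro exI[of _ s] exI[of _ t]) (auto simp: d1_def)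
    next
      fix D assume D: "interval_family a b D" and P: "\<And>s t. (s, t) \<in> D \<Longrightarrow> a \<le> s \<and> s < t \<and> t \<le> b \<and> \<bar>f t - f s\<bar> > M * (t - s)"
      have "M * (\<Sum>(s, t)\<in>D. t - s) \<le> (\<Sum>(s, t)\<in>D. \<bar>f t - f s\<bar>)"
        unfolding sum_distrib_left using P by (intro sum_mono) (auto intro: less_imp_le)
      also have "\<dots> \<le> B" by (rule B[OF D])
      also have "\<dots> \<le> M * e" using e by (simp add: M_def)
      finally show "(\<Sum>(s, t)\<in>D. t - s) \<le> e" using M by simp
    qed auto
  qed
  then show ?thesis by (auto simp: negligible_outer_le)
qed

text \<open>The candidate derivative is the supremum of the eventual lower bounds of the difference
  quotient. A number p above it is no eventual lower bound, so \<open>sep\<close> turns any larger q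
  into an eventual upper bound. Rational p and q suffice, which keeps the exceptional sets countable
  in number.\<close>

lemma slope_eventually_bounded_between_imp_differentiable:
  fixes f :: "real \<Rightarrow> real"
  defines "Q \<equiv> \<lambda>x y. (f y - f x) / (y - x)"
  assumes bdd: "\<forall>\<^sub>F y in at x. \<bar>Q x y\<bar> \<le> M"
    and sep: "\<And>p q. p \<in> \<rat> \<Longrightarrow> q \<in> \<rat> \<Longrightarrow> p < q \<Longrightarrow>
      (\<forall>\<^sub>F y in at x. Q x y \<le> q) \<or> (\<forall>\<^sub>F y in at x. p \<le> Q x y)"
  shows "f differentiable (at x)"
proof -
  define A where "A = {r. \<forall>\<^sub>F y in at x. r \<le> Q x y}"
  define l where "l = Sup A"
  have "-M \<in> A" unfolding A_def using bdd by (auto elim: eventually_mono)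
  have "r \<le> M" if "r \<in> A" for r
  proof -
    have "\<forall>\<^sub>F y in at x. r \<le> Q x y" using that by (simp add: A_def)
    with bdd have "\<forall>\<^sub>F y in at x. r \<le> M" by eventually_elim auto
    then show ?thesis by (simp add: eventually_const_iff)
  qed
  then have bA: "bdd_above A" by (meson bdd_above.I)
  have "(Q x \<longlongrightarrow> l) (at x)"
  proof (rule order_tendstoI)
    fix r assume "r < l"
    then obtain r' where "r' \<in> A" "r < r'"
      unfolding l_def using \<open>-M \<in> A\<close> bA by (subst (asm) less_cSup_iff) auto
    then show "\<forall>\<^sub>F y in at x. r < Q x y" by (auto simp: A_def elim: eventually_mono)
  next
    fix r assume "l < r"
    then obtain q where q: "q \<in> \<rat>" "l < q" "q < r" using Rats_dense_in_real by blast
    then obtain p where p: "p \<in> \<rat>" "l < p" "p < q" using Rats_dense_in_real by blast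
    have "p \<notin> A" using p bA cSup_upper[of p A] by (auto simp: l_def)
    then have "\<forall>\<^sub>F y in at x. Q x y \<le> q" using sep[OF p(1) q(1) p(3)] by (auto simp: A_def)
    then show "\<forall>\<^sub>F y in at x. Q x y < r" using q by (auto elim: eventually_mono)
  qed
  then have "(f has_field_derivative l) (at x)"
    unfolding has_field_derivative_iff Q_def by simp
  then show ?thesis by (auto simp: real_differentiable_def)
qed

text \<open>Used with c = (p + q) / 2: tilting the graph makes two slope thresholds p < q symmetric
  about 0, the form treated by the lemma on two-sided slopes.\<close>

lemma bounded_variation_add_linear:
  fixes f :: "real \<Rightarrow> real"
  assumes "a \<le> b" and B: "\<And>D. interval_family a b D \<Longrightarrow> (\<Sum>(s, t)\<in>D. \<bar>f t - f s\<bar>) \<le> B"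
    and D: "interval_family a b D"
  shows "(\<Sum>(s, t)\<in>D. \<bar>(f t - c * t) - (f s - c * s)\<bar>) \<le> B + \<bar>c\<bar> * (b - a)"
proof -
  have "(\<Sum>(s, t)\<in>D. \<bar>(f t - c * t) - (f s - c * s)\<bar>) \<le> (\<Sum>(s, t)\<in>D. \<bar>f t - f s\<bar> + \<bar>c\<bar> * (t - s))"
  proof (rule sum_mono, clarify)
    fix s t assume "(s, t) \<in> D"
    then have "s < t" using D by (auto simp: interval_family_def)
    have "\<bar>(f t - c * t) - (f s - c * s)\<bar> = \<bar>(f t - f s) - c * (t - s)\<bar>" by (simp add: algebra_simps)
    also have "\<dots> \<le> \<bar>f t - f s\<bar> + \<bar>c * (t - s)\<bar>" by (rule abs_triangle_ineq4)
    also have "\<bar>c * (t - s)\<bar> = \<bar>c\<bar> * (t - s)" using \<open>s < t\<close> by (simp add: abs_mult)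
    finally show "\<bar>(f t - c * t) - (f s - c * s)\<bar> \<le> \<bar>f t - f s\<bar> + \<bar>c\<bar> * (t - s)" .
  qed
  also have "\<dots> = (\<Sum>(s, t)\<in>D. \<bar>f t - f s\<bar>) + \<bar>c\<bar> * (\<Sum>(s, t)\<in>D. t - s)"
    unfolding sum_distrib_left sum.distrib[symmetric] by (intro sum.cong) auto
  also have "\<dots> \<le> B + \<bar>c\<bar> * (b - a)"
    using sum_increments_le[OF D \<open>a \<le> b\<close>, of "\<lambda>x. x"] B[OF D]
    by (intro add_mono mult_left_mono) auto
  finally show ?thesis .
qed

text \<open>Off a countable union of null sets the slopes at x are bounded and, for each rational
  gap p < q, eventually stay below q or eventually stay above p. The difference quotient then
  converges.\<close>

lemma bounded_variation_imp_ae_differentiable: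
  fixes f :: "real \<Rightarrow> real"
  assumes ab: "a \<le> b"
    and B: "\<And>D. interval_family a b D \<Longrightarrow> (\<Sum>(s, t)\<in>D. \<bar>f t - f s\<bar>) \<le> B"
  shows "negligible {x\<in>{a<..<b}. \<not> f differentiable (at x)}"
proof -
  define N where "N g \<eta> = {x\<in>{a<..<b}. \<forall>d>0.
      (\<exists>s t. s < t \<and> s \<le> x \<and> x \<le> t \<and> t - s < d \<and> g t - g s > \<eta> * (t - s)) \<and>
      (\<exists>s t. s < t \<and> s \<le> x \<and> x \<le> t \<and> t - s < d \<and> g t - g s < - \<eta> * (t - s))}"
    for g :: "real \<Rightarrow> real" and \<eta>
  define I where "I = {x\<in>{a<..<b}. \<forall>M. \<forall>d>0.
      \<exists>s t. s < t \<and> s \<le> x \<and> x \<le> t \<and> t - s < d \<and> \<bar>f t - f s\<bar> > M * (t - s)}"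
  define h where "h p q = (\<lambda>x. f x - ((p + q) / 2) * x)" for p q
  let ?R = "{(p, q). p \<in> \<rat> \<and> q \<in> \<rat> \<and> p < (q :: real)}"
  let ?U = "I \<union> (\<Union>(p, q)\<in>?R. N (h p q) ((q - p) / 4))"
  have "countable ?R" by (rule countable_subset[of _ "\<rat> \<times> \<rat>"]) (auto intro: countable_rat)
  moreover have "negligible (N (h p q) ((q - p) / 4))" if "p < q" for p q
    unfolding N_def
  proof (rule negligible_two_sided_slopes[OF ab])
    show "(\<Sum>(s, t)\<in>D. \<bar>h p q t - h p q s\<bar>) \<le> B + \<bar>(p + q) / 2\<bar> * (b - a)" if "interval_family a b D" for D
      unfolding h_def by (rule bounded_variation_add_linear[OF ab B that])
  qed (use that in auto)
  moreover have "negligible I" unfolding I_def by (rule negligible_unbounded_slopes[OF B])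
  ultimately have neg: "negligible ?U"
    by (intro negligible_Un negligible_countable_Union) auto
  \<comment> \<open>A difference quotient at x is the slope over an interval with x as an endpoint,
    on whichever side y lies. Conditions on the intervals that contain x therefore cover both
    one-sided limits.\<close>
  have slope: "s < t \<and> s \<le> x \<and> x \<le> t \<and> t - s < d \<and> (f t - f s) / (t - s) = (f y - f x) / (y - x)"
    if "y \<noteq> x" "dist y x < d" "s = min x y" "t = max x y" for x y s t d
    using that by (cases "x < y") (auto simp: dist_real_def min_def max_def divide_simps, argo+)
  have "f differentiable (at x)" if x: "x \<in> {a<..<b}" "x \<notin> ?U" for x
  proof -
    have "x \<notin> I" using x(2) by blast
    then obtain M d where d: "d > 0"
      and nM: "\<not> (\<exists>s t. s < t \<and> s \<le> x \<and> x \<le> t \<and> t - s < d \<and> \<bar>f t - f s\<bar> > M * (t - s))"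
      using x(1) unfolding I_def by blast
    have M: "\<bar>f t - f s\<bar> \<le> M * (t - s)" if "s < t" "s \<le> x" "x \<le> t" "t - s < d" for s t
      using nM that by (meson linorder_not_less)
    have bdd: "\<forall>\<^sub>F y in at x. \<bar>(f y - f x) / (y - x)\<bar> \<le> M"
      unfolding eventually_at
    proof (intro exI conjI ballI impI)
      fix y assume y: "y \<noteq> x \<and> dist y x < d"
      define s t where "s = min x y" and "t = max x y"
      have st: "s < t" "s \<le> x" "x \<le> t" "t - s < d" and eq: "(f t - f s) / (t - s) = (f y - f x) / (y - x)"
        using slope[OF conjunct1[OF y] conjunct2[OF y] s_def t_def] by blast+
      have "\<bar>(f t - f s) / (t - s)\<bar> \<le> M" using M[OF st] st(1) by (simp add: divide_simps)
      then show "\<bar>(f y - f x) / (y - x)\<bar> \<le> M" unfolding eq .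
    qed (rule d)
    have sep: "(\<forall>\<^sub>F y in at x. (f y - f x) / (y - x) \<le> q) \<or> (\<forall>\<^sub>F y in at x. p \<le> (f y - f x) / (y - x))"
      if pq: "p \<in> \<rat>" "q \<in> \<rat>" "p < q" for p q
    proof -
    \<comment> \<open>Midpoint and a quarter of the length of the gap, so that p \<le> c - \<eta>
      and c + \<eta> \<le> q.\<close>
    define c \<eta> where "c = (p + q) / 2" and "\<eta> = (q - p) / 4"
    have "(p, q) \<in> ?R" using pq by simp
    from UN_upper[OF this, of "\<lambda>(p, q). N (h p q) ((q - p) / 4)"]
    have "N (h p q) \<eta> \<subseteq> ?U" unfolding \<eta>_def prod.case by (rule le_supI2)
    then have "x \<notin> N (h p q) \<eta>" using x(2) by blast
    then obtain d where d: "d > 0" and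
      nd: "\<not> ((\<exists>s t. s < t \<and> s \<le> x \<and> x \<le> t \<and> t - s < d \<and> h p q t - h p q s > \<eta> * (t - s)) \<and>
      (\<exists>s t. s < t \<and> s \<le> x \<and> x \<le> t \<and> t - s < d \<and> h p q t - h p q s < - \<eta> * (t - s)))"
      using x(1) unfolding N_def by blast
    have
      "(\<forall>s t. s < t \<and> s \<le> x \<and> x \<le> t \<and> t - s < d \<longrightarrow> h p q t - h p q s \<le> \<eta> * (t - s)) \<or>
       (\<forall>s t. s < t \<and> s \<le> x \<and> x \<le> t \<and> t - s < d \<longrightarrow> h p q t - h p q s \<ge> - \<eta> * (t - s))"
      using nd by (meson linorder_not_less)
    moreover have hq: "h p q t - h p q s \<le> \<eta> * (t - s) \<Longrightarrow> (f t - f s) / (t - s) \<le> q"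
      and hp: "h p q t - h p q s \<ge> - \<eta> * (t - s) \<Longrightarrow> p \<le> (f t - f s) / (t - s)" if "s < t" for s t
    proof -
      assume "h p q t - h p q s \<le> \<eta> * (t - s)"
      then have "f t - f s \<le> (c + \<eta>) * (t - s)" by (simp add: h_def c_def field_simps)
      also have "\<dots> \<le> q * (t - s)" using pq that by (intro mult_right_mono) (auto simp: c_def \<eta>_def field_simps)
      finally show "(f t - f s) / (t - s) \<le> q" using that by (simp add: divide_simps)
    next
      assume "h p q t - h p q s \<ge> - \<eta> * (t - s)"
      then have "f t - f s \<ge> (c - \<eta>) * (t - s)" by (simp add: h_def c_def field_simps)
      moreover have "(c - \<eta>) * (t - s) \<ge> p * (t - s)" using pq that by (intro mult_right_mono) (auto simp: c_def \<eta>_def field_simps)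
      ultimately have "p * (t - s) \<le> f t - f s" by linarith
      then show "p \<le> (f t - f s) / (t - s)" using that by (simp add: divide_simps)
    qed
    ultimately have *: "(\<forall>s t. s < t \<and> s \<le> x \<and> x \<le> t \<and> t - s < d \<longrightarrow> (f t - f s) / (t - s) \<le> q) \<or>
       (\<forall>s t. s < t \<and> s \<le> x \<and> x \<le> t \<and> t - s < d \<longrightarrow> p \<le> (f t - f s) / (t - s))"
      by (elim disj_forward) simp_all
    have "(\<forall>y. y \<noteq> x \<and> dist y x < d \<longrightarrow> (f y - f x) / (y - x) \<le> q) \<or>
       (\<forall>y. y \<noteq> x \<and> dist y x < d \<longrightarrow> p \<le> (f y - f x) / (y - x))"
    proof (rule disj_forward[OF *]; intro allI impI; elim conjE)
      fix y assume *: "\<forall>s t. s < t \<and> s \<le> x \<and> x \<le> t \<and> t - s < d \<longrightarrow> (f t - f s) / (t - s) \<le> q"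
        and y: "y \<noteq> x" "dist y x < d"
      show "(f y - f x) / (y - x) \<le> q" using slope[OF y refl refl] * by metis
    next
      fix y assume *: "\<forall>s t. s < t \<and> s \<le> x \<and> x \<le> t \<and> t - s < d \<longrightarrow> p \<le> (f t - f s) / (t - s)"
        and y: "y \<noteq> x" "dist y x < d"
      show "p \<le> (f y - f x) / (y - x)" using slope[OF y refl refl] * by metis
    qed
    then show ?thesis unfolding eventually_at using d by auto
    qed
    show ?thesis by (rule slope_eventually_bounded_between_imp_differentiable[OF bdd sep])
  qed
  then show ?thesis by (intro negligible_subset[OF neg]) auto
qed

section \<open>Absolute continuity: almost everywhere derivative and fundamental theorem\<close>

lemma absolutely_continuous_on_Icc_alt:
  "absolutely_continuous_on_Icc a b f \<longleftrightarrow>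
    (\<forall>\<epsilon>>0. \<exists>\<delta>>0. \<forall>D. interval_family a b D \<and> (\<Sum>(s, t)\<in>D. t - s) < \<delta> \<longrightarrow> (\<Sum>(s, t)\<in>D. \<bar>f t - f s\<bar>) < \<epsilon>)"
  unfolding absolutely_continuous_on_Icc_def interval_family_def by (simp only: conj_assoc)

text \<open>On an interval shorter than the \<delta> that belongs to 1, every family has increments
  of total size below 1, so the variation there is bounded. Countably many such intervals with
  rational endpoints cover the open interval.\<close>

lemma absolutely_continuous_imp_ae_differentiable:
  fixes f :: "real \<Rightarrow> real"
  assumes ac: "absolutely_continuous_on_Icc a b f"
  shows "negligible {x\<in>{a<..<b}. \<not> f differentiable (at x)}"
proof -
  obtain \<delta> where \<delta>: "\<delta> > 0"
    and ac1: "\<And>D. interval_family a b D \<Longrightarrow> (\<Sum>(s, t)\<in>D. t - s) < \<delta> \<Longrightarrow> (\<Sum>(s, t)\<in>D. \<bar>f t - f s\<bar>) < 1"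
    using ac unfolding absolutely_continuous_on_Icc_alt by (meson zero_less_one)
  let ?R = "{(p, q). p \<in> \<rat> \<and> q \<in> \<rat> \<and> a \<le> p \<and> p < q \<and> q \<le> b \<and> q - p < \<delta>}"
  let ?Z = "\<lambda>(p, q). {x\<in>{p<..<q}. \<not> f differentiable (at x)}"
  have "countable ?R" by (rule countable_subset[of _ "\<rat> \<times> \<rat>"]) (auto intro: countable_rat)
  moreover have "negligible (?Z (p, q))" if pq: "(p, q) \<in> ?R" for p q
  proof -
    have "(\<Sum>(s, t)\<in>D. \<bar>f t - f s\<bar>) \<le> 1" if D: "interval_family p q D" for D
    proof -
      have "(\<Sum>(s, t)\<in>D. t - s) \<le> q - p" using sum_increments_le[OF D, of "\<lambda>x. x"] pq by auto
      then show ?thesis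
        using ac1[OF interval_family_widen[OF D]] pq by auto
    qed
    then show ?thesis using bounded_variation_imp_ae_differentiable[of p q f 1] pq by auto
  qed
  ultimately have "negligible (\<Union>r\<in>?R. ?Z r)" by (intro negligible_countable_Union) auto
  moreover have "{x\<in>{a<..<b}. \<not> f differentiable (at x)} \<subseteq> (\<Union>r\<in>?R. ?Z r)"
  proof clarify
    fix x assume x: "x \<in> {a<..<b}" "\<not> f differentiable (at x)"
    obtain p where p: "p \<in> \<rat>" "max a (x - \<delta> / 2) < p" "p < x"
      using Rats_dense_in_real[of "max a (x - \<delta> / 2)" x] x \<delta> by auto
    obtain q where q: "q \<in> \<rat>" "x < q" "q < min b (x + \<delta> / 2)"
      using Rats_dense_in_real[of x "min b (x + \<delta> / 2)"] x \<delta> by auto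
    have "(p, q) \<in> ?R" using p q by auto
    then show "x \<in> (\<Union>r\<in>?R. ?Z r)" by (rule UN_I) (use p q x in auto)
  qed
  ultimately show ?thesis by (rule negligible_subset)
qed

text \<open>A Henstock argument. At tags outside N the gauge is the radius of good linear
  approximation. At tags in N it confines the interval to an open set of measure below \<delta>;
  there h contributes nothing and absolute continuity makes the increments of f small in
  total.\<close>

lemma absolutely_continuous_fundamental_theorem:
  fixes f :: "real \<Rightarrow> real"
  assumes ab: "a \<le> b" and ac: "absolutely_continuous_on_Icc a b f"
    and neg: "negligible N" and h0: "\<And>x. x \<in> N \<Longrightarrow> h x = 0"
    and h: "\<And>x. x \<in> {a..b} - N \<Longrightarrow> (f has_field_derivative h x) (at x)"
  shows "(h has_integral (f b - f a)) {a..b}"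
  unfolding has_integral_factor_content box_real[symmetric]
proof safe
  fix e :: real assume e: "e > 0"
  show "\<exists>d. gauge d \<and> (\<forall>p. p tagged_division_of (cbox a b) \<and> d fine p \<longrightarrow>
    norm ((\<Sum>(x, k)\<in>p. measure lborel k *\<^sub>R h x) - (f b - f a)) \<le> e * measure lborel (cbox a b))"
  proof (cases "a = b")
    \<comment> \<open>Here the permitted error is 0, and so would be the \<epsilon> of the other
      case; but both quantities vanish.\<close>
    case True
    have "norm ((\<Sum>(x, k)\<in>p. measure lborel k *\<^sub>R h x) - (f b - f a)) \<le> e * measure lborel (cbox a b)"
      if p: "p tagged_division_of (cbox a b)" for p
    proof -
      have "(\<Sum>(x, k)\<in>p. measure lborel k *\<^sub>R h x) = 0"
        using sum_content_null[OF _ p, of h] True by simp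
      then show ?thesis using True by simp
    qed
    then show ?thesis by (intro exI[of _ "\<lambda>x. ball x 1"]) (auto intro: gauge_ball)
  next
    case False
    with ab have ab': "a < b" by simp
    \<comment> \<open>Half of the permitted error e * (b - a), spent on the tags in N; the tags
      outside N get the other half.\<close>
    define \<epsilon> where "\<epsilon> = e * (b - a) / 2"
    have \<epsilon>: "\<epsilon> > 0" using e ab' by (simp add: \<epsilon>_def)
    obtain \<delta> where \<delta>: "\<delta> > 0"
      and acd: "\<And>D. interval_family a b D \<Longrightarrow> (\<Sum>(s, t)\<in>D. t - s) < \<delta> \<Longrightarrow> (\<Sum>(s, t)\<in>D. \<bar>f t - f s\<bar>) < \<epsilon>"
      using ac \<epsilon> unfolding absolutely_continuous_on_Icc_alt by meson
    obtain O' where O': "open O'" "N \<subseteq> O'" "O' \<in> lmeasurable" "measure lebesgue O' < \<delta>"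
    proof -
      have "N \<in> sets lebesgue" using neg by (auto simp: negligible_iff_null_sets)
      then obtain U where U: "open U" "N \<subseteq> U" "U - N \<in> lmeasurable" "emeasure lebesgue (U - N) < ennreal \<delta>"
        using sets_lebesgue_outer_open[of N \<delta>] \<delta> by auto
      have "U = (U - N) \<union> N" using U by auto
      moreover have "(U - N) \<union> N \<in> lmeasurable" "measure lebesgue ((U - N) \<union> N) = measure lebesgue (U - N)"
        using measure_Un_negligible[OF U(3) neg] by auto
      moreover have "measure lebesgue (U - N) < \<delta>"
        using U(3,4) \<delta> by (simp add: emeasure_eq_measure2 ennreal_less_iff)
      ultimately show ?thesis using that[of U] U by auto
    qed
    have "\<exists>d>0. (x \<in> N \<longrightarrow> ball x d \<subseteq> O') \<and>
        (x \<in> {a..b} - N \<longrightarrow> (\<forall>y. \<bar>y - x\<bar> < d \<longrightarrow> \<bar>f y - f x - (y - x) * h x\<bar> \<le> e / 2 * \<bar>y - x\<bar>))" for x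
    proof (cases "x \<in> N")
      case True
      then show ?thesis using O'(1,2) by (meson DiffD2 openE subsetD)
    next
      case False
      show ?thesis
      proof (cases "x \<in> {a..b}")
        case True
        then have "(f has_derivative (\<lambda>y. h x * y)) (at x)"
          using h[of x] False unfolding has_field_derivative_def by simp
        then obtain d where "d > 0" "\<And>y. norm (y - x) < d \<Longrightarrow> norm (f y - f x - h x * (y - x)) \<le> e / 2 * norm (y - x)"
          unfolding has_derivative_at_alt using e by (meson half_gt_zero)
        then show ?thesis using False by (intro exI[of _ d]) (auto simp: mult.commute)
      qed (use False in \<open>auto intro: exI[of _ 1]\<close>)
    qed
    then obtain d where d: "\<And>x. d x > 0" and dN: "\<And>x. x \<in> N \<Longrightarrow> ball x (d x) \<subseteq> O'"
      and dh: "\<And>x y. x \<in> {a..b} - N \<Longrightarrow> \<bar>y - x\<bar> < d x \<Longrightarrow> \<bar>f y - f x - (y - x) * h x\<bar> \<le> e / 2 * \<bar>y - x\<bar>"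
      by metis
    have "\<bar>(\<Sum>(x, k)\<in>p. measure lborel k * h x) - (f b - f a)\<bar> \<le> e * (b - a)"
      if p: "p tagged_division_of (cbox a b)" and fine: "(\<lambda>x. ball x (d x)) fine p" for p
    proof -
      have finp: "finite p" using p by (rule tagged_division_of_finite)
      have pbox: "\<exists>u v. K = {u..v} \<and> u \<le> x \<and> x \<le> v \<and> a \<le> u \<and> v \<le> b \<and> K \<subseteq> ball x (d x)" if xK: "(x, K) \<in> p" for x K
      proof -
        obtain u v where K: "K = {u..v}" using tagged_division_ofD(4)[OF p xK] by auto
        moreover have x: "u \<le> x" "x \<le> v" using tagged_division_ofD(2)[OF p xK] K by auto
        moreover have "{u..v} \<subseteq> {a..b}" using tagged_division_ofD(3)[OF p xK] K by auto
        then have "a \<le> u" "v \<le> b" using x by auto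
        moreover have "K \<subseteq> ball x (d x)" using fine xK by (auto simp: fine_def)
        ultimately show ?thesis by blast
      qed
      have adda: "(\<Sum>(x,K)\<in>p. f (Sup K) - f (Inf K)) = f b - f a" "(\<Sum>(x,K)\<in>p. Sup K - Inf K) = b - a"
        using additive_tagged_division_1[OF ab, of p f] additive_tagged_division_1[OF ab, of p "\<lambda>x. x"] p by auto
      let ?t = "\<lambda>(x, K). measure lborel K * h x - (f (Sup K) - f (Inf K))"
      let ?pN = "{z\<in>p. fst z \<in> N}" and ?p' = "{z\<in>p. fst z \<notin> N}"
      have "(\<Sum>(x, k)\<in>p. measure lborel k * h x) - (f b - f a) = (\<Sum>z\<in>p. ?t z)"
        unfolding adda(1)[symmetric] by (subst sum_subtractf[symmetric]) (auto intro!: sum.cong)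
      also have "\<dots> = (\<Sum>z\<in>?pN. ?t z) + (\<Sum>z\<in>?p'. ?t z)"
        using finp by (subst sum.union_disjoint[symmetric]) (auto intro!: sum.cong)
      finally have eq: "(\<Sum>(x, k)\<in>p. measure lborel k * h x) - (f b - f a) = (\<Sum>z\<in>?pN. ?t z) + (\<Sum>z\<in>?p'. ?t z)" .
      \<comment> \<open>Each interval is cut at its tag x; the linear approximation at x errs by at
        most e / 2 times the length on either piece.\<close>
      have "\<bar>\<Sum>z\<in>?p'. ?t z\<bar> \<le> (\<Sum>(x, K)\<in>?p'. e / 2 * (Sup K - Inf K))"
      proof (rule order_trans[OF sum_abs sum_mono], clarify)
        fix x K assume xK: "(x, K) \<in> p" "fst (x, K) \<notin> N"
        then obtain u v where uv: "K = {u..v}" "u \<le> x" "x \<le> v" "a \<le> u" "v \<le> b" "K \<subseteq> ball x (d x)"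
          using pbox[OF xK(1)] by (elim exE conjE)
        have "u \<in> K" "v \<in> K" using uv(1-3) by auto
        then have "u \<in> ball x (d x)" "v \<in> ball x (d x)" using uv(6) by blast+
        then have *: "\<bar>u - x\<bar> < d x" "\<bar>v - x\<bar> < d x" by (auto simp: dist_real_def)
        have x: "x \<in> {a..b} - N" using xK uv by auto
        have "\<bar>f v - f x - (v - x) * h x\<bar> \<le> e / 2 * (v - x)" "\<bar>f u - f x - (u - x) * h x\<bar> \<le> e / 2 * (x - u)"
          using dh[OF x *(1)] dh[OF x *(2)] uv by auto
        moreover have "measure lborel K * h x - (f (Sup K) - f (Inf K)) =
           - (f v - f x - (v - x) * h x) + (f u - f x - (u - x) * h x)"
          using uv by (simp add: algebra_simps)
        moreover have "e / 2 * (Sup K - Inf K) = e / 2 * (v - x) + e / 2 * (x - u)"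
          using uv by (simp add: field_simps)
        ultimately show "\<bar>measure lborel K * h x - (f (Sup K) - f (Inf K))\<bar> \<le> e / 2 * (Sup K - Inf K)" by linarith
      qed
      also have "\<dots> \<le> (\<Sum>(x, K)\<in>p. e / 2 * (Sup K - Inf K))"
      proof (rule sum_mono2[OF finp], goal_cases)
        case (2 z)
        then obtain x K where "z = (x, K)" "(x, K) \<in> p" by (cases z) auto
        then show ?case using pbox[of x K] e by auto
      qed auto
      also have "\<dots> = e / 2 * (\<Sum>(x, K)\<in>p. Sup K - Inf K)" unfolding sum_distrib_left by (intro sum.cong) auto
      finally have p': "\<bar>\<Sum>z\<in>?p'. ?t z\<bar> \<le> e / 2 * (b - a)" using adda(2) by simp
      \<comment> \<open>Members of an interval family have positive length, so degenerate intervals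
        of the division are set aside; f has no increment over them.\<close>
      let ?q = "{z\<in>?pN. Inf (snd z) < Sup (snd z)}"
      let ?io = "\<lambda>z :: real \<times> real set. (Inf (snd z), Sup (snd z))"
      have qK: "\<exists>x u v. z = (x, {u..v}) \<and> u < v \<and> u \<le> x \<and> x \<le> v \<and> a \<le> u \<and> v \<le> b \<and> {u..v} \<subseteq> O' \<and> ?io z = (u, v)" if "z \<in> ?q" for z
      proof -
        obtain x K where z: "z = (x, K)" "(x, K) \<in> p" "x \<in> N" using \<open>z \<in> ?q\<close> by (cases z) auto
        obtain u v where uv: "K = {u..v}" "u \<le> x" "x \<le> v" "a \<le> u" "v \<le> b" "K \<subseteq> ball x (d x)"
          using pbox[OF z(2)] by (elim exE conjE)
        have "u < v" using \<open>z \<in> ?q\<close> z uv by auto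
        then show ?thesis using z uv dN[OF z(3)] by (intro exI[of _ x] exI[of _ u] exI[of _ v]) auto
      qed
      have disj: "interior (snd z) \<inter> interior (snd z') = {}" if "z \<in> p" "z' \<in> p" "z \<noteq> z'" for z z'
        using tagged_division_ofD(5)[OF p, of "fst z" "snd z" "fst z'" "snd z'"] that by auto
      have sep: "t \<le> s' \<or> t' \<le> s" if zz: "z \<in> ?q" "z' \<in> ?q" "z \<noteq> z'" "?io z = (s, t)" "?io z' = (s', t')" for z z' s t s' t'
      proof (rule ccontr)
        assume n: "\<not> ?thesis"
        obtain x u v where z: "z = (x, {u..v})" "?io z = (u, v)" using qK[OF zz(1)] by blast
        obtain x' u' v' where z': "z' = (x', {u'..v'})" "?io z' = (u', v')" using qK[OF zz(2)] by blast
        have "interior (snd z) \<inter> interior (snd z') = {}" using disj[of z z'] zz by blast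
        moreover have "interior (snd z) = {s<..<t}" "interior (snd z') = {s'<..<t'}"
          using z z' zz(4,5) by auto
        ultimately have dj: "{s<..<t} \<inter> {s'<..<t'} = {}" by simp
        have "s < t" "s' < t'" using zz by auto
        then have "max s s' < min t t'" using n by auto
        then obtain w where "max s s' < w" "w < min t t'" using dense by blast
        then have "w \<in> {s<..<t} \<inter> {s'<..<t'}" by auto
        then show False unfolding dj by simp
      qed
      have inj: "inj_on ?io ?q"
      proof (rule inj_onI, rule ccontr)
        fix z z' assume *: "z \<in> ?q" "z' \<in> ?q" "?io z = ?io z'" "z \<noteq> z'"
        then show False using sep[OF *(1,2,4) refl refl] by auto
      qed
      have fam: "interval_family a b (?io ` ?q)"
      proof (rule interval_familyI)
        show "finite (?io ` ?q)" using finp by auto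
        fix s t assume st: "(s, t) \<in> ?io ` ?q"
        then show "a \<le> s \<and> s < t \<and> t \<le> b" using qK by fastforce
        fix s' t' assume st': "(s', t') \<in> ?io ` ?q" "(s, t) \<noteq> (s', t')"
        obtain z z' where "z \<in> ?q" "z' \<in> ?q" "?io z = (s, t)" "?io z' = (s', t')" using st st' by blast
        then show "t \<le> s' \<or> t' \<le> s" using sep[of z z' s t s' t'] st' by force
      qed
      have "(\<Sum>(s, t)\<in>?io ` ?q. t - s) = (\<Sum>z\<in>?q. measure lebesgue {Inf (snd z)<..<Sup (snd z)})"
        by (subst sum.reindex[OF inj]) (auto intro!: sum.cong)
      also have "\<dots> = measure lebesgue (\<Union>z\<in>?q. {Inf (snd z)<..<Sup (snd z)})"
      proof (rule measure_finite_Union[symmetric])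
        show "disjoint_family_on (\<lambda>z. {Inf (snd z)<..<Sup (snd z)}) ?q"
          unfolding disjoint_family_on_def
        proof (intro ballI impI)
          fix z z' assume *: "z \<in> ?q" "z' \<in> ?q" "z \<noteq> z'"
          then show "{Inf (snd z)<..<Sup (snd z)} \<inter> {Inf (snd z')<..<Sup (snd z')} = {}"
            using sep[OF * refl refl] by auto
        qed
      qed (use finp in auto)
      also have "\<dots> \<le> measure lebesgue O'"
      proof (rule measure_mono_fmeasurable[OF _ _ O'(3)])
        show "(\<Union>z\<in>?q. {Inf (snd z)<..<Sup (snd z)}) \<subseteq> O'"
        proof (rule UN_least)
          fix z assume "z \<in> ?q"
          then obtain x u v where "?io z = (u, v)" "{u..v} \<subseteq> O'" using qK by meson
          then show "{Inf (snd z)<..<Sup (snd z)} \<subseteq> O'" by auto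
        qed
      qed (use finp in auto)
      finally have "(\<Sum>(s, t)\<in>?io ` ?q. t - s) < \<delta>" using O'(4) by simp
      then have "(\<Sum>(s, t)\<in>?io ` ?q. \<bar>f t - f s\<bar>) < \<epsilon>" by (rule acd[OF fam])
      moreover have "(\<Sum>(s, t)\<in>?io ` ?q. \<bar>f t - f s\<bar>) = (\<Sum>z\<in>?q. \<bar>f (Sup (snd z)) - f (Inf (snd z))\<bar>)"
        by (subst sum.reindex[OF inj]) auto
      moreover have "(\<Sum>z\<in>?q. \<bar>f (Sup (snd z)) - f (Inf (snd z))\<bar>) = (\<Sum>z\<in>?pN. \<bar>f (Sup (snd z)) - f (Inf (snd z))\<bar>)"
      proof (rule sum.mono_neutral_left)
        show "\<forall>z\<in>?pN - ?q. \<bar>f (Sup (snd z)) - f (Inf (snd z))\<bar> = 0"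
        proof
          fix z assume z: "z \<in> ?pN - ?q"
          then obtain x K where zx: "z = (x, K)" "(x, K) \<in> p" by (cases z) auto
          obtain u v where uv: "K = {u..v}" "u \<le> x" "x \<le> v" using pbox[OF zx(2)] by (elim exE conjE)
          then have "u = v" using z zx by auto
          then show "\<bar>f (Sup (snd z)) - f (Inf (snd z))\<bar> = 0" using zx uv by auto
        qed
      qed (use finp in auto)
      moreover have "\<bar>\<Sum>z\<in>?pN. ?t z\<bar> \<le> (\<Sum>z\<in>?pN. \<bar>f (Sup (snd z)) - f (Inf (snd z))\<bar>)"
        by (rule order_trans[OF sum_abs sum_mono]) (auto simp: h0)
      ultimately have "\<bar>\<Sum>z\<in>?pN. ?t z\<bar> \<le> \<epsilon>" by linarith
      then show ?thesis using p' unfolding eq \<epsilon>_def by (simp add: field_simps)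
    qed
    then show ?thesis using ab
      by (intro exI[of _ "\<lambda>x. ball x (d x)"]) (auto intro!: gauge_ball_dependent d)
  qed
qed


section \<open>A weighted Hoelder inequality\<close>

text \<open>\<open>deriv f\<close> has unspecified values where f is not differentiable and need not
  be Borel, so a Borel function g that agrees with it almost everywhere takes its place. If the
  integral of |g| is infinite there is nothing to show; otherwise the Lebesgue integral of g
  coincides with the gauge integral of the fundamental theorem.\<close>

lemma absolutely_continuous_increment_le:
  fixes f :: "real \<Rightarrow> real"
  assumes ab: "a \<le> b" and ac: "absolutely_continuous_on_Icc a b f"
  obtains g where "g \<in> borel_measurable borel"
    and "AE x in lborel. x \<in> {a<..<b} \<longrightarrow> g x = deriv f x"
    and "ennreal \<bar>f b - f a\<bar> \<le> (\<integral>\<^sup>+x\<in>{a<..<b}. ennreal \<bar>g x\<bar> \<partial>lborel)"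
proof -
  define N where "N = {x\<in>{a<..<b}. \<not> f differentiable (at x)} \<union> {a, b}"
  have negN: "negligible N"
    unfolding N_def using absolutely_continuous_imp_ae_differentiable[OF ac] by (intro negligible_Un) auto
  define h where "h x = (if x \<in> N \<or> x \<notin> {a..b} then 0 else deriv f x)" for x
  have hi: "(h has_integral (f b - f a)) {a..b}"
  proof (rule absolutely_continuous_fundamental_theorem[OF ab ac negN])
    fix x assume "x \<in> {a..b} - N"
    then have "x \<in> {a<..<b}" "f differentiable (at x)" "h x = deriv f x" by (auto simp: N_def h_def)
    then show "(f has_field_derivative h x) (at x)" by (simp add: DERIV_deriv_iff_real_differentiable)
  qed (simp add: h_def)
  have ind: "(\<lambda>x. indicator {a..b} x *\<^sub>R h x) = h" by (auto simp: h_def indicator_def)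
  have "h \<in> borel_measurable (lebesgue_on {a..b})"
    using hi integrable_imp_measurable by blast
  then have "(\<lambda>x. indicator {a..b} x *\<^sub>R h x) \<in> borel_measurable lebesgue"
    by (subst borel_measurable_restrict_space_iff[symmetric]) auto
  then have hm: "h \<in> borel_measurable lebesgue" unfolding ind .
  obtain g where g: "g \<in> borel_measurable lborel" "AE x in lborel. h x = g x"
    using completion_ex_borel_measurable_real[OF hm] by (elim bexE)
  have [measurable]: "g \<in> borel_measurable borel" using g(1) by simp
  obtain Z where Z: "{x. h x \<noteq> g x} \<subseteq> Z" "Z \<in> null_sets lborel"
    using g(2) unfolding eventually_ae_filter by auto
  have negZ: "negligible Z"
    using Z(2) by (metis negligible_iff_null_sets null_sets_completionI)
  have "AE x in lebesgue. x \<notin> N" using negN AE_not_in negligible_iff_null_sets by blast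
  then have "AE x in lborel. x \<notin> N" by (simp add: AE_completion_iff)
  then have aeg: "AE x in lborel. x \<in> {a<..<b} \<longrightarrow> g x = deriv f x"
    using g(2)
  proof eventually_elim
    case (elim x)
    then show ?case by (auto simp: h_def)
  qed
  have "AE x in lborel. x \<notin> {a, b}"
    by (intro AE_not_in finite_imp_null_set_lborel) simp
  then have out: "AE x in lborel. x \<notin> {a<..<b} \<longrightarrow> g x = 0"
    using g(2)
  proof eventually_elim
    case (elim x)
    then show ?case by (auto simp: h_def)
  qed
  have eq: "(\<integral>\<^sup>+x\<in>{a<..<b}. ennreal \<bar>g x\<bar> \<partial>lborel) = (\<integral>\<^sup>+x. ennreal \<bar>g x\<bar> \<partial>lborel)"
  proof (rule nn_integral_cong_AE)
    show "AE x in lborel. ennreal \<bar>g x\<bar> * indicator {a<..<b} x = ennreal \<bar>g x\<bar>"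
      using out by eventually_elim (simp add: indicator_def)
  qed
  have "ennreal \<bar>f b - f a\<bar> \<le> (\<integral>\<^sup>+x. ennreal \<bar>g x\<bar> \<partial>lborel)"
  proof (cases "(\<integral>\<^sup>+x. ennreal \<bar>g x\<bar> \<partial>lborel) = \<infinity>")
    case False
    then have int: "integrable lborel g"
      by (intro integrableI_bounded) (auto simp: top.not_eq_extremum)
    have "(g has_integral (integral\<^sup>L lborel g)) UNIV" by (rule has_integral_integral_lborel[OF int])
    moreover have "(g has_integral (f b - f a)) UNIV"
    proof (rule has_integral_spike[OF negZ])
      have "(h has_integral (f b - f a)) UNIV \<longleftrightarrow> (h has_integral (f b - f a)) {a..b}"
        by (subst has_integral_restrict_UNIV[symmetric, of h _ "{a..b}"]) (rule has_integral_cong, auto simp: h_def)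
      then show "(h has_integral (f b - f a)) UNIV" using hi by simp
      show "g x = h x" if "x \<in> UNIV - Z" for x
      proof (rule ccontr)
        assume "g x \<noteq> h x"
        then have "x \<in> {x. h x \<noteq> g x}" by (intro CollectI) (rule not_sym)
        then show False using subsetD[OF Z(1)] that by blast
      qed
    qed
    ultimately have "integral\<^sup>L lborel g = f b - f a" by (rule has_integral_unique)
    then have "\<bar>f b - f a\<bar> \<le> (\<integral>x. \<bar>g x\<bar> \<partial>lborel)" by (metis integral_abs_bound)
    moreover have "(\<integral>\<^sup>+x. ennreal \<bar>g x\<bar> \<partial>lborel) = ennreal (\<integral>x. \<bar>g x\<bar> \<partial>lborel)"
      using int by (intro nn_integral_eq_integral) auto
    ultimately show ?thesis by (simp add: ennreal_leI)
  qed simp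
  then show ?thesis using that[of g] aeg eq by simp
qed

text \<open>A weighted Young inequality, read off from Bernoulli's inequality at y = l * m * x, so
  that all exponents are natural numbers. For m = r * (1 - ln r) the first term is l ^ k times the
  energy density and the second is k / l times |ds / dr|.\<close>

lemma Young_power:
  fixes x m l :: real
  assumes "0 \<le> x" "0 < m" "0 < l"
  shows "real (k + 1) * x \<le> l ^ k * (m ^ k * x ^ (k + 1)) + real k / (l * m)"
proof -
  define y where "y = l * m * x"
  have y: "y \<ge> 0" using assms by (simp add: y_def)
  have "1 + real (k + 1) * (y - 1) \<le> (1 + (y - 1)) ^ (k + 1)"
    using y by (intro Bernoulli_inequality) auto
  then have "real (k + 1) * y \<le> y ^ (k + 1) + real k" by (simp add: algebra_simps)
  then have "real (k + 1) * y / (l * m) \<le> (y ^ (k + 1) + real k) / (l * m)"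
    using assms by (intro divide_right_mono) auto
  moreover have "real (k + 1) * y / (l * m) = real (k + 1) * x" using assms by (simp add: y_def)
  moreover have "(y ^ (k + 1) + real k) / (l * m) = l ^ k * (m ^ k * x ^ (k + 1)) + real k / (l * m)"
    using assms by (simp add: y_def power_mult_distrib field_simps)
  ultimately show ?thesis by simp
qed

lemma DERIV_ln_one_minus_ln:
  fixes r :: real
  assumes "0 < r" "r < exp 1"
  shows "((\<lambda>r. - ln (1 - ln r)) has_field_derivative 1 / (r * (1 - ln r))) (at r)"
proof -
  have "ln r < 1" using assms ln_less_cancel_iff[of r "exp 1"] by simp
  then show ?thesis using assms by (auto intro!: derivative_eq_intros simp: field_simps)
qed

text \<open>Hoelder's inequality, by integrating Young's inequality and choosing l afterwards. The
  substitution is not carried out: s = ln (1 - ln r) enters only because - s is a primitive of 1 /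
  (r * (1 - ln r)), whose integral is the length of the interval in s.\<close>

lemma log_weighted_Hoelder:
  fixes v :: "real \<Rightarrow> real"
  assumes r: "0 < r0" "r0 \<le> r1" "r1 < 1" and E: "0 \<le> E"
    and ac: "absolutely_continuous_on_Icc r0 r1 v"
    and en: "(\<integral>\<^sup>+r\<in>{r0<..<r1}. ennreal (r ^ k * \<bar>deriv v r\<bar> ^ (k + 1) * (1 - ln r) ^ k) \<partial>lborel) \<le> ennreal E"
  shows "\<bar>v r1 - v r0\<bar> ^ (k + 1) \<le> E * (ln (1 - ln r0) - ln (1 - ln r1)) ^ k"
proof -
  define D where "D = ln (1 - ln r0) - ln (1 - ln r1)"
  define A where "A = \<bar>v r1 - v r0\<bar>"
  obtain g where [measurable]: "g \<in> borel_measurable borel"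
    and ae: "AE x in lborel. x \<in> {r0<..<r1} \<longrightarrow> g x = deriv v x"
    and le: "ennreal A \<le> (\<integral>\<^sup>+x\<in>{r0<..<r1}. ennreal \<bar>g x\<bar> \<partial>lborel)"
    using absolutely_continuous_increment_le[OF r(2) ac] unfolding A_def by blast
  have eng: "(\<integral>\<^sup>+r\<in>{r0<..<r1}. ennreal (r ^ k * \<bar>g r\<bar> ^ (k + 1) * (1 - ln r) ^ k) \<partial>lborel) \<le> ennreal E"
  proof -
    have "(\<integral>\<^sup>+r\<in>{r0<..<r1}. ennreal (r ^ k * \<bar>g r\<bar> ^ (k + 1) * (1 - ln r) ^ k) \<partial>lborel) =
      (\<integral>\<^sup>+r\<in>{r0<..<r1}. ennreal (r ^ k * \<bar>deriv v r\<bar> ^ (k + 1) * (1 - ln r) ^ k) \<partial>lborel)"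
    proof (rule nn_integral_cong_AE)
      show "AE r in lborel. ennreal (r ^ k * \<bar>g r\<bar> ^ (k + 1) * (1 - ln r) ^ k) * indicator {r0<..<r1} r =
        ennreal (r ^ k * \<bar>deriv v r\<bar> ^ (k + 1) * (1 - ln r) ^ k) * indicator {r0<..<r1} r"
        using ae by eventually_elim (simp add: indicator_def)
    qed
    then show ?thesis using en by simp
  qed
  have lnr: "ln x < 0" if "0 < x" "x < 1" for x :: real using that by simp
  have D0: "0 \<le> D"
  proof -
    have "ln r1 < 0" "ln r0 \<le> ln r1" using r by auto
    then show ?thesis by (simp add: D_def)
  qed
  have intD: "(\<integral>\<^sup>+x. ennreal (1 / (x * (1 - ln x))) * indicator {r0..r1} x \<partial>lborel) = ennreal D"
  proof -
    have "(\<integral>\<^sup>+x. ennreal (1 / (x * (1 - ln x))) * indicator {r0..r1} x \<partial>lborel) =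
       ennreal (- ln (1 - ln r1) - (- ln (1 - ln r0)))"
    proof (rule nn_integral_FTC_Icc)
      fix x assume x: "x \<in> {r0..r1}"
      have "x < exp 1" using x r by (smt (verit) atLeastAtMost_iff exp_ge_add_one_self)
      then show "((\<lambda>r. - ln (1 - ln r)) has_real_derivative 1 / (x * (1 - ln x))) (at x)"
        using DERIV_ln_one_minus_ln[of x] x r by auto
      have "ln x < 0" using x r by simp
      then have "0 \<le> 1 - ln x" by linarith
      then have "0 \<le> x * (1 - ln x)" using x r by (intro mult_nonneg_nonneg) (linarith | auto)+
      then show "0 \<le> 1 / (x * (1 - ln x))" by simp
    qed (use r in auto)
    then show ?thesis by (simp add: D_def)
  qed
  have main: "real (k + 1) * A \<le> l ^ k * E + real k * D / l" if l: "l > 0" for l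
  proof -
    have "ennreal (real (k + 1) * A) = ennreal (real (k + 1)) * ennreal A" by (simp add: ennreal_mult A_def)
    also have "\<dots> \<le> ennreal (real (k + 1)) * (\<integral>\<^sup>+x\<in>{r0<..<r1}. ennreal \<bar>g x\<bar> \<partial>lborel)"
      by (rule mult_left_mono[OF le]) simp
    also have "\<dots> = (\<integral>\<^sup>+x\<in>{r0<..<r1}. ennreal (real (k + 1) * \<bar>g x\<bar>) \<partial>lborel)"
      by (subst nn_integral_cmult[symmetric]) (auto intro!: nn_integral_cong simp: ennreal_mult mult.assoc)
    also have "\<dots> \<le> (\<integral>\<^sup>+x. ennreal (l ^ k) * (ennreal (x ^ k * \<bar>g x\<bar> ^ (k + 1) * (1 - ln x) ^ k) * indicator {r0<..<r1} x)
         + ennreal (real k / l) * (ennreal (1 / (x * (1 - ln x))) * indicator {r0..r1} x) \<partial>lborel)"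
    proof (rule nn_integral_mono)
      fix x
      show "ennreal (real (k + 1) * \<bar>g x\<bar>) * indicator {r0<..<r1} x \<le>
         ennreal (l ^ k) * (ennreal (x ^ k * \<bar>g x\<bar> ^ (k + 1) * (1 - ln x) ^ k) * indicator {r0<..<r1} x)
         + ennreal (real k / l) * (ennreal (1 / (x * (1 - ln x))) * indicator {r0..r1} x)"
      proof (cases "x \<in> {r0<..<r1}")
        case True
        then have x: "0 < x" "x < 1" using r by auto
        have l1: "0 < 1 - ln x" using lnr[OF x] by linarith
        have m: "0 < x * (1 - ln x)" using x(1) l1 by (rule mult_pos_pos)
        have "real (k + 1) * \<bar>g x\<bar> \<le> l ^ k * ((x * (1 - ln x)) ^ k * \<bar>g x\<bar> ^ (k + 1)) + real k / (l * (x * (1 - ln x)))"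
          using m l by (intro Young_power) auto
        also have "\<dots> = l ^ k * (x ^ k * \<bar>g x\<bar> ^ (k + 1) * (1 - ln x) ^ k) + real k / l * (1 / (x * (1 - ln x)))"
          by (simp add: power_mult_distrib mult_ac)
        finally have "ennreal (real (k + 1) * \<bar>g x\<bar>) \<le>
          ennreal (l ^ k * (x ^ k * \<bar>g x\<bar> ^ (k + 1) * (1 - ln x) ^ k) + real k / l * (1 / (x * (1 - ln x))))"
          by (rule ennreal_leI)
        also have "\<dots> = ennreal (l ^ k) * ennreal (x ^ k * \<bar>g x\<bar> ^ (k + 1) * (1 - ln x) ^ k) + ennreal (real k / l) * ennreal (1 / (x * (1 - ln x)))"
          using m l x l1
          by (subst ennreal_plus; (subst ennreal_mult)?) (auto simp: ennreal_mult[symmetric])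
        finally show ?thesis using True by simp
      qed simp
    qed
    also have "\<dots> = ennreal (l ^ k) * (\<integral>\<^sup>+x. ennreal (x ^ k * \<bar>g x\<bar> ^ (k + 1) * (1 - ln x) ^ k) * indicator {r0<..<r1} x \<partial>lborel)
         + ennreal (real k / l) * (\<integral>\<^sup>+x. ennreal (1 / (x * (1 - ln x))) * indicator {r0..r1} x \<partial>lborel)"
      by (subst nn_integral_add) (auto simp: nn_integral_cmult)
    also have "\<dots> \<le> ennreal (l ^ k) * ennreal E + ennreal (real k / l) * ennreal D"
      unfolding intD by (intro add_mono mult_left_mono eng) auto
    also have "\<dots> = ennreal (l ^ k * E + real k * D / l)"
      using l E D0 by (simp add: ennreal_mult[symmetric] ennreal_plus[symmetric] del: ennreal_plus)
    finally show ?thesis using l E D0 by (subst (asm) ennreal_le_iff) auto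
  qed
  show ?thesis
  proof (cases "A = 0")
    case True
    then show ?thesis using E D0 by (simp add: A_def D_def)
  next
    case False
    then have A: "A > 0" by (simp add: A_def)
    \<comment> \<open>The parameter l will be D / A, so D must be positive; D = 0 would force r0 =
      r1 and hence A = 0.\<close>
    have "D \<noteq> 0"
    proof
      assume "D = 0"
      have "r0 = r1"
      proof (rule ccontr)
        assume "r0 \<noteq> r1"
        then have "ln r0 < ln r1" "ln r1 < 0" using r by auto
        then have "ln (1 - ln r1) < ln (1 - ln r0)" by simp
        then show False using \<open>D = 0\<close> by (simp add: D_def)
      qed
      then show False using A by (simp add: A_def)
    qed
    then have D: "D > 0" using D0 by simp
    \<comment> \<open>this l makes the last term \<open>k * A\<close>, to be absorbed on the left\<close>
    have "real (k + 1) * A \<le> (D / A) ^ k * E + real k * D / (D / A)" using A D by (intro main) simp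
    then have "A \<le> (D / A) ^ k * E" using A D by (simp add: algebra_simps)
    then have "A * A ^ k \<le> (D / A) ^ k * E * A ^ k" using A by (intro mult_right_mono) auto
    then show ?thesis using A by (simp add: A_def[symmetric] D_def[symmetric] power_divide mult.commute)
  qed
qed


section \<open>Radial integrals over the unit ball\<close>

text \<open>A uniformly distributed point of the ball has norm below exp (- a) with probability exp
  (- n * a), so - ln (norm x) is exponential with rate n. This plays the part of polar coordinates
  for radial integrands.\<close>

lemma distributed_neg_ln_norm:
  "distributed (uniform_measure lborel (ball (0 :: 'a::euclidean_space) 1)) lborel (\<lambda>x. - ln (norm x))
     (exponential_density (real DIM('a)))"
proof -
  let ?B = "ball (0 :: 'a) 1" and ?n = "real DIM('a)"
  let ?M = "uniform_measure lborel ?B"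
  define c where "c = unit_ball_vol ?n"
  have c: "c > 0" unfolding c_def by (rule unit_ball_vol_pos) simp
  have vol: "emeasure lborel (ball (0 :: 'a) r) = ennreal (c * r ^ DIM('a))" if "r \<ge> 0" for r
    unfolding c_def using that by (rule emeasure_ball)
  interpret prob_space ?M
    by (rule prob_space_uniform_measure) (use vol[of 1] c in auto)
  show ?thesis
  proof (rule exponential_distributedI)
    show "(\<lambda>x. - ln (norm x)) \<in> borel_measurable ?M" by measurable
    show "0 < ?n" by simp
    fix a :: real assume a: "0 \<le> a"
    let ?r = "exp (- a)"
    \<comment> \<open>Because \<open>ln 0 = 0\<close>, the origin satisfies - ln (norm x) \<le> a.
      It is therefore taken out of the small ball, which leaves the measure unchanged.\<close>
    have eq: "?B \<inter> {x. - ln (norm x) \<le> a} = ?B - (ball 0 ?r - {0})"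
    proof (intro set_eqI)
      fix x :: 'a
      show "x \<in> ?B \<inter> {x. - ln (norm x) \<le> a} \<longleftrightarrow> x \<in> ?B - (ball 0 ?r - {0})"
      proof (cases "x = 0")
        case False
        then have "- ln (norm x) \<le> a \<longleftrightarrow> ?r \<le> norm x"
          using ln_ge_iff[of "norm x" "- a"] by auto
        then show ?thesis using False by (auto simp: not_less)
      qed (use a in simp)
    qed
    have fin: "emeasure lborel (ball (0 :: 'a) ?r - {0}) = ennreal (c * ?r ^ DIM('a))"
      using vol[of ?r] by (subst emeasure_Diff_null_set) (auto intro!: null_setsI)
    have "emeasure lborel (?B - (ball 0 ?r - {0})) = ennreal c - ennreal (c * ?r ^ DIM('a))"
    proof (subst emeasure_Diff)
      have "?r \<le> 1" using a by simp
      then show "ball (0 :: 'a) ?r - {0} \<subseteq> ?B" by (meson Diff_subset order_trans subset_ball)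
    qed (use vol[of 1] in \<open>auto simp: fin\<close>)
    also have "\<dots> = ennreal (c * (1 - exp (- a * ?n)))"
      using c by (subst ennreal_minus) (auto simp: algebra_simps exp_of_nat_mult[symmetric])
    finally have e: "emeasure lborel (?B \<inter> {x. - ln (norm x) \<le> a}) = ennreal (c * (1 - exp (- a * ?n)))"
      unfolding eq .
    have "emeasure ?M {x \<in> space ?M. - ln (norm x) \<le> a} =
        emeasure lborel (?B \<inter> {x. - ln (norm x) \<le> a}) / emeasure lborel ?B"
      by (subst emeasure_uniform_measure) (auto simp: space_uniform_measure)
    also have "\<dots> = ennreal (c * (1 - exp (- a * ?n))) / ennreal c" unfolding e using vol[of 1] by simp
    also have "\<dots> = ennreal (1 - exp (- a * ?n))"
      using c a by (subst divide_ennreal) auto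
    also have "\<dots> = 1 - ennreal (exp (- a * ?n))" by (subst ennreal_1[symmetric], subst ennreal_minus) auto
    finally show "emeasure ?M {x \<in> space ?M. - ln (norm x) \<le> a} = 1 - ennreal (exp (- a * ?n))" .
  qed
qed

lemma nn_integral_ball_neg_ln_norm:
  fixes F :: "real \<Rightarrow> ennreal"
  assumes [measurable]: "F \<in> borel_measurable borel"
  shows "(\<integral>\<^sup>+ x\<in>ball (0 :: 'a::euclidean_space) 1. F (- ln (norm x)) \<partial>lborel) =
    ennreal (unit_ball_vol (real DIM('a))) * (\<integral>\<^sup>+ t\<in>{0..}. ennreal (real DIM('a) * exp (- (real DIM('a) * t))) * F t \<partial>lborel)"
proof -
  let ?B = "ball (0 :: 'a) 1" and ?c = "unit_ball_vol (real DIM('a))"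
  have c: "?c > 0" by (rule unit_ball_vol_pos) simp
  have vol: "emeasure lborel ?B = ennreal ?c" using emeasure_ball[of 1 "0 :: 'a"] by simp
  have "(\<integral>\<^sup>+ t. ennreal (exponential_density (real DIM('a)) t) * F t \<partial>lborel) =
      (\<integral>\<^sup>+ x. F (- ln (norm x)) \<partial>uniform_measure lborel ?B)"
    by (rule distributed_nn_integral[OF distributed_neg_ln_norm]) simp
  also have "\<dots> = (\<integral>\<^sup>+ x\<in>?B. F (- ln (norm x)) \<partial>lborel) / ennreal ?c"
    by (subst nn_integral_uniform_measure) (auto simp: vol)
  finally have "ennreal ?c * (\<integral>\<^sup>+ t. ennreal (exponential_density (real DIM('a)) t) * F t \<partial>lborel) =
      ennreal ?c * ((\<integral>\<^sup>+ x\<in>?B. F (- ln (norm x)) \<partial>lborel) / ennreal ?c)" by simp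
  also have "\<dots> = (\<integral>\<^sup>+ x\<in>?B. F (- ln (norm x)) \<partial>lborel)"
  proof -
    have "ennreal ?c \<noteq> 0" using c by (metis ennreal_eq_0_iff not_le)
    then show ?thesis
      by (subst ennreal_times_divide, subst mult.commute, intro mult_divide_eq_ennreal) auto
  qed
  finally have "ennreal ?c * (\<integral>\<^sup>+ t. ennreal (exponential_density (real DIM('a)) t) * F t \<partial>lborel) =
      (\<integral>\<^sup>+ x\<in>?B. F (- ln (norm x)) \<partial>lborel)" .
  moreover have "(\<integral>\<^sup>+ t. ennreal (exponential_density (real DIM('a)) t) * F t \<partial>lborel) =
      (\<integral>\<^sup>+ t\<in>{0..}. ennreal (real DIM('a) * exp (- (real DIM('a) * t))) * F t \<partial>lborel)"
    by (rule nn_integral_cong) (simp add: exponential_density_def indicator_def mult.commute[of "real DIM('a)"])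
  ultimately show ?thesis by simp
qed


section \<open>The one-dimensional double-exponential inequality\<close>

lemma le_if_power_le:
  fixes a b :: "'a::linordered_semidom"
  assumes "a ^ n \<le> b ^ n" "0 \<le> b" "0 < n"
  shows "a \<le> b"
proof (rule ccontr)
  assume "\<not> a \<le> b"
  then have "b ^ n < a ^ n" using assms by (intro power_strict_mono) auto
  then show False using assms by simp
qed

text \<open>
  If \<open>s - Gs\<close> is small, almost all of the energy is spent before s, and what is left is too little to
  bring \<open>Gt\<close> near t.
\<close>
lemma energy_splitting_deficit:
  fixes s t :: real
  assumes k: "k \<ge> 1" and st: "0 < s" "s < t"
    and nn: "0 \<le> As" "0 \<le> At" "0 \<le> Gs" "0 \<le> Gt" "0 \<le> \<beta>" and ab: "\<alpha> + \<beta> \<le> 1"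
    and Gs: "Gs ^ k = As ^ (k + 1)" and Gt: "Gt ^ k = At ^ (k + 1)"
    and As: "As ^ (k + 1) \<le> \<alpha> * s ^ k" and At: "\<bar>At - As\<bar> ^ (k + 1) \<le> \<beta> * (t - s) ^ k"
  shows "max (s - Gs) (t - Gt) \<ge> 1 / (real k * 4 ^ (k + 1)) * (s * (t - s) / t)"
proof (cases "s - Gs \<ge> 1 / (real k * 4 ^ (k + 1)) * (s * (t - s) / t)")
  case False
  \<comment> \<open>The factor k cancels the one produced by Bernoulli's inequality below; 4 ^ (k +
    1) turns into a factor 1 / 4 after the (k + 1)-th root.\<close>
  define c0 where "c0 = 1 / (real k * 4 ^ (k + 1))"
  define \<theta> where "\<theta> = s / t"
  define \<delta> where "\<delta> = c0 * (1 - \<theta>)"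
  have \<theta>: "0 < \<theta>" "\<theta> < 1" using st by (auto simp: \<theta>_def)
  have s: "s = \<theta> * t" and ts: "t - s = (1 - \<theta>) * t" using st by (auto simp: \<theta>_def field_simps)
  have "real k * 4 ^ (k + 1) \<ge> 1 * 4 ^ 1" using k by (intro mult_mono power_increasing) auto
  then have c0: "0 < c0" "c0 \<le> 1 / 4" unfolding c0_def using k by (auto intro!: divide_left_mono)
  have "\<delta> \<le> 1 * 1" unfolding \<delta>_def using \<theta> c0 by (intro mult_mono) auto
  then have \<delta>: "0 \<le> \<delta>" "\<delta> \<le> 1" using \<theta> c0 by (auto simp: \<delta>_def)
  have "s - Gs < c0 * (s * (t - s) / t)" using False unfolding c0_def by linarith
  also have "\<dots> = s * \<delta>" using st by (simp add: \<delta>_def \<theta>_def field_simps)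
  finally have "s * (1 - \<delta>) < Gs" by (simp add: algebra_simps)
  then have "(s * (1 - \<delta>)) ^ k \<le> Gs ^ k" using st \<delta> by (intro power_mono) auto
  also have "\<dots> \<le> \<alpha> * s ^ k" using Gs As by simp
  finally have "(1 - \<delta>) ^ k \<le> \<alpha>" using st by (simp add: power_mult_distrib)
  moreover have "1 - real k * \<delta> \<le> (1 - \<delta>) ^ k"
    using Bernoulli_inequality[of "-\<delta>" k] \<delta> by simp
  ultimately have "\<beta> \<le> real k * \<delta>" using ab by linarith
  also have "\<dots> = (1 - \<theta>) / 4 ^ (k + 1)" using k by (simp add: \<delta>_def c0_def)
  finally have \<beta>: "\<beta> \<le> (1 - \<theta>) / 4 ^ (k + 1)" .
  \<comment> \<open>The amplitude that unit energy would allow at t, in analogy with the bound on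
    \<open>As\<close>; the amplitudes below are measured in units of T.\<close>
  define T where "T = root (k + 1) (t ^ k)"
  have T: "0 \<le> T" "T ^ (k + 1) = t ^ k" using st unfolding T_def by (auto simp del: power_Suc intro!: real_root_pow_pos2)
  have "\<bar>At - As\<bar> ^ (k + 1) \<le> (1 - \<theta>) / 4 ^ (k + 1) * (t - s) ^ k"
    using At mult_right_mono[OF \<beta>, of "(t - s) ^ k"] st by simp
  also have "\<dots> = ((1 - \<theta>) / 4 * T) ^ (k + 1)"
    using T(2) by (simp add: ts power_mult_distrib power_divide)
  finally have d: "\<bar>At - As\<bar> \<le> (1 - \<theta>) / 4 * T"
    by (rule le_if_power_le) (use T \<theta> in auto)
  \<comment> \<open>The exponent must rise from k to k + 1: one factor \<theta> is at most the
    square of (1 + \<theta>) / 2, each of the others at most its first power.\<close>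
  have x: "\<theta> ^ k \<le> ((1 + \<theta>) / 2) ^ (k + 1)"
  proof -
    have "\<theta> ^ k = \<theta> ^ (k - 1) * \<theta>" using k by (metis power_minus_mult less_le_trans zero_less_one)
    also have "\<dots> \<le> ((1 + \<theta>) / 2) ^ (k - 1) * ((1 + \<theta>) / 2) ^ 2"
    proof (intro mult_mono power_mono)
      have "0 \<le> ((1 - \<theta>) / 2) ^ 2" by simp
      then show "\<theta> \<le> ((1 + \<theta>) / 2) ^ 2" by (simp add: power2_eq_square field_simps)
    qed (use \<theta> in auto)
    also have "\<dots> = ((1 + \<theta>) / 2) ^ (k + 1)" using k by (simp add: power_add[symmetric])
    finally show ?thesis .
  qed
  have "\<alpha> * s ^ k \<le> 1 * s ^ k" using ab nn st by (intro mult_right_mono) auto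
  then have "As ^ (k + 1) \<le> \<theta> ^ k * T ^ (k + 1)" using As T(2) by (simp add: s power_mult_distrib)
  also have "\<dots> \<le> ((1 + \<theta>) / 2) ^ (k + 1) * T ^ (k + 1)"
    using x T st by (intro mult_right_mono) auto
  finally have "As ^ (k + 1) \<le> ((1 + \<theta>) / 2 * T) ^ (k + 1)" by (simp only: power_mult_distrib)
  then have "As \<le> (1 + \<theta>) / 2 * T"
    by (rule le_if_power_le) (use T \<theta> in auto)
  then have AtT: "At \<le> (1 - (1 - \<theta>) / 4) * T" using d abs_ge_self[of "At - As"] by (simp add: field_simps)
  define y where "y = 1 - (1 - \<theta>) / 4"
  have y: "0 \<le> y" "y \<le> 1" using \<theta> by (auto simp: y_def)
  have "Gt ^ k \<le> (y * T) ^ (k + 1)" unfolding Gt y_def using AtT nn by (intro power_mono) auto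
  also have "\<dots> = y * (y * t) ^ k" using T(2) by (simp only: power_mult_distrib) (simp add: mult_ac)
  also have "\<dots> \<le> 1 * (y * t) ^ k" using y st by (intro mult_right_mono) auto
  finally have "Gt \<le> y * t" using y st k
    by (intro le_if_power_le[of Gt k]) auto
  moreover have "y * t = t - (t - s) / 4" by (simp add: y_def ts algebra_simps)
  ultimately have "(t - s) / 4 \<le> t - Gt" by linarith
  moreover have "c0 * (s * (t - s) / t) \<le> 1 / 4 * (t - s)"
  proof (intro mult_mono)
    have "s * (t - s) \<le> t * (t - s)" using st by (intro mult_right_mono) auto
    then show "s * (t - s) / t \<le> t - s" using st by (simp add: divide_le_eq mult.commute)
  qed (use c0 st in auto)
  ultimately show ?thesis unfolding c0_def by linarith
qed simp

section \<open>From the deficit to a bound for the double-exponential integral\<close>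

lemma one_minus_exp_neg_ge:
  fixes x :: real
  assumes "0 \<le> x"
  shows "min 1 x / 2 \<le> 1 - exp (- x)"
proof -
  let ?m = "min 1 x"
  have m: "0 \<le> ?m" "?m \<le> 1" using assms by auto
  have "exp (- x) \<le> exp (- ?m)" by simp
  also have "\<dots> = 1 / exp ?m" by (simp add: exp_minus divide_inverse)
  also have "\<dots> \<le> 1 / (1 + ?m)" using m exp_ge_add_one_self[of ?m] by (intro divide_left_mono) auto
  also have "\<dots> \<le> 1 - ?m / 2"
  proof -
    have "?m * ?m \<le> 1 * ?m" using m by (intro mult_right_mono) auto
    then show ?thesis using m by (simp add: field_simps)
  qed
  finally show ?thesis by simp
qed

lemma mult_div_add_ge_half_min:
  fixes a b :: real
  assumes "0 < a" "0 < b"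
  shows "min a b / 2 \<le> a * b / (a + b)"
proof -
  have "min a b * (a + b) \<le> 2 * (a * b)"
  proof (cases "a \<le> b")
    case True
    then have "a * a \<le> a * b" using assms by (intro mult_left_mono) auto
    then show ?thesis using True by (simp add: algebra_simps)
  next
    case False
    then have "b * b \<le> a * b" using assms by (intro mult_right_mono) auto
    then show ?thesis using False by (simp add: algebra_simps)
  qed
  then show ?thesis using assms by (simp add: field_simps)
qed

text \<open>Let s0 minimize the deficit. In \<open>gap\<close>, applied to s0 and another point s,
  the maximum is then the deficit at s, so s0 is the only place where it can be small. The minimum
  is taken on the compact interval [1, S]; y0 = exp s0 depends on S, the constant does not. The 8
  collects three halvings: a * b / (a + b) against the minimum of a and b, 1 - exp (- x) against x,
  and distances in s against distances in y.\<close>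

lemma exp_gap_ge:
  fixes G :: "real \<Rightarrow> real"
  assumes c0: "0 < c0" "c0 \<le> 1" and S: "1 \<le> S"
    and cont: "continuous_on {1..S} G" and le: "\<And>s. s \<in> {1..S} \<Longrightarrow> G s \<le> s"
    and gap: "\<And>s t. 0 < s \<Longrightarrow> s < t \<Longrightarrow> max (s - G s) (t - G t) \<ge> c0 * (s * (t - s) / t)"
  obtains y0 where "\<And>y. exp 1 \<le> y \<Longrightarrow> y \<le> exp S \<Longrightarrow> c0 / 8 * min y \<bar>y - y0\<bar> \<le> y - exp (G (ln y))"
proof -
  define \<phi> where "\<phi> s = s - G s" for s
  obtain s0 where s0: "s0 \<in> {1..S}" "\<And>s. s \<in> {1..S} \<Longrightarrow> \<phi> s0 \<le> \<phi> s"
  proof -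
    have "continuous_on {1..S} \<phi>" unfolding \<phi>_def using cont by (intro continuous_intros)
    then show ?thesis using continuous_attains_inf[of "{1..S}" \<phi>] S that by auto
  qed
  have pair: "c0 * (min 1 (t - s) / 2) \<le> c0 * (s * (t - s) / t)" if "1 \<le> s" "s < t" for s t :: real
  proof -
    have "min 1 (t - s) / 2 \<le> min s (t - s) / 2" using that by auto
    also have "\<dots> \<le> s * (t - s) / (s + (t - s))" using that by (intro mult_div_add_ge_half_min) auto
    finally show ?thesis using c0 by (intro mult_left_mono) auto
  qed
  have \<phi>: "c0 * (min 1 \<bar>s - s0\<bar> / 2) \<le> \<phi> s" if s: "s \<in> {1..S}" for s
  proof -
    consider "s < s0" | "s = s0" | "s0 < s" by linarith
    then show ?thesis
    proof cases
      case 1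
      then have "c0 * (min 1 (s0 - s) / 2) \<le> max (s - G s) (s0 - G s0)"
        using s by (intro order_trans[OF pair gap]) auto
      then show ?thesis using 1 s0(2)[OF s] unfolding \<phi>_def by (simp add: max_def split: if_splits)
    next
      case 2
      then show ?thesis using le[OF s] by (simp add: \<phi>_def)
    next
      case 3
      then have "c0 * (min 1 (s - s0) / 2) \<le> max (s0 - G s0) (s - G s)"
        using s0 by (intro order_trans[OF pair gap]) auto
      then show ?thesis using 3 s0(2)[OF s] unfolding \<phi>_def by (simp add: max_def split: if_splits)
    qed
  qed
  define y0 where "y0 = exp s0"
  have "c0 / 8 * min y \<bar>y - y0\<bar> \<le> y - exp (G (ln y))" if y: "exp 1 \<le> y" "y \<le> exp S" for y
  proof -
    have y0: "y0 > 0" "ln y0 = s0" by (auto simp: y0_def)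
    have yp: "y > 0" using y(1) by (meson exp_gt_zero less_le_trans)
    define s where "s = ln y"
    have ys: "y = exp s" using yp by (simp add: s_def)
    have s: "s \<in> {1..S}" using y by (simp add: ys)
    have \<phi>0: "0 \<le> \<phi> s" using le[OF s] by (simp add: \<phi>_def)
    \<comment> \<open>The inequality ln z \<le> z - 1 compares the distance in s with the relative
      distance in y.\<close>
    have A: "min y \<bar>y - y0\<bar> / 2 \<le> y * min 1 \<bar>s - s0\<bar>"
    proof -
      consider "y < y0" | "y = y0" | "y0 < y" by linarith
      then show ?thesis
      proof cases
        case 1
        have "ln (y / y0) \<le> y / y0 - 1" using yp y0 by (intro ln_le_minus_one) auto
        then have l: "(y0 - y) / y0 \<le> s0 - s" using yp y0 by (simp add: ln_div s_def field_simps)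
        have "(y0 - y) / y0 \<le> 1" using yp y0 by simp
        then have "y * ((y0 - y) / y0) \<le> y * min 1 \<bar>s - s0\<bar>" using l yp by (intro mult_left_mono) auto
        moreover have "min y (y0 - y) / 2 \<le> y * (y0 - y) / (y + (y0 - y))"
          using 1 yp by (intro mult_div_add_ge_half_min) auto
        then have "min y (y0 - y) / 2 \<le> y * ((y0 - y) / y0)" by simp
        moreover have "\<bar>y - y0\<bar> = y0 - y" using 1 by simp
        ultimately show ?thesis by (metis order_trans)
      next
        case 2
        then show ?thesis using yp by simp
      next
        case 3
        have "ln (y0 / y) \<le> y0 / y - 1" using yp y0 by (intro ln_le_minus_one) auto
        then have l: "(y - y0) / y \<le> s - s0" using yp y0 by (simp add: ln_div s_def field_simps)
        have "(y - y0) / y \<le> 1" using yp y0 by simp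
        then have "y * ((y - y0) / y) \<le> y * min 1 \<bar>s - s0\<bar>" using l yp by (intro mult_left_mono) auto
        moreover have "min y \<bar>y - y0\<bar> / 2 \<le> y * ((y - y0) / y)" using 3 yp by (simp add: min_def)
        ultimately show ?thesis by (rule order_trans[rotated])
      qed
    qed
    have m: "c0 * (min 1 \<bar>s - s0\<bar> / 2) \<le> min 1 (\<phi> s)"
    proof -
      have "c0 * (min 1 \<bar>s - s0\<bar> / 2) \<le> 1 * 1" using c0 by (intro mult_mono) auto
      then show ?thesis using \<phi>[OF s] by simp
    qed
    have "c0 / 8 * min y \<bar>y - y0\<bar> = c0 / 4 * (min y \<bar>y - y0\<bar> / 2)" by simp
    also have "\<dots> \<le> c0 / 4 * (y * min 1 \<bar>s - s0\<bar>)" using A c0 by (intro mult_left_mono) auto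
    also have "\<dots> = y * (c0 * (min 1 \<bar>s - s0\<bar> / 2) / 2)" by simp
    also have "\<dots> \<le> y * (min 1 (\<phi> s) / 2)" using m yp by (intro mult_left_mono divide_right_mono) auto
    also have "\<dots> \<le> y * (1 - exp (- \<phi> s))"
      using one_minus_exp_neg_ge[OF \<phi>0] yp by (intro mult_left_mono) auto
    also have "\<dots> = y - exp (G (ln y))"
      by (simp add: \<phi>_def ys right_diff_distrib mult_exp_exp)
    finally show ?thesis .
  qed
  then show ?thesis using that by blast
qed

lemma nn_integral_exp_neg_abs_le:
  assumes a: "0 < (a::real)"
  shows "(\<integral>\<^sup>+ t. ennreal (exp (- (a * \<bar>t - t0\<bar>))) \<partial>lborel) \<le> ennreal (2 / a)"
proof -
  let ?d = "exponential_density a"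
  have d1: "(\<integral>\<^sup>+ t. ennreal (?d t) \<partial>lborel) = 1"
  proof -
    have "prob_space (density lborel (\<lambda>t. ennreal (?d t)))" by (rule prob_space_exponential_density[OF a])
    then have "emeasure (density lborel (\<lambda>t. ennreal (?d t))) (space lborel) = 1"
      using prob_space.emeasure_space_1 by fastforce
    then have "emeasure (density lborel (\<lambda>t. ennreal (?d t))) UNIV = 1" by simp
    moreover have "emeasure (density lborel (\<lambda>t. ennreal (?d t))) UNIV = (\<integral>\<^sup>+ t. ennreal (?d t) * indicator UNIV t \<partial>lborel)"
      by (rule emeasure_density) auto
    ultimately show ?thesis by simp
  qed
  have d2: "(\<integral>\<^sup>+ t. ennreal (?d (- t)) \<partial>lborel) = 1"
    using nn_integral_real_affine[of "\<lambda>t. ennreal (?d t)" "-1" 0] d1 by simp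
  have "(\<integral>\<^sup>+ t. ennreal (exp (- (a * \<bar>t - t0\<bar>))) \<partial>lborel) = (\<integral>\<^sup>+ t. ennreal (exp (- (a * \<bar>t\<bar>))) \<partial>lborel)"
    using nn_integral_real_affine[of "\<lambda>t. ennreal (exp (- (a * \<bar>t - t0\<bar>)))" 1 t0] by simp
  also have "\<dots> \<le> (\<integral>\<^sup>+ t. ennreal (1 / a) * (ennreal (?d t) + ennreal (?d (- t))) \<partial>lborel)"
  proof (rule nn_integral_mono)
    fix t :: real
    have "ennreal (exp (- (a * \<bar>t\<bar>))) \<le> ennreal (1 / a * (?d t + ?d (- t)))"
      using a by (intro ennreal_leI) (auto simp: exponential_density_def field_simps)
    also have "\<dots> = ennreal (1 / a) * (ennreal (?d t) + ennreal (?d (- t)))"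
      using a exponential_density_nonneg[OF a] by (subst ennreal_mult) (auto simp: ennreal_plus)
    finally show "ennreal (exp (- (a * \<bar>t\<bar>))) \<le> ennreal (1 / a) * (ennreal (?d t) + ennreal (?d (- t)))" .
  qed
  also have "\<dots> = ennreal (1 / a) * (1 + 1)"
    by (subst nn_integral_cmult) (auto simp: nn_integral_add d1 d2)
  also have "\<dots> = ennreal (1 / a * 2)" using a by (subst ennreal_mult) auto
  finally show ?thesis by simp
qed

text \<open>With y = 1 + t the integrand is m * exp m * exp (- m * (y - exp (G (ln y)))). The gap
  bound majorizes it by exponentials peaked at t = 0 and t = y0 - 1. As y0 is available only for a
  bounded range of t, the integral is first cut at N; the resulting bound involves neither y0 nor N,
  and monotone convergence concludes.\<close>

lemma nn_integral_double_exp_le: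
  fixes G :: "real \<Rightarrow> real"
  assumes c0: "0 < c0" "c0 \<le> 1" and m: "0 < m"
    and [measurable]: "G \<in> borel_measurable borel"
    and cont: "continuous_on {1..} G" and le: "\<And>s. 0 \<le> s \<Longrightarrow> G s \<le> s"
    and gap: "\<And>s t. 0 < s \<Longrightarrow> s < t \<Longrightarrow> max (s - G s) (t - G t) \<ge> c0 * (s * (t - s) / t)"
  shows "(\<integral>\<^sup>+ t\<in>{0..}. ennreal (m * exp (- (m * t))) * ennreal (exp (m * exp (G (ln (1 + t))))) \<partial>lborel)
    \<le> ennreal (m * exp m * (exp 1 + 32 / (m * c0)))"
proof -
  \<comment> \<open>Decay rate of the two peaks, m times the constant in the gap bound. Together
    they have mass at most 4 / \<kappa>, which is the 32 / (m * c0) of the result.\<close>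
  define \<kappa> where "\<kappa> = m * (c0 / 8)"
  have \<kappa>: "\<kappa> > 0" using c0 m by (simp add: \<kappa>_def)
  let ?P = "\<lambda>z t :: real. ennreal (exp (- (\<kappa> * \<bar>t - z\<bar>)))"
  define F where "F t = ennreal (m * exp (- (m * t))) * ennreal (exp (m * exp (G (ln (1 + t)))))" for t
  have [measurable]: "F \<in> borel_measurable borel" unfolding F_def by measurable
  define C where "C = m * exp m * (exp 1 + 32 / (m * c0))"
  have trunc: "(\<integral>\<^sup>+ t. F t * indicator {0..real N} t \<partial>lborel) \<le> ennreal C" for N
  proof -
    \<comment> \<open>The maximum keeps [1, S] nonempty for small N.\<close>
    define S where "S = max 1 (ln (1 + real N))"
    obtain y0 where y0: "\<And>y. exp 1 \<le> y \<Longrightarrow> y \<le> exp S \<Longrightarrow> c0 / 8 * min y \<bar>y - y0\<bar> \<le> y - exp (G (ln y))"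
    proof (rule exp_gap_ge[OF c0, of S G])
      show "continuous_on {1..S} G" using cont by (rule continuous_on_subset) auto
    qed (use le gap in \<open>auto simp: S_def\<close>)
    have pt: "F t * indicator {0..real N} t \<le> ennreal (m * exp m) *
        (indicator {0..exp 1} t + (?P 0 t + ?P (y0 - 1) t))" for t
    proof (cases "t \<in> {0..real N}")
      case True
      define y where "y = 1 + t"
      have y: "1 \<le> y" using True by (simp add: y_def)
      have Feq: "F t = ennreal (m * exp m) * ennreal (exp (- (m * (y - exp (G (ln y))))))"
        unfolding F_def using m by (simp add: ennreal_mult[symmetric] exp_add[symmetric] y_def algebra_simps)
      have "ennreal (exp (- (m * (y - exp (G (ln y)))))) \<le>
        indicator {0..exp 1} t + (?P 0 t + ?P (y0 - 1) t)"
      proof (cases "y < exp 1")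
        case True
        \<comment> \<open>Below y = exp 1 there is no gap bound; \<open>G s \<le> s\<close> bounds
          the exponential by 1, which is enough on an interval of fixed length.\<close>
        have "exp (G (ln y)) \<le> exp (ln y)" using le[of "ln y"] y by (subst exp_le_cancel_iff) simp
        then have "0 \<le> m * (y - exp (G (ln y)))" using y m by simp
        then have "exp (- (m * (y - exp (G (ln y))))) \<le> 1" by simp
        then have "ennreal (exp (- (m * (y - exp (G (ln y)))))) \<le> 1" using ennreal_leI by fastforce
        also have "(1 :: ennreal) = indicator {0..exp 1} t" using True \<open>t \<in> {0..real N}\<close> by (simp add: y_def)
        finally show ?thesis by (rule order_trans) simp
      next
        case False
        have "y = exp (ln y)" using y by simp
        also have "\<dots> \<le> exp S" using True unfolding S_def y_def by (subst exp_le_cancel_iff) (auto simp: le_max_iff_disj)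
        finally have "c0 / 8 * min y \<bar>y - y0\<bar> \<le> y - exp (G (ln y))" using y0 False by simp
        then have "m * (c0 / 8 * min y \<bar>y - y0\<bar>) \<le> m * (y - exp (G (ln y)))" using m by (intro mult_left_mono) auto
        then have "exp (- (m * (y - exp (G (ln y))))) \<le> exp (- (\<kappa> * min y \<bar>y - y0\<bar>))" by (simp add: \<kappa>_def)
        also have "\<dots> \<le> exp (- (\<kappa> * \<bar>t - 0\<bar>)) + exp (- (\<kappa> * \<bar>t - (y0 - 1)\<bar>))"
        proof (cases "y \<le> \<bar>y - y0\<bar>")
          case True
          have "\<kappa> * \<bar>t - 0\<bar> \<le> \<kappa> * y" using \<kappa> y by (intro mult_left_mono) (auto simp: y_def)
          then have "exp (- (\<kappa> * y)) \<le> exp (- (\<kappa> * \<bar>t - 0\<bar>))" by simp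
          then show ?thesis
            unfolding min_absorb1[OF True] using exp_ge_zero[of "- (\<kappa> * \<bar>t - (y0 - 1)\<bar>)"] by linarith
        next
          case False
          then have le: "\<bar>y - y0\<bar> \<le> y" by simp
          have "\<bar>y - y0\<bar> = \<bar>t - (y0 - 1)\<bar>" by (simp add: y_def)
          then show ?thesis
            unfolding min_absorb2[OF le] using exp_ge_zero[of "- (\<kappa> * \<bar>t - 0\<bar>)"] by simp
        qed
        finally have "ennreal (exp (- (m * (y - exp (G (ln y)))))) \<le>
          ennreal (exp (- (\<kappa> * \<bar>t - 0\<bar>)) + exp (- (\<kappa> * \<bar>t - (y0 - 1)\<bar>)))"
          by (rule ennreal_leI)
        also have "\<dots> = ?P 0 t + ?P (y0 - 1) t"
          by (rule ennreal_plus) simp_all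
        finally have "ennreal (exp (- (m * (y - exp (G (ln y)))))) \<le>
          ?P 0 t + ?P (y0 - 1) t" .
        then show ?thesis by (rule order_trans) simp
      qed
      then have "F t \<le> ennreal (m * exp m) *
        (indicator {0..exp 1} t + (?P 0 t + ?P (y0 - 1) t))"
        unfolding Feq by (intro mult_left_mono) auto
      then show ?thesis using True by simp
    qed simp
    have "(\<integral>\<^sup>+ t. F t * indicator {0..real N} t \<partial>lborel) \<le> (\<integral>\<^sup>+ t. ennreal (m * exp m) *
        (indicator {0..exp 1} t + (?P 0 t + ?P (y0 - 1) t)) \<partial>lborel)"
      by (rule nn_integral_mono) (rule pt)
    also have "\<dots> = ennreal (m * exp m) * (ennreal (exp 1) + ((\<integral>\<^sup>+ t. ?P 0 t \<partial>lborel)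
        + (\<integral>\<^sup>+ t. ?P (y0 - 1) t \<partial>lborel)))"
    proof -
      have e: "(\<lambda>t. ennreal (exp (- (\<kappa> * \<bar>t - c\<bar>)))) \<in> borel_measurable lborel" for c by measurable
      have i: "(indicator {0..exp 1} :: real \<Rightarrow> ennreal) \<in> borel_measurable lborel" by measurable
      have "(\<integral>\<^sup>+ t. indicator {0..exp 1} t \<partial>(lborel :: real measure)) = ennreal (exp 1)"
        by (subst nn_integral_indicator) auto
      then show ?thesis
        unfolding nn_integral_cmult[OF borel_measurable_add[OF i borel_measurable_add[OF e e]]]
          nn_integral_add[OF i borel_measurable_add[OF e e]] nn_integral_add[OF e e] by simp
    qed
    also have "\<dots> \<le> ennreal (m * exp m) * (ennreal (exp 1) + (ennreal (2 / \<kappa>) + ennreal (2 / \<kappa>)))"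
      by (intro mult_left_mono add_mono nn_integral_exp_neg_abs_le[OF \<kappa>] order_refl zero_le)
    also have "\<dots> = ennreal (m * exp m * (exp 1 + (2 / \<kappa> + 2 / \<kappa>)))"
      using \<kappa> m by (simp add: ennreal_mult[symmetric] ennreal_plus[symmetric] del: ennreal_plus)
    also have "m * exp m * (exp 1 + (2 / \<kappa> + 2 / \<kappa>)) = C" using c0 m by (simp add: C_def \<kappa>_def field_simps)
    finally show ?thesis .
  qed
  have "(\<integral>\<^sup>+ t\<in>{0..}. F t \<partial>lborel) = (\<integral>\<^sup>+ t. (SUP N. F t * indicator {0..real N} t) \<partial>lborel)"
  proof (rule nn_integral_cong)
    fix t :: real
    show "F t * indicator {0..} t = (SUP N. F t * indicator {0..real N} t)"
    proof (cases "0 \<le> t")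
      case True
      obtain N where N: "t \<le> real N" using real_arch_simple by blast
      show ?thesis
      proof (rule antisym)
        have "F t * indicator {0..} t = F t * indicator {0..real N} t" using True N by simp
        also have "\<dots> \<le> (SUP N. F t * indicator {0..real N} t)" by (rule SUP_upper) simp
        finally show "F t * indicator {0..} t \<le> (SUP N. F t * indicator {0..real N} t)" .
      qed (auto intro!: SUP_least mult_left_mono simp: indicator_def)
    qed simp
  qed
  also have "\<dots> = (SUP N. \<integral>\<^sup>+ t. F t * indicator {0..real N} t \<partial>lborel)"
    by (rule nn_integral_monotone_convergence_SUP)
       (auto simp: incseq_def le_fun_def indicator_def)
  also have "\<dots> \<le> ennreal C" by (rule SUP_least) (rule trunc)
  finally show ?thesis unfolding F_def C_def .
qed


section \<open>Principal minors of rank-one perturbations of scalar matrices\<close>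

text \<open>Composition with a transposition of two points of X permutes the summands and flips
  every sign, so the sum equals its negative. If X lacks two distinct points, only the identity
  remains.\<close>

lemma sum_sign_permutations:
  assumes "finite X"
  shows "(\<Sum>p | p permutes X. of_int (sign p) :: real) = (if card X \<le> 1 then 1 else 0)"
proof (cases "card X \<le> 1")
  case True
  then have "card X = 0 \<or> card X = 1" by linarith
  then have "X = {} \<or> (\<exists>a. X = {a})" using assms by (metis card_0_eq card_1_singletonE)
  then have "{p. p permutes X} = {id}" using permutes_empty permutes_sing by (auto simp: id_def)
  then show ?thesis using True by (simp add: sign_id)
next
  case False
  then have "\<not> (\<forall>a\<in>X. \<forall>b\<in>X. a = b)" using card_le_Suc0_iff_eq[OF assms] by simp
  then obtain a b where ab: "a \<in> X" "b \<in> X" "a \<noteq> b" by blast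
  let ?q = "Transposition.transpose a b"
  have q: "?q permutes X" using ab by (simp add: permutes_swap_id)
  let ?S = "\<Sum>p | p permutes X. of_int (sign p) :: real"
  have "?S = (\<Sum>p | p permutes X. of_int (sign (?q \<circ> p)))"
    by (rule setum_permutations_compose_left[OF q])
  also have "\<dots> = (\<Sum>p | p permutes X. - of_int (sign p))"
  proof (intro sum.cong refl)
    fix p assume "p \<in> {p. p permutes X}"
    then have "permutation p" using assms by (auto simp: permutation_permutes)
    moreover have "permutation ?q" by (rule permutation_swap_id)
    ultimately show "of_int (sign (?q \<circ> p)) = - (of_int (sign p) :: real)"
      using ab by (simp add: sign_compose sign_swap_id)
  qed
  also have "\<dots> = - ?S" by (simp add: sum_negf)
  finally show ?thesis using False by simp
qed

text \<open>
  Expanding the product, the terms with two or more factors from the rank-one part cancel, because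
  they are invariant under permuting those factors while the signs sum to zero.
\<close>
lemma principal_minor_scalar_plus_rank_one:
  fixes x :: "real ^ 'n"
  shows "principal_minor I (\<chi> i j. (if i = j then \<alpha> else 0) + \<beta> * x $ i * x $ j) =
    \<alpha> ^ card I + \<beta> * \<alpha> ^ (card I - 1) * (\<Sum>i\<in>I. (x $ i)\<^sup>2)"
proof -
  let ?A = "\<chi> i j. (if i = j then \<alpha> else 0) + \<beta> * x $ i * x $ j"
  let ?t = "\<lambda>X p. of_int (sign p) * ((\<Prod>i\<in>X. \<beta> * x $ i * x $ p i) * (\<Prod>i\<in>I - X. if i = p i then \<alpha> else 0))"
  have "principal_minor I ?A =
      (\<Sum>p | p permutes I. \<Sum>X\<in>Pow I. ?t X p)"
    unfolding principal_minor_def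
  proof (intro sum.cong refl)
    fix p
    have "(\<Prod>i\<in>I. ?A $ i $ p i) =
        (\<Prod>i\<in>I. \<beta> * x $ i * x $ p i + (if i = p i then \<alpha> else 0))"
      by (intro prod.cong refl) simp
    also have "\<dots> = (\<Sum>X\<in>Pow I. (\<Prod>i\<in>X. \<beta> * x $ i * x $ p i) * (\<Prod>i\<in>I - X. if i = p i then \<alpha> else 0))"
      by (rule prod_add) simp
    finally show "of_int (sign p) * (\<Prod>i\<in>I. ?A $ i $ p i) =
        (\<Sum>X\<in>Pow I. ?t X p)"
      by (simp only: sum_distrib_left)
  qed
  also have "\<dots> = (\<Sum>X\<in>Pow I. \<Sum>p | p permutes I. ?t X p)" by (rule sum.swap)
  also have "\<dots> = (\<Sum>X\<in>Pow I. if card X \<le> 1 then (\<Prod>i\<in>X. \<beta> * (x $ i)\<^sup>2) * \<alpha> ^ (card I - card X) else 0)"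
  proof (intro sum.cong refl)
    fix X assume "X \<in> Pow I"
    then have X: "X \<subseteq> I" by simp
    \<comment> \<open>A permutation that moves a point outside X picks there an off-diagonal entry
      of the scalar part, which is 0.\<close>
    have "(\<Sum>p | p permutes I. ?t X p) = (\<Sum>p | p permutes X. ?t X p)"
    proof (rule sum.mono_neutral_right)
      show "finite {p. p permutes I}" by simp
      show "{p. p permutes X} \<subseteq> {p. p permutes I}" using X by (auto intro: permutes_subset)
      show "\<forall>p\<in>{p. p permutes I} - {p. p permutes X}. ?t X p = 0"
      proof
        fix p assume p: "p \<in> {p. p permutes I} - {p. p permutes X}"
        then obtain i where "i \<in> I - X" "p i \<noteq> i"
          using permutes_superset[of p I X] by auto
        then have "\<exists>i\<in>I - X. (if i = p i then \<alpha> else 0) = 0" by (intro bexI[of _ i]) auto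
        then have "(\<Prod>i\<in>I - X. if i = p i then \<alpha> else 0) = 0" by (intro prod_zero) auto
        then show "?t X p = 0" by simp
      qed
    qed
    also have "\<dots> = (\<Sum>p | p permutes X. of_int (sign p) * ((\<Prod>i\<in>X. \<beta> * (x $ i)\<^sup>2) * \<alpha> ^ (card I - card X)))"
    proof (intro sum.cong refl)
      fix p assume "p \<in> {p. p permutes X}"
      then have p: "p permutes X" by simp
      have "(\<Prod>i\<in>X. x $ p i) = (\<Prod>i\<in>X. x $ i)" using prod.permute[OF p, of "\<lambda>i. x $ i"] by (simp add: o_def)
      then have "(\<Prod>i\<in>X. \<beta> * x $ i * x $ p i) = (\<Prod>i\<in>X. \<beta> * (x $ i)\<^sup>2)"
        by (simp add: prod.distrib power2_eq_square mult.assoc)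
      moreover have "(\<Prod>i\<in>I - X. if i = p i then \<alpha> else 0) = (\<Prod>i\<in>I - X. \<alpha>)"
        using p by (intro prod.cong) (auto simp: permutes_def)
      moreover have "card (I - X) = card I - card X" using X by (simp add: card_Diff_subset)
      ultimately show "?t X p = of_int (sign p) * ((\<Prod>i\<in>X. \<beta> * (x $ i)\<^sup>2) * \<alpha> ^ (card I - card X))" by simp
    qed
    also have "\<dots> = (\<Sum>p | p permutes X. of_int (sign p)) * ((\<Prod>i\<in>X. \<beta> * (x $ i)\<^sup>2) * \<alpha> ^ (card I - card X))"
      by (rule sum_distrib_right[symmetric])
    finally show "(\<Sum>p | p permutes I. ?t X p) =
        (if card X \<le> 1 then (\<Prod>i\<in>X. \<beta> * (x $ i)\<^sup>2) * \<alpha> ^ (card I - card X) else 0)"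
      by (simp add: sum_sign_permutations)
  qed
  also have "\<dots> = (\<Sum>X\<in>insert {} ((\<lambda>i. {i}) ` I). if card X \<le> 1 then (\<Prod>i\<in>X. \<beta> * (x $ i)\<^sup>2) * \<alpha> ^ (card I - card X) else 0)"
  proof (rule sum.mono_neutral_right)
    show "\<forall>X\<in>Pow I - insert {} ((\<lambda>i. {i}) ` I).
        (if card X \<le> 1 then (\<Prod>i\<in>X. \<beta> * (x $ i)\<^sup>2) * \<alpha> ^ (card I - card X) else 0) = 0"
    proof
      fix X assume X: "X \<in> Pow I - insert {} ((\<lambda>i. {i}) ` I)"
      have "card X \<noteq> 0" using X finite[of X] by auto
      moreover have "card X \<noteq> 1" using X by (auto simp: card_1_singleton_iff)
      ultimately have "\<not> card X \<le> 1" by linarith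
      then show "(if card X \<le> 1 then (\<Prod>i\<in>X. \<beta> * (x $ i)\<^sup>2) * \<alpha> ^ (card I - card X) else 0) = 0" by simp
    qed
  qed auto
  also have "\<dots> = \<alpha> ^ card I + (\<Sum>i\<in>I. \<beta> * (x $ i)\<^sup>2 * \<alpha> ^ (card I - 1))"
    by (subst sum.insert) (auto simp: sum.reindex)
  finally show ?thesis by (simp add: sum_distrib_left mult_ac)
qed

text \<open>Over all index sets of size j, each coordinate of x is counted (n - 1 choose j - 1)
  times. The factor n on the left permits the use of n * (n - 1 choose j - 1) = j * (n choose j)
  without division.\<close>

lemma S_minors_scalar_plus_rank_one:
  fixes x :: "real ^ 'n"
  assumes j: "1 \<le> j"
  shows "real CARD('n) * S_minors j (\<chi> i j. (if i = j then \<alpha> else 0) + \<beta> * x $ i * x $ j) =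
    real (CARD('n) choose j) * \<alpha> ^ (j - 1) * (real CARD('n) * \<alpha> + real j * \<beta> * (norm x)\<^sup>2)"
proof -
  let ?A = "\<chi> i j. (if i = j then \<alpha> else 0) + \<beta> * x $ i * x $ j"
  let ?n = "CARD('n)"
  let ?J = "{I :: 'n set. card I = j}"
  have cJ: "card ?J = ?n choose j" using n_subsets[of "UNIV :: 'n set" j] by simp
  have cnt: "card {I \<in> ?J. i \<in> I} = (?n - 1) choose (j - 1)" for i
  proof -
    have "bij_betw (insert i) {I. I \<subseteq> UNIV - {i} \<and> card I = j - 1} {I \<in> ?J. i \<in> I}"
    proof (rule bij_betwI[where g="\<lambda>I. I - {i}"])
      show "insert i \<in> {I. I \<subseteq> UNIV - {i} \<and> card I = j - 1} \<rightarrow> {I \<in> ?J. i \<in> I}"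
        using j by (auto simp: card_insert_if)
    qed (use j in auto)
    then have "card {I \<in> ?J. i \<in> I} = card {I. I \<subseteq> UNIV - {i} \<and> card I = j - 1}"
      by (simp add: bij_betw_same_card)
    also have "\<dots> = (?n - 1) choose (j - 1)" using n_subsets[of "UNIV - {i}" "j - 1"] by simp
    finally show ?thesis .
  qed
  have "(\<Sum>I\<in>?J. \<Sum>i\<in>I. (x $ i)\<^sup>2) = (\<Sum>I\<in>?J. \<Sum>i\<in>UNIV. if i \<in> I then (x $ i)\<^sup>2 else 0)"
    by (rule sum.cong[OF refl], subst sum.inter_restrict[symmetric]) simp_all
  also have "\<dots> = (\<Sum>i\<in>UNIV. \<Sum>I\<in>?J. if i \<in> I then (x $ i)\<^sup>2 else 0)" by (rule sum.swap)
  also have "\<dots> = (\<Sum>i\<in>UNIV. real (card {I \<in> ?J. i \<in> I}) * (x $ i)\<^sup>2)"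
    by (rule sum.cong[OF refl], subst sum.inter_filter[symmetric]) simp_all
  also have "\<dots> = real ((?n - 1) choose (j - 1)) * (norm x)\<^sup>2"
    unfolding cnt by (simp add: sum_distrib_left norm_vec_def L2_set_def sum_nonneg)
  finally have sq: "(\<Sum>I\<in>?J. \<Sum>i\<in>I. (x $ i)\<^sup>2) = real ((?n - 1) choose (j - 1)) * (norm x)\<^sup>2" .
  have "S_minors j ?A =
      (\<Sum>I\<in>?J. \<alpha> ^ j + \<beta> * \<alpha> ^ (j - 1) * (\<Sum>i\<in>I. (x $ i)\<^sup>2))"
    unfolding S_minors_def by (intro sum.cong refl) (simp add: principal_minor_scalar_plus_rank_one)
  also have "\<dots> = real (?n choose j) * \<alpha> ^ j + \<beta> * \<alpha> ^ (j - 1) * (real ((?n - 1) choose (j - 1)) * (norm x)\<^sup>2)"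
    by (simp add: sum.distrib cJ sum_distrib_left[symmetric] sq)
  finally have S: "S_minors j ?A =
     real (?n choose j) * \<alpha> ^ j + \<beta> * \<alpha> ^ (j - 1) * (real ((?n - 1) choose (j - 1)) * (norm x)\<^sup>2)" .
  have ab: "real ?n * real ((?n - 1) choose (j - 1)) = real j * real (?n choose j)"
  proof -
    have "Suc (?n - 1) * ((?n - 1) choose (j - 1)) = (Suc (?n - 1) choose Suc (j - 1)) * Suc (j - 1)"
      by (rule Suc_times_binomial_eq)
    then have "?n * ((?n - 1) choose (j - 1)) = j * (?n choose j)" using j by (simp add: mult.commute)
    then show ?thesis by (metis of_nat_mult)
  qed
  have aj: "\<alpha> ^ j = \<alpha> ^ (j - 1) * \<alpha>" using j by (simp add: power_eq_if)
  have "real ?n * S_minors j ?A =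
     real ?n * real (?n choose j) * \<alpha> ^ (j - 1) * \<alpha> + \<beta> * \<alpha> ^ (j - 1) * (real ?n * real ((?n - 1) choose (j - 1))) * (norm x)\<^sup>2"
    unfolding S aj by (simp add: algebra_simps)
  then show ?thesis unfolding ab by (simp add: algebra_simps)
qed

text \<open>The decisive factor n * \<alpha> + j * \<beta> * |x|^2 equals (n - 2 * j) * \<alpha> + j
  * (2 * \<alpha> + \<beta> * |x|^2), a sum of nonnegative terms as long as 2 * j \<le> n. One
  condition thus serves all j up to n / 2, and it is sharp at j = n / 2 for positive
  \<alpha>.\<close>

lemma S_minors_scalar_plus_rank_one_nonneg:
  fixes x :: "real ^ 'n"
  assumes j: "1 \<le> j" "2 * j \<le> CARD('n)" and a: "0 \<le> \<alpha>" and ab: "0 \<le> 2 * \<alpha> + \<beta> * (norm x)\<^sup>2"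
  shows "0 \<le> S_minors j (\<chi> i j. (if i = j then \<alpha> else 0) + \<beta> * x $ i * x $ j)"
proof -
  let ?A = "\<chi> i j. (if i = j then \<alpha> else 0) + \<beta> * x $ i * x $ j"
  have "real (2 * j) \<le> real CARD('n)" using j(2) by (simp only: of_nat_le_iff)
  then have "0 \<le> (real CARD('n) - 2 * real j) * \<alpha>" using a by (intro mult_nonneg_nonneg) auto
  moreover have "0 \<le> real j * (2 * \<alpha> + \<beta> * (norm x)\<^sup>2)" by (rule mult_nonneg_nonneg[OF _ ab]) simp
  ultimately have "0 \<le> (real CARD('n) - 2 * real j) * \<alpha> + real j * (2 * \<alpha> + \<beta> * (norm x)\<^sup>2)" by simp
  then have "0 \<le> real CARD('n) * \<alpha> + real j * \<beta> * (norm x)\<^sup>2" by (simp add: algebra_simps)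
  then have "0 \<le> real CARD('n) * S_minors j ?A"
    unfolding S_minors_scalar_plus_rank_one[OF j(1)] using a by (intro mult_nonneg_nonneg) auto
  then show ?thesis by (simp add: zero_le_mult_iff)
qed


section \<open>Radial functions\<close>

text \<open>Writing u through the squared norm, which is smooth everywhere, spares a separate
  treatment of the origin. In return f must be twice differentiable at \<rho> = 0 in the two-sided
  sense.\<close>

lemma radial_C2:
  fixes u :: "real ^ 'n \<Rightarrow> real" and f f1 f2 :: "real \<Rightarrow> real"
  assumes u: "u = (\<lambda>x. f ((norm x)\<^sup>2))"
    and f1: "\<And>\<rho>. 0 \<le> \<rho> \<Longrightarrow> \<rho> < 1 \<Longrightarrow> (f has_real_derivative f1 \<rho>) (at \<rho>)"
    and f2: "\<And>\<rho>. 0 \<le> \<rho> \<Longrightarrow> \<rho> < 1 \<Longrightarrow> (f1 has_real_derivative f2 \<rho>) (at \<rho>)"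
    and cont: "continuous_on {0..<1} f2"
  shows "C2_on (ball 0 1) u"
    and "\<And>x. x \<in> ball 0 1 \<Longrightarrow> hessian u x =
      (\<chi> i j. (if i = j then 2 * f1 ((norm x)\<^sup>2) else 0) + 4 * f2 ((norm x)\<^sup>2) * x $ i * x $ j)"
proof -
  have \<rho>: "0 \<le> x \<bullet> x" "x \<bullet> x < 1" if "x \<in> ball 0 1" for x :: "real ^ 'n"
    using that by (auto simp: norm_eq_sqrt_inner)
  have dsq: "((\<lambda>x. x \<bullet> x) has_derivative (\<lambda>h. 2 * (x \<bullet> h))) (at x)" for x :: "real ^ 'n"
    by (auto intro!: derivative_eq_intros simp: inner_commute)
  have du: "(u has_derivative (\<lambda>h. f1 (x \<bullet> x) * (2 * (x \<bullet> h)))) (at x)" if "x \<in> ball 0 1" for x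
  proof -
    have "((\<lambda>x. f (x \<bullet> x)) has_derivative (\<lambda>h. f1 (x \<bullet> x) * (2 * (x \<bullet> h)))) (at x)"
      using DERIV_compose_FDERIV[OF f1[OF \<rho>[OF that]] dsq] by (simp add: mult.commute)
    then show ?thesis unfolding u power2_norm_eq_inner .
  qed
  have p1: "partial_deriv i u x = 2 * f1 (x \<bullet> x) * x $ i" if "x \<in> ball 0 1" for x i
    unfolding partial_deriv_def frechet_derivative_at[OF du[OF that], symmetric]
    by (simp add: inner_axis)
  have dp: "(partial_deriv j u has_derivative
      (\<lambda>h. 2 * (f2 (x \<bullet> x) * (2 * (x \<bullet> h))) * x $ j + 2 * f1 (x \<bullet> x) * h $ j)) (at x)" if x: "x \<in> ball 0 1" for x j
  proof (rule has_derivative_transform_within_open[OF _ open_ball x])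
    have "((\<lambda>x. f1 (x \<bullet> x)) has_derivative (\<lambda>h. f2 (x \<bullet> x) * (2 * (x \<bullet> h)))) (at x)"
      using DERIV_compose_FDERIV[OF f2[OF \<rho>[OF x]] dsq] by (simp add: mult.commute)
    moreover have "((\<lambda>x. x $ j) has_derivative (\<lambda>h. h $ j)) (at x)"
      by (rule bounded_linear_imp_has_derivative[OF bounded_linear_vec_nth])
    ultimately show "((\<lambda>x. 2 * f1 (x \<bullet> x) * x $ j) has_derivative
      (\<lambda>h. 2 * (f2 (x \<bullet> x) * (2 * (x \<bullet> h))) * x $ j + 2 * f1 (x \<bullet> x) * h $ j)) (at x)"
      by (auto intro!: derivative_eq_intros simp: algebra_simps)
  qed (simp add: p1)
  have p2: "partial_deriv i (partial_deriv j u) x =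
      (if i = j then 2 * f1 (x \<bullet> x) else 0) + 4 * f2 (x \<bullet> x) * x $ i * x $ j" if "x \<in> ball 0 1" for x i j
    unfolding partial_deriv_def[of i] frechet_derivative_at[OF dp[OF that], symmetric]
    by (cases "i = j") (simp_all add: inner_axis, simp_all add: axis_def)
  show "hessian u x = (\<chi> i j. (if i = j then 2 * f1 ((norm x)\<^sup>2) else 0) + 4 * f2 ((norm x)\<^sup>2) * x $ i * x $ j)"
    if "x \<in> ball 0 1" for x
    unfolding hessian_def power2_norm_eq_inner using p2[OF that] by (simp add: vec_eq_iff)
  have im: "(\<lambda>x :: real ^ 'n. x \<bullet> x) ` ball 0 1 \<subseteq> {0..<1}" using \<rho> by auto
  have c1: "continuous_on {0..<1} f1"
    by (rule continuous_at_imp_continuous_on) (auto intro!: DERIV_isCont f2)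
  have "continuous_on (ball 0 1) (\<lambda>x :: real ^ 'n. f1 (x \<bullet> x))"
    by (rule continuous_on_compose2[OF c1 _ im]) (intro continuous_intros)
  moreover have "continuous_on (ball 0 1) (\<lambda>x :: real ^ 'n. f2 (x \<bullet> x))"
    by (rule continuous_on_compose2[OF cont _ im]) (intro continuous_intros)
  ultimately have "continuous_on (ball 0 1) (\<lambda>x. (if i = j then 2 * f1 (x \<bullet> x) else 0) + 4 * f2 (x \<bullet> x) * x $ i * x $ j)" for i j :: 'n
    by (cases "i = j") (auto intro!: continuous_intros)
  then have "continuous_on (ball 0 1) (partial_deriv i (partial_deriv j u))" for i j
    by (rule continuous_on_eq) (simp add: p2)
  then show "C2_on (ball 0 1) u"
    unfolding C2_on_def using differentiableI[OF du] differentiableI[OF dp] by blast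
qed

lemma profile_eq:
  fixes x :: "'a::real_normed_vector"
  assumes "radial_on S u" "x \<in> S" "\<And>y. norm y = norm x \<Longrightarrow> y \<in> S"
  shows "profile u (norm x) = u x"
proof -
  have n: "norm (SOME y :: 'a. norm y = norm x) = norm x" by (rule someI[of _ x]) simp
  then have "(SOME y :: 'a. norm y = norm x) \<in> S" by (rule assms(3))
  then show ?thesis using assms(1,2) n unfolding profile_def radial_on_def by blast
qed

lemma profile_cong:
  assumes "\<And>x. norm x = r \<Longrightarrow> u x = c" "0 \<le> r"
  shows "profile (u :: 'a::{real_normed_vector, perfect_space} \<Rightarrow> real) r = c"
proof -
  have "\<exists>x :: 'a. norm x = r" using vector_choose_size[OF assms(2)] by blast
  then have "norm (SOME x :: 'a. norm x = r) = r" by (rule someI_ex)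
  then show ?thesis using assms(1) by (simp add: profile_def)
qed

lemma profile_diff: "profile (\<lambda>x. u x - w x) = (\<lambda>r. profile u r - profile w r)"
  by (simp add: profile_def fun_eq_iff)

section \<open>Regularity of radial profiles\<close>

lemma Lipschitz_imp_absolutely_continuous:
  assumes L: "\<And>s t. a \<le> s \<Longrightarrow> s \<le> t \<Longrightarrow> t \<le> b \<Longrightarrow> \<bar>f t - f s\<bar> \<le> L * (t - s)"
  shows "absolutely_continuous_on_Icc a b f"
  unfolding absolutely_continuous_on_Icc_alt
proof (intro allI impI)
  fix e :: real assume e: "e > 0"
  define L' where "L' = \<bar>L\<bar> + 1"
  have L': "L' > 0" by (simp add: L'_def)
  show "\<exists>d>0. \<forall>D. interval_family a b D \<and> (\<Sum>(s, t)\<in>D. t - s) < d \<longrightarrow> (\<Sum>(s, t)\<in>D. \<bar>f t - f s\<bar>) < e"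
  proof (intro exI[of _ "e / L'"] conjI allI impI)
    fix D assume D: "interval_family a b D \<and> (\<Sum>(s, t)\<in>D. t - s) < e / L'"
    have "(\<Sum>(s, t)\<in>D. \<bar>f t - f s\<bar>) \<le> (\<Sum>(s, t)\<in>D. L' * (t - s))"
    proof (rule sum_mono, clarify)
      fix s t assume "(s, t) \<in> D"
      then have st: "a \<le> s" "s < t" "t \<le> b" using D by (auto simp: interval_family_def)
      have "\<bar>f t - f s\<bar> \<le> L * (t - s)" using L st by simp
      also have "\<dots> \<le> L' * (t - s)" using st by (intro mult_right_mono) (auto simp: L'_def)
      finally show "\<bar>f t - f s\<bar> \<le> L' * (t - s)" .
    qed
    also have "\<dots> = L' * (\<Sum>(s, t)\<in>D. t - s)" by (simp add: sum_distrib_left case_prod_beta)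
    also have "\<dots> < L' * (e / L')" using D L' by (intro mult_strict_left_mono) auto
    finally show "(\<Sum>(s, t)\<in>D. \<bar>f t - f s\<bar>) < e" using L' by simp
  qed (use e L' in simp)
qed

lemma absolutely_continuous_diff:
  assumes f: "absolutely_continuous_on_Icc a b f" and g: "absolutely_continuous_on_Icc a b g"
  shows "absolutely_continuous_on_Icc a b (\<lambda>x. f x - g x)"
  unfolding absolutely_continuous_on_Icc_alt
proof (intro allI impI)
  fix e :: real assume "e > 0"
  then have "e / 2 > 0" by simp
  obtain d1 where d1: "d1 > 0" "\<And>D. interval_family a b D \<Longrightarrow> (\<Sum>(s, t)\<in>D. t - s) < d1 \<Longrightarrow> (\<Sum>(s, t)\<in>D. \<bar>f t - f s\<bar>) < e / 2"
    using f \<open>e / 2 > 0\<close> unfolding absolutely_continuous_on_Icc_alt by meson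
  obtain d2 where d2: "d2 > 0" "\<And>D. interval_family a b D \<Longrightarrow> (\<Sum>(s, t)\<in>D. t - s) < d2 \<Longrightarrow> (\<Sum>(s, t)\<in>D. \<bar>g t - g s\<bar>) < e / 2"
    using g \<open>e / 2 > 0\<close> unfolding absolutely_continuous_on_Icc_alt by meson
  show "\<exists>d>0. \<forall>D. interval_family a b D \<and> (\<Sum>(s, t)\<in>D. t - s) < d \<longrightarrow> (\<Sum>(s, t)\<in>D. \<bar>f t - g t - (f s - g s)\<bar>) < e"
  proof (intro exI[of _ "min d1 d2"] conjI allI impI)
    fix D assume D: "interval_family a b D \<and> (\<Sum>(s, t)\<in>D. t - s) < min d1 d2"
    have "(\<Sum>(s, t)\<in>D. \<bar>f t - g t - (f s - g s)\<bar>) \<le> (\<Sum>(s, t)\<in>D. \<bar>f t - f s\<bar>) + (\<Sum>(s, t)\<in>D. \<bar>g t - g s\<bar>)"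
      by (simp add: case_prod_beta sum.distrib[symmetric]) (intro sum_mono, linarith)
    also have "\<dots> < e / 2 + e / 2" using D d1(2) d2(2) by (intro add_strict_mono) auto
    finally show "(\<Sum>(s, t)\<in>D. \<bar>f t - g t - (f s - g s)\<bar>) < e" by simp
  qed (use d1 d2 in simp)
qed

lemma absolutely_continuous_imp_continuous_on:
  assumes f: "absolutely_continuous_on_Icc a b f"
  shows "continuous_on {a..b} f"
  unfolding continuous_on_iff
proof (intro ballI allI impI)
  fix x e :: real assume x: "x \<in> {a..b}" and "e > 0"
  then obtain d where d: "d > 0" "\<And>D. interval_family a b D \<Longrightarrow> (\<Sum>(s, t)\<in>D. t - s) < d \<Longrightarrow> (\<Sum>(s, t)\<in>D. \<bar>f t - f s\<bar>) < e"
    using f unfolding absolutely_continuous_on_Icc_alt by meson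
  have *: "\<bar>f t - f s\<bar> < e" if "a \<le> s" "s < t" "t \<le> b" "t - s < d" for s t
    using d(2)[of "{(s, t)}"] that by (simp add: interval_family_def disjoint_family_on_def)
  show "\<exists>d>0. \<forall>y\<in>{a..b}. dist y x < d \<longrightarrow> dist (f y) (f x) < e"
  proof (intro exI[of _ d] conjI ballI impI d(1))
    fix y assume y: "y \<in> {a..b}" "dist y x < d"
    consider "x < y" | "x = y" | "y < x" by linarith
    then show "dist (f y) (f x) < e"
    proof cases
      case 1
      then show ?thesis using *[of x y] x y by (simp add: dist_real_def)
    next
      case 3
      then show ?thesis using *[of y x] x y by (simp add: dist_real_def abs_minus_commute)
    qed (use \<open>e > 0\<close> in simp)
  qed
qed

text \<open>Along a coordinate axis the profile is U on a ray, and its derivative is a partial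
  derivative of U. That is continuous, so the profile is Lipschitz on compact subintervals of (0,
  1). Boundedness and the limit at 1 come from continuity on the closed ball.\<close>

lemma Phi_0_rad_profile:
  fixes U :: "real ^ 'n \<Rightarrow> real"
  assumes U: "U \<in> Phi_0_rad k"
  shows "locally_absolutely_continuous_on_Ioo 0 1 (profile U)"
    and "(profile U \<longlongrightarrow> 0) (at_left 1)"
    and "\<exists>M. \<forall>r\<in>{0..1}. \<bar>profile U r\<bar> \<le> M"
proof -
  have rad: "radial_on (cball 0 1) U" and adm: "k_admissible k U" and zero: "\<And>x. x \<in> sphere 0 1 \<Longrightarrow> U x = 0"
    using U by (auto simp: Phi_0_rad_def)
  have C2: "C2_on (ball 0 1) U" and cont: "continuous_on (cball 0 1) U"
    using adm by (auto simp: k_admissible_def)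
  obtain i :: 'n where True by blast
  define e :: "real ^ 'n" where "e = axis i 1"
  have e: "norm e = 1" by (simp add: e_def)
  have pe: "profile U r = U (r *\<^sub>R e)" if "r \<in> {0..1}" for r
    using profile_eq[OF rad, of "r *\<^sub>R e"] that e by simp
  have contU: "continuous_on {0..1} (\<lambda>r. U (r *\<^sub>R e))"
    by (rule continuous_on_compose2[OF cont]) (use e in \<open>auto intro!: continuous_intros\<close>)
  then have contp: "continuous_on {0..1} (profile U)"
    by (rule continuous_on_eq) (simp add: pe)
  show "\<exists>M. \<forall>r\<in>{0..1}. \<bar>profile U r\<bar> \<le> M"
    using compact_continuous_image[OF contp compact_Icc, THEN compact_imp_bounded]
    by (auto simp: bounded_iff)
  have "profile U 1 = 0" using pe[of 1] zero[of e] e by simp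
  moreover have "(profile U \<longlongrightarrow> profile U 1) (at 1 within {0..1})"
    using contp by (simp add: continuous_on_def)
  moreover have "at (1 :: real) within {0..1} = at_left 1" by (rule at_within_Icc_at_left) simp
  ultimately show "(profile U \<longlongrightarrow> 0) (at_left 1)" by simp
  show "locally_absolutely_continuous_on_Ioo 0 1 (profile U)"
    unfolding locally_absolutely_continuous_on_Ioo_def
  proof (intro allI impI, elim conjE)
    fix c d :: real assume cd: "0 < c" "c \<le> d" "d < 1"
    let ?g = "\<lambda>r. partial_deriv i U (r *\<^sub>R e)"
    have der: "((\<lambda>r. U (r *\<^sub>R e)) has_real_derivative ?g r) (at r)" if r: "r \<in> {c..d}" for r
    proof -
      have "r *\<^sub>R e \<in> ball 0 1" using r cd e by simp
      then have "U differentiable (at (r *\<^sub>R e))" using C2 by (simp add: C2_on_def)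
      then have "(U has_derivative frechet_derivative U (at (r *\<^sub>R e))) (at (r *\<^sub>R e))"
        by (rule frechet_derivative_works[THEN iffD1])
      then have *: "((\<lambda>r. U (r *\<^sub>R e)) has_derivative (\<lambda>h. frechet_derivative U (at (r *\<^sub>R e)) (h *\<^sub>R e))) (at r)"
        by (rule has_derivative_compose[rotated]) (auto intro!: derivative_eq_intros)
      have "linear (frechet_derivative U (at (r *\<^sub>R e)))"
        using \<open>U differentiable _\<close> by (rule linear_frechet_derivative)
      then have "(\<lambda>h. frechet_derivative U (at (r *\<^sub>R e)) (h *\<^sub>R e)) = (\<lambda>h. ?g r * h)"
        by (simp add: linear_cmul partial_deriv_def e_def fun_eq_iff)
      then show ?thesis using * by (simp add: has_field_derivative_def)
    qed
    have "continuous_on (ball 0 1) (partial_deriv i U)"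
      using C2 by (intro continuous_at_imp_continuous_on)
        (auto simp: C2_on_def intro: differentiable_imp_continuous_within)
    then have "continuous_on {c..d} ?g"
      by (rule continuous_on_compose2) (use cd e in \<open>auto intro!: continuous_intros\<close>)
    then obtain L where L: "\<And>r. r \<in> {c..d} \<Longrightarrow> \<bar>?g r\<bar> \<le> L"
      using compact_continuous_image[of "{c..d}" ?g, THEN compact_imp_bounded] that
      by (fastforce simp: bounded_iff)
    show "absolutely_continuous_on_Icc c d (profile U)"
    proof (rule Lipschitz_imp_absolutely_continuous[where L=L])
      fix s t assume st: "c \<le> s" "s \<le> t" "t \<le> d"
      have "norm (U (t *\<^sub>R e) - U (s *\<^sub>R e)) \<le> L * norm (t - s)"
        by (rule field_differentiable_bound[of "{c..d}" "\<lambda>r. U (r *\<^sub>R e)" ?g])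
           (use der L st in \<open>auto intro: has_field_derivative_at_within\<close>)
      then show "\<bar>profile U t - profile U s\<bar> \<le> L * (t - s)"
        using st cd by (simp add: pe)
    qed
  qed
qed


section \<open>Radial profiles of finite weighted energy\<close>

text \<open>Borel representatives of the derivative on intervals exhausting (0, 1) are glued by a
  pointwise limit: at almost every x the sequence, cut off outside its intervals, is eventually
  constant.\<close>

lemma locally_absolutely_continuous_deriv_measurable:
  fixes v :: "real \<Rightarrow> real"
  assumes ac: "locally_absolutely_continuous_on_Ioo 0 1 v"
  obtains g where "g \<in> borel_measurable borel"
    and "AE x in lborel. x \<in> {0<..<1} \<longrightarrow> g x = deriv v x"
proof -
  define a b where "a m = 1 / real (m + 3)" and "b m = 1 - 1 / real (m + 3)" for m
  have ab: "0 < a m" "a m \<le> b m" "b m < 1" for m by (auto simp: a_def b_def field_simps)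
  have "\<exists>g. g \<in> borel_measurable borel \<and> (AE x in lborel. x \<in> {a m<..<b m} \<longrightarrow> g x = deriv v x)" for m
  proof -
    have "absolutely_continuous_on_Icc (a m) (b m) v"
      using ac ab[of m] unfolding locally_absolutely_continuous_on_Ioo_def by blast
    from absolutely_continuous_increment_le[OF ab(2) this] show ?thesis by metis
  qed
  then obtain g where [measurable]: "\<And>m. g m \<in> borel_measurable borel"
    and g: "\<And>m. AE x in lborel. x \<in> {a m<..<b m} \<longrightarrow> g m x = deriv v x" by metis
  define h where "h x = lim (\<lambda>m. g m x * indicator {a m<..<b m} x)" for x
  have "h \<in> borel_measurable borel" unfolding h_def by measurable
  moreover have "AE x in lborel. \<forall>m. x \<in> {a m<..<b m} \<longrightarrow> g m x = deriv v x"
    using g by (simp add: AE_all_countable)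
  then have "AE x in lborel. x \<in> {0<..<1} \<longrightarrow> h x = deriv v x"
  proof eventually_elim
    case (elim x)
    show ?case
    proof
      assume x: "x \<in> {0<..<1}"
      have "a \<longlonglongrightarrow> 0" "b \<longlonglongrightarrow> 1" unfolding a_def b_def by real_asymp+
      then have "\<forall>\<^sub>F m in sequentially. a m < x" "\<forall>\<^sub>F m in sequentially. x < b m"
        using x by (auto dest: order_tendstoD)
      then have "\<forall>\<^sub>F m in sequentially. g m x * indicator {a m<..<b m} x = deriv v x"
        by eventually_elim (use elim in auto)
      then have "(\<lambda>m. g m x * indicator {a m<..<b m} x) \<longlonglongrightarrow> deriv v x" by (rule tendsto_eventually)
      then show "h x = deriv v x" unfolding h_def by (rule limI)
    qed
  qed
  ultimately show ?thesis using that by blast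
qed

text \<open>The interface to the one-dimensional argument. \<open>I a b\<close> is c times the
  energy carried by (a, b), as a real number, and Hoelder's inequality holds on each subinterval
  with that share of the energy alone. The bound on v itself is the limit b -> 1, where v tends to
  0.\<close>

lemma log_weighted_energy_bounds:
  fixes v :: "real \<Rightarrow> real"
  assumes c: "0 < c" and e: "0 \<le> e"
    and ac: "locally_absolutely_continuous_on_Ioo 0 1 v" and lim: "(v \<longlongrightarrow> 0) (at_left 1)"
    and en: "ennreal c * (\<integral>\<^sup>+ r\<in>{0<..<1}. ennreal (r ^ k * \<bar>deriv v r\<bar> ^ (k + 1) * (1 - ln r) ^ k) \<partial>lborel) \<le> ennreal e"
  obtains I :: "real \<Rightarrow> real \<Rightarrow> real" where "\<And>a b. 0 \<le> I a b"
    and "\<And>a b. 0 < a \<Longrightarrow> a \<le> b \<Longrightarrow> b < 1 \<Longrightarrow> I a b + I b 1 \<le> e"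
    and "\<And>a b. 0 < a \<Longrightarrow> a \<le> b \<Longrightarrow> b < 1 \<Longrightarrow> c * \<bar>v b - v a\<bar> ^ (k + 1) \<le> I a b * (ln (1 - ln a) - ln (1 - ln b)) ^ k"
    and "\<And>a. 0 < a \<Longrightarrow> a < 1 \<Longrightarrow> c * \<bar>v a\<bar> ^ (k + 1) \<le> I a 1 * ln (1 - ln a) ^ k"
proof -
  obtain g where [measurable]: "g \<in> borel_measurable borel"
    and ae: "AE x in lborel. x \<in> {0<..<1} \<longrightarrow> g x = deriv v x"
    using locally_absolutely_continuous_deriv_measurable[OF ac] by blast
  define d where "d r = ennreal (r ^ k * \<bar>g r\<bar> ^ (k + 1) * (1 - ln r) ^ k)" for r
  have [measurable]: "d \<in> borel_measurable borel" unfolding d_def by measurable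
  have deq: "(\<integral>\<^sup>+ r\<in>{a<..<b}. ennreal (r ^ k * \<bar>deriv v r\<bar> ^ (k + 1) * (1 - ln r) ^ k) \<partial>lborel) = (\<integral>\<^sup>+ r\<in>{a<..<b}. d r \<partial>lborel)"
    if ab: "0 \<le> a" "b \<le> 1" for a b
  proof (rule nn_integral_cong_AE)
    show "AE r in lborel. ennreal (r ^ k * \<bar>deriv v r\<bar> ^ (k + 1) * (1 - ln r) ^ k) * indicator {a<..<b} r = d r * indicator {a<..<b} r"
      using ae
    proof eventually_elim
      case (elim r)
      show ?case
      proof (cases "r \<in> {a<..<b}")
        case True
        then have "g r = deriv v r" using elim ab by simp
        then show ?thesis by (simp add: d_def)
      qed simp
    qed
  qed
  define J where "J a b = ennreal c * (\<integral>\<^sup>+ r\<in>{a<..<b}. d r \<partial>lborel)" for a b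
  have J01: "J 0 1 \<le> ennreal e" using en deq[of 0 1] by (simp add: J_def)
  have Jmono: "J a b \<le> J a' b'" if "a' \<le> a" "b \<le> b'" for a b a' b'
    unfolding J_def using that by (intro mult_left_mono nn_integral_mono) (auto simp: indicator_def)
  have Jsplit: "J a b + J b 1 \<le> J 0 1" if "0 < a" "a \<le> b" "b < 1" for a b
  proof -
    have "J a b + J b 1 = ennreal c * ((\<integral>\<^sup>+ r\<in>{a<..<b}. d r \<partial>lborel) + (\<integral>\<^sup>+ r\<in>{b<..<1}. d r \<partial>lborel))"
      by (simp add: J_def distrib_left)
    also have "\<dots> = ennreal c * (\<integral>\<^sup>+ r. d r * indicator {a<..<b} r + d r * indicator {b<..<1} r \<partial>lborel)"
      by (subst nn_integral_add) auto
    also have "\<dots> \<le> J 0 1"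
      unfolding J_def using that by (intro mult_left_mono nn_integral_mono) (auto simp: indicator_def)
    finally show ?thesis .
  qed
  define I where "I a b = enn2real (J a b)" for a b
  have IJ: "J a b = ennreal (I a b)" if "0 \<le> a" "b \<le> 1" for a b
  proof -
    have "J a b \<le> ennreal e" using Jmono[OF that] J01 by (rule order_trans)
    then have "J a b < \<top>" by (rule le_less_trans) simp
    then show ?thesis by (simp add: I_def)
  qed
  have I0: "0 \<le> I a b" for a b by (simp add: I_def)
  have Isplit: "I a b + I b 1 \<le> e" if "0 < a" "a \<le> b" "b < 1" for a b
  proof -
    have "ennreal (I a b + I b 1) = J a b + J b 1" using that I0 by (simp add: IJ)
    also have "\<dots> \<le> ennreal e" using Jsplit[OF that] J01 by (rule order_trans)
    finally show ?thesis using e by simp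
  qed
  have Imono: "I a b \<le> I a 1" if "0 < a" "b \<le> 1" for a b
  proof -
    have "ennreal (I a b) \<le> ennreal (I a 1)" using Jmono[of a a b 1] that by (simp add: IJ)
    then show ?thesis using I0 by simp
  qed
  have H: "c * \<bar>v b - v a\<bar> ^ (k + 1) \<le> I a b * (ln (1 - ln a) - ln (1 - ln b)) ^ k"
    if ab: "0 < a" "a \<le> b" "b < 1" for a b
  proof -
    have "\<bar>v b - v a\<bar> ^ (k + 1) \<le> (I a b / c) * (ln (1 - ln a) - ln (1 - ln b)) ^ k"
    proof (rule log_weighted_Hoelder[OF ab])
      show "absolutely_continuous_on_Icc a b v"
        using ac ab unfolding locally_absolutely_continuous_on_Ioo_def by blast
      have "ennreal c * (\<integral>\<^sup>+ r\<in>{a<..<b}. d r \<partial>lborel) = ennreal c * ennreal (I a b / c)"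
        using IJ[of a b] ab c I0[of a b] unfolding J_def by (simp add: ennreal_mult[symmetric])
      then have "(\<integral>\<^sup>+ r\<in>{a<..<b}. d r \<partial>lborel) = ennreal (I a b / c)"
        using c by (subst (asm) ennreal_mult_cancel_left) auto
      then show "(\<integral>\<^sup>+ r\<in>{a<..<b}. ennreal (r ^ k * \<bar>deriv v r\<bar> ^ (k + 1) * (1 - ln r) ^ k) \<partial>lborel) \<le> ennreal (I a b / c)"
        using deq[of a b] ab by simp
    qed (use c I0 in simp)
    then have "c * \<bar>v b - v a\<bar> ^ (k + 1) \<le> c * ((I a b / c) * (ln (1 - ln a) - ln (1 - ln b)) ^ k)"
      using c by (intro mult_left_mono) auto
    then show ?thesis using c by simp
  qed
  have H1: "c * \<bar>v a\<bar> ^ (k + 1) \<le> I a 1 * ln (1 - ln a) ^ k" if a: "0 < a" "a < 1" for a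
  proof (rule tendsto_le[OF trivial_limit_at_left_real])
    show "((\<lambda>b. I a 1 * (ln (1 - ln a) - ln (1 - ln b)) ^ k) \<longlongrightarrow> I a 1 * ln (1 - ln a) ^ k) (at_left 1)"
    proof -
      have "((\<lambda>b :: real. I a 1 * (ln (1 - ln a) - ln (1 - ln b)) ^ k) \<longlongrightarrow> I a 1 * (ln (1 - ln a) - ln (1 - ln 1)) ^ k) (at_left 1)"
        by (intro tendsto_intros) auto
      then show ?thesis by simp
    qed
    have "((\<lambda>b. c * \<bar>v b - v a\<bar> ^ (k + 1)) \<longlongrightarrow> c * \<bar>0 - v a\<bar> ^ (k + 1)) (at_left 1)"
      by (intro tendsto_intros lim)
    then show "((\<lambda>b. c * \<bar>v b - v a\<bar> ^ (k + 1)) \<longlongrightarrow> c * \<bar>v a\<bar> ^ (k + 1)) (at_left 1)" by simp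
    have "\<forall>\<^sub>F b in at_left 1. b \<in> {a<..<1}" using a by (intro eventually_at_leftI) auto
    then show "\<forall>\<^sub>F b in at_left 1. c * \<bar>v b - v a\<bar> ^ (k + 1) \<le> I a 1 * (ln (1 - ln a) - ln (1 - ln b)) ^ k"
    proof eventually_elim
      case (elim b)
      then have "0 < b" "ln b \<le> 0" "ln a \<le> ln b" using a by auto
      then have "ln (1 - ln b) \<le> ln (1 - ln a)" by (subst ln_le_cancel_iff) linarith+
      then have "I a b * (ln (1 - ln a) - ln (1 - ln b)) ^ k \<le> I a 1 * (ln (1 - ln a) - ln (1 - ln b)) ^ k"
        using Imono[of a b] a elim by (intro mult_right_mono) auto
      then show ?case using H[of a b] a elim by simp
    qed
  qed
  show ?thesis by (rule that[of I]) (fact I0 Isplit H H1)+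
qed

section \<open>The logarithmic weight, the weighted norm and radial integrands\<close>

definition log_weight :: "nat \<Rightarrow> 'a::real_normed_vector \<Rightarrow> real"
  where "log_weight k x = ln (exp 1 / norm x) powr real k"

lemma profile_log_weight:
  assumes "0 < r" "r < 1"
  shows "profile (log_weight k :: 'a::{real_normed_vector, perfect_space} \<Rightarrow> real) r = (1 - ln r) ^ k"
proof (rule profile_cong)
  fix x :: 'a assume "norm x = r"
  have "ln r < 0" using assms by simp
  then have "0 < 1 - ln r" by linarith
  moreover have "ln (exp 1 / r) = 1 - ln r" using assms by (simp add: ln_div)
  ultimately show "log_weight k x = (1 - ln r) ^ k"
    using \<open>norm x = r\<close> by (simp add: log_weight_def powr_realpow)
qed (use assms in simp)

lemma Phi_energy_log_weight:
  fixes u :: "real ^ 'n \<Rightarrow> real"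
  assumes "CARD('n) = 2 * k"
  shows "Phi_energy k (log_weight k) u = ennreal (hessian_const TYPE('n) k) *
    (\<integral>\<^sup>+ r\<in>{0<..<1}. ennreal (r ^ k * \<bar>deriv (profile u) r\<bar> ^ (k + 1) * (1 - ln r) ^ k) \<partial>lborel)"
proof -
  have "CARD('n) - k = k" using assms by simp
  show ?thesis
    unfolding Phi_energy_def
  proof (rule arg_cong2[where f="(*)", OF refl nn_integral_cong])
    fix r
    show "ennreal (r ^ (CARD('n) - k) * \<bar>deriv (profile u) r\<bar> ^ (k + 1) * profile (log_weight k :: real ^ 'n \<Rightarrow> real) r) * indicator {0<..<1} r =
        ennreal (r ^ k * \<bar>deriv (profile u) r\<bar> ^ (k + 1) * (1 - ln r) ^ k) * indicator {0<..<1} r"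
      using profile_log_weight[where 'a="real ^ 'n", of r k] \<open>CARD('n) - k = k\<close>
      by (cases "r \<in> {0<..<1}") simp_all
  qed
qed

lemma sphere_area_eq: "sphere_area TYPE('n::finite) = real CARD('n) * unit_ball_vol (real CARD('n))"
proof -
  have "{t *\<^sub>R x | t x. 0 < t \<and> t \<le> 1 \<and> x \<in> sphere (0 :: real ^ 'n) 1} = cball 0 1 - {0}"
  proof (intro set_eqI iffI)
    fix y :: "real ^ 'n" assume y: "y \<in> cball 0 1 - {0}"
    then have "y = norm y *\<^sub>R (y /\<^sub>R norm y)" "0 < norm y" "norm y \<le> 1" "y /\<^sub>R norm y \<in> sphere 0 1" by auto
    then show "y \<in> {t *\<^sub>R x | t x. 0 < t \<and> t \<le> 1 \<and> x \<in> sphere (0 :: real ^ 'n) 1}" by blast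
  qed auto
  moreover have "measure lebesgue (cball 0 1 - {0 :: real ^ 'n}) = measure lebesgue (cball (0 :: real ^ 'n) 1)"
    by (rule measure_Diff_null_set) auto
  moreover have "measure lebesgue (cball (0 :: real ^ 'n) 1) = unit_ball_vol (real CARD('n))"
    using content_cball[of 1 "0 :: real ^ 'n"] by simp
  ultimately show ?thesis by (simp add: sphere_area_def sphere_measure_def)
qed

lemma hessian_const_pos:
  assumes "1 \<le> k" "k \<le> CARD('n::finite)"
  shows "0 < hessian_const TYPE('n) k"
proof -
  have "0 < (CARD('n) - 1) choose (k - 1)" using assms by (simp add: zero_less_binomial_iff)
  then show ?thesis
    unfolding hessian_const_def sphere_area_eq using assms
    by (intro mult_pos_pos divide_pos_pos) (auto simp: unit_ball_vol_pos)
qed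

lemma Phi_energy_le_if_Phi_norm_le:
  assumes "Phi_norm k w u \<le> ennreal b" "0 \<le> b"
  shows "Phi_energy k w u \<le> ennreal (b ^ (k + 1))"
proof -
  have fin: "Phi_energy k w u \<noteq> \<infinity>"
    using assms unfolding Phi_norm_def by (auto simp: top_unique split: if_splits)
  define x where "x = enn2real (Phi_energy k w u)"
  have x: "0 \<le> x" "Phi_energy k w u = ennreal x" using fin by (auto simp: x_def top.not_eq_extremum)
  have "x powr (1 / real (k + 1)) \<le> b"
    using assms fin unfolding Phi_norm_def x_def[symmetric] by (simp add: ennreal_le_iff)
  then have "(x powr (1 / real (k + 1))) ^ (k + 1) \<le> b ^ (k + 1)" by (intro power_mono) auto
  moreover have "(x powr (1 / real (k + 1))) ^ (k + 1) = x"
    using x(1) by (cases "x = 0") (auto simp: powr_realpow[symmetric] powr_powr simp del: power_Suc of_nat_Suc of_nat_add)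
  ultimately show ?thesis unfolding x(2) by (intro ennreal_leI) simp
qed

lemma Phi_norm_le_1_if_Phi_energy_le_1:
  assumes "Phi_energy k w u \<le> 1"
  shows "Phi_norm k w u \<le> 1"
proof -
  have fin: "Phi_energy k w u \<noteq> \<infinity>" using assms by (auto simp: top_unique)
  define x where "x = enn2real (Phi_energy k w u)"
  have x: "0 \<le> x" "Phi_energy k w u = ennreal x" using fin by (auto simp: x_def top.not_eq_extremum)
  then have "x \<le> 1" using assms by simp
  then have "x powr (1 / real (k + 1)) \<le> 1" using x(1) by (intro powr_le1) auto
  then show ?thesis using fin unfolding Phi_norm_def x_def[symmetric] by (simp add: ennreal_le_1)
qed

lemma Phi_0_rad_subset_weighted:
  fixes U :: "real ^ 'n \<Rightarrow> real"
  assumes U: "U \<in> Phi_0_rad k" and fin: "Phi_norm k w U < \<infinity>"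
  shows "U \<in> Phi_0_rad_weighted k w"
proof -
  have "Phi_norm k w (\<lambda>x. U x - U x) = 0"
  proof -
    have "profile (\<lambda>x :: real ^ 'n. 0) = (\<lambda>r. 0)" by (simp add: profile_def fun_eq_iff)
    then show ?thesis by (simp add: Phi_norm_def Phi_energy_def)
  qed
  then have "(\<lambda>m :: nat. Phi_norm k w (\<lambda>x. U x - U x)) \<longlonglongrightarrow> 0" by simp
  moreover have "radial_on (ball 0 1 - {0}) U" using U by (auto simp: Phi_0_rad_def radial_on_def)
  ultimately show ?thesis
    unfolding Phi_0_rad_weighted_def using Phi_0_rad_profile[OF U] U fin
    by (intro CollectI conjI exI[of _ "\<lambda>m. U"]) auto
qed

lemma locally_absolutely_continuous_diff:
  assumes "locally_absolutely_continuous_on_Ioo a b f" "locally_absolutely_continuous_on_Ioo a b g"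
  shows "locally_absolutely_continuous_on_Ioo a b (\<lambda>x. f x - g x)"
  using assms absolutely_continuous_diff unfolding locally_absolutely_continuous_on_Ioo_def by blast

lemma locally_absolutely_continuous_imp_continuous_on:
  assumes "locally_absolutely_continuous_on_Ioo a b f"
  shows "continuous_on {a<..<b} f"
proof (rule continuous_at_imp_continuous_on, rule ballI)
  fix x assume x: "x \<in> {a<..<b}"
  define c d where "c = (a + x) / 2" and "d = (x + b) / 2"
  have cd: "a < c" "c < x" "x < d" "d < b" using x by (auto simp: c_def d_def field_simps)
  then have "absolutely_continuous_on_Icc c d f"
    using assms unfolding locally_absolutely_continuous_on_Ioo_def by (meson less_imp_le order.strict_trans)
  then have "continuous_on {c..d} f" by (rule absolutely_continuous_imp_continuous_on)
  then have "continuous_on {c<..<d} f" by (rule continuous_on_subset) auto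
  then show "isCont f x" using cd by (simp add: continuous_on_eq_continuous_at)
qed

text \<open>The origin, where the profile says nothing about u, is a null set. The double negation
  displays the radius as exp (- t) with t = - ln (norm x).\<close>

lemma AE_ball_radial:
  fixes u :: "real ^ 'n \<Rightarrow> real"
  assumes "radial_on (ball 0 1 - {0}) u"
  shows "AE x in lborel. x \<in> ball 0 1 \<longrightarrow> u x = profile u (exp (- (- ln (norm x)))) \<and> 0 < - ln (norm x)"
proof -
  have "AE x in lborel. x \<noteq> (0 :: real ^ 'n)" by (rule AE_lborel_singleton)
  then show ?thesis
  proof eventually_elim
    case (elim x)
    show ?case
    proof
      assume x: "x \<in> ball 0 1"
      have "profile u (norm x) = u x"
      proof (rule profile_eq[OF assms])
        fix y :: "real ^ 'n" assume "norm y = norm x"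
        moreover from this have "y \<noteq> 0" using elim by (metis norm_eq_zero)
        ultimately show "y \<in> ball 0 1 - {0}" using x by simp
      qed (use x elim in simp)
      then show "u x = profile u (exp (- (- ln (norm x)))) \<and> 0 < - ln (norm x)"
        using elim x by simp
    qed
  qed
qed

text \<open>F is the integrand in the variable t = - ln (norm x). It is tied to u for t > 0 only, so
  that its other values can be set in a way that makes it Borel.\<close>

lemma nn_integral_ball_radial:
  fixes u :: "real ^ 'n \<Rightarrow> real" and F :: "real \<Rightarrow> ennreal"
  assumes rad: "radial_on (ball 0 1 - {0}) u"
    and [measurable]: "F \<in> borel_measurable borel"
    and F: "\<And>t. 0 < t \<Longrightarrow> H (profile u (exp (- t))) = F t"
  shows "(\<integral>\<^sup>+ x\<in>ball 0 1. H (u x) \<partial>lborel) = ennreal (unit_ball_vol (real CARD('n))) *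
    (\<integral>\<^sup>+ t\<in>{0..}. ennreal (real CARD('n) * exp (- (real CARD('n) * t))) * F t \<partial>lborel)"
proof -
  have "(\<integral>\<^sup>+ x\<in>ball 0 1. H (u x) \<partial>lborel) = (\<integral>\<^sup>+ x\<in>ball (0 :: real ^ 'n) 1. F (- ln (norm x)) \<partial>lborel)"
  proof (rule nn_integral_cong_AE)
    show "AE x in lborel. H (u x) * indicator (ball 0 1) x = F (- ln (norm x)) * indicator (ball 0 1) x"
      using AE_ball_radial[OF rad]
    proof eventually_elim
      case (elim x)
      show ?case
      proof (cases "x \<in> ball 0 1")
        case True
        then have "H (u x) = F (- ln (norm x))" using elim F[of "- ln (norm x)"] by metis
        then show ?thesis by simp
      qed simp
    qed
  qed
  then show ?thesis using nn_integral_ball_neg_ln_norm[where 'a="real ^ 'n", of F] by simp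
qed


section \<open>The integral inequalities\<close>

lemma Phi_0_rad_weightedD:
  assumes "u \<in> Phi_0_rad_weighted k w"
  shows "radial_on (ball 0 1 - {0}) u" "locally_absolutely_continuous_on_Ioo 0 1 (profile u)"
    "(profile u \<longlongrightarrow> 0) (at_left 1)"
  using assms by (simp_all add: Phi_0_rad_weighted_def)

lemma power_powr_divide:
  fixes x :: real
  assumes "0 \<le> x" "1 \<le> k" "1 \<le> j"
  shows "(x powr (real j / real k)) ^ k = x ^ j"
proof (cases "x = 0")
  case False
  then have "(x powr (real j / real k)) ^ k = (x powr (real j / real k)) powr real k"
    using assms by (simp add: powr_realpow)
  also have "\<dots> = x powr real j" using assms by (simp add: powr_powr)
  also have "\<dots> = x ^ j" using False assms by (simp add: powr_realpow)
  finally show ?thesis .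
qed (use assms in \<open>simp add: power_0_left\<close>)

lemma exp_one_minus_exp:
  assumes "0 < (s :: real)"
  shows "0 < exp (1 - exp s)" "exp (1 - exp s) < 1" "ln (1 - ln (exp (1 - exp s))) = s"
  using assms by auto

text \<open>The critical case a = n, with a bound depending on n and k alone. For s < t, the energy
  outside radius \<rho> s and the energy between \<rho> t and \<rho> s are the shares \<alpha> and
  \<beta> of the splitting argument.\<close>

lemma double_exp_integral_le:
  fixes u :: "real ^ 'n \<Rightarrow> real" and k :: nat
  defines "c \<equiv> hessian_const TYPE('n) k"
  assumes nk: "CARD('n) = 2 * k" and u: "u \<in> Phi_0_rad_weighted k (log_weight k)"
    and norm: "Phi_norm k (log_weight k) u \<le> 1"
  shows "(\<integral>\<^sup>+ x\<in>ball 0 1. ennreal (exp (real CARD('n) * exp (c powr (1 / real k) * \<bar>u x\<bar> powr (real (k + 1) / real k)))) \<partial>lborel)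
    \<le> ennreal (unit_ball_vol (real CARD('n))) * ennreal (real CARD('n) * exp (real CARD('n)) *
        (exp 1 + 32 / (real CARD('n) * (1 / (real k * 4 ^ (k + 1))))))"
proof -
  have "0 < CARD('n)" by (rule zero_less_card_finite)
  then have k: "1 \<le> k" using nk by linarith
  have c: "0 < c" unfolding c_def using k nk by (intro hessian_const_pos) auto
  define v where "v = profile u"
  note uD = Phi_0_rad_weightedD[OF u]
  have en: "ennreal c * (\<integral>\<^sup>+ r\<in>{0<..<1}. ennreal (r ^ k * \<bar>deriv v r\<bar> ^ (k + 1) * (1 - ln r) ^ k) \<partial>lborel) \<le> ennreal 1"
    using Phi_energy_le_if_Phi_norm_le[of k "log_weight k" u 1] norm
    unfolding Phi_energy_log_weight[OF nk] c_def v_def by simp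
  obtain I :: "real \<Rightarrow> real \<Rightarrow> real" where I0: "\<And>a b. 0 \<le> I a b"
    and Isplit: "\<And>a b. 0 < a \<Longrightarrow> a \<le> b \<Longrightarrow> b < 1 \<Longrightarrow> I a b + I b 1 \<le> 1"
    and H: "\<And>a b. 0 < a \<Longrightarrow> a \<le> b \<Longrightarrow> b < 1 \<Longrightarrow> c * \<bar>v b - v a\<bar> ^ (k + 1) \<le> I a b * (ln (1 - ln a) - ln (1 - ln b)) ^ k"
    and H1: "\<And>a. 0 < a \<Longrightarrow> a < 1 \<Longrightarrow> c * \<bar>v a\<bar> ^ (k + 1) \<le> I a 1 * ln (1 - ln a) ^ k"
    using log_weighted_energy_bounds[OF c _ uD(2)[folded v_def] uD(3)[folded v_def] en] by auto
  define \<rho> where "\<rho> s = exp (1 - exp s)" for s :: real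
  have \<rho>: "0 < \<rho> s" "\<rho> s < 1" "ln (1 - ln (\<rho> s)) = s" if "0 < s" for s
    unfolding \<rho>_def using exp_one_minus_exp[OF that] by auto
  \<comment> \<open>For s \<le> 0 the radius \<rho> s leaves (0, 1). The value 0 there makes G Borel
    on the whole line and gives \<open>G 0 = 0\<close>.\<close>
  define G where "G s = (if 0 < s then c powr (1 / real k) * \<bar>v (\<rho> s)\<bar> powr (real (k + 1) / real k) else 0)" for s
  have G0: "0 \<le> G s" for s by (simp add: G_def)
  have Gk: "G s ^ k = c * \<bar>v (\<rho> s)\<bar> ^ (k + 1)" if "0 < s" for s
  proof -
    have "(c powr (1 / real k)) ^ k = c"
      using power_powr_divide[of c k 1, unfolded of_nat_1 power_one_right] c k by auto
    moreover have "(\<bar>v (\<rho> s)\<bar> powr (real (k + 1) / real k)) ^ k = \<bar>v (\<rho> s)\<bar> ^ (k + 1)"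
      by (rule power_powr_divide) (use k in auto)
    ultimately show ?thesis using that by (simp only: G_def if_True power_mult_distrib)
  qed
  have Gle: "G s \<le> s" if "0 \<le> s" for s
  proof (cases "s = 0")
    case False
    then have s: "0 < s" using that by simp
    have "I (\<rho> s) 1 \<le> 1" using Isplit[of "\<rho> s" "\<rho> s"] \<rho>[OF s] I0[of "\<rho> s" "\<rho> s"] by simp
    then have "I (\<rho> s) 1 * s ^ k \<le> 1 * s ^ k" using s by (intro mult_right_mono) auto
    then have "G s ^ k \<le> s ^ k" using H1[OF \<rho>(1,2)[OF s]] \<rho>(3)[OF s] Gk[OF s] by simp
    then show ?thesis using s k by (intro le_if_power_le[of "G s" k]) auto
  qed (simp add: G_def)
  have contv: "continuous_on {0<..<1} v"
    using locally_absolutely_continuous_imp_continuous_on[OF uD(2)] by (simp add: v_def)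
  have contG: "continuous_on {0<..} G"
  proof -
    have "continuous_on {0<..} (\<lambda>s. v (\<rho> s))"
    proof (rule continuous_on_compose2[OF contv])
      show "continuous_on {0<..} \<rho>" unfolding \<rho>_def by (intro continuous_intros)
    qed (use \<rho> in auto)
    then have "continuous_on {0<..} (\<lambda>s. c powr (1 / real k) * \<bar>v (\<rho> s)\<bar> powr (real (k + 1) / real k))"
      using k c by (intro continuous_intros continuous_on_powr') auto
    then show ?thesis by (rule continuous_on_eq) (simp add: G_def)
  qed
  have Gm: "G \<in> borel_measurable borel"
  proof -
    have "(\<lambda>s. indicator {0<..} s *\<^sub>R G s) \<in> borel_measurable borel"
      by (rule borel_measurable_continuous_on_indicator) (use contG in auto)
    moreover have "(\<lambda>s. indicator {0<..} s *\<^sub>R G s) = G" by (auto simp: G_def fun_eq_iff)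
    ultimately show ?thesis by simp
  qed
  let ?c0 = "1 / (real k * 4 ^ (k + 1))"
  have gap: "max (s - G s) (t - G t) \<ge> ?c0 * (s * (t - s) / t)" if st: "0 < s" "s < t" for s t
  proof -
    have t: "0 < t" using st by simp
    have le: "\<rho> t \<le> \<rho> s" using st by (simp add: \<rho>_def)
    \<comment> \<open>The root absorbs c into the amplitude R * |v|, as the splitting argument is
      stated without constants.\<close>
    define R where "R = root (k + 1) c"
    have R: "0 \<le> R" "R ^ (k + 1) = c" using c unfolding R_def by (auto simp del: power_Suc intro!: real_root_pow_pos2)
    show ?thesis
    proof (rule energy_splitting_deficit[OF k st, where As = "R * \<bar>v (\<rho> s)\<bar>" and At = "R * \<bar>v (\<rho> t)\<bar>"
          and \<alpha> = "I (\<rho> s) 1" and \<beta> = "I (\<rho> t) (\<rho> s)"])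
      show "I (\<rho> s) 1 + I (\<rho> t) (\<rho> s) \<le> 1" using Isplit[OF \<rho>(1)[OF t] le \<rho>(2)[OF st(1)]] by simp
      show "G s ^ k = (R * \<bar>v (\<rho> s)\<bar>) ^ (k + 1)" "G t ^ k = (R * \<bar>v (\<rho> t)\<bar>) ^ (k + 1)"
        using Gk[OF st(1)] Gk[OF t] R by (simp_all only: power_mult_distrib)
      show "(R * \<bar>v (\<rho> s)\<bar>) ^ (k + 1) \<le> I (\<rho> s) 1 * s ^ k"
        using H1[OF \<rho>(1,2)[OF st(1)]] \<rho>(3)[OF st(1)] R by (simp only: power_mult_distrib)
      have "\<bar>R * \<bar>v (\<rho> t)\<bar> - R * \<bar>v (\<rho> s)\<bar>\<bar> = R * \<bar>\<bar>v (\<rho> t)\<bar> - \<bar>v (\<rho> s)\<bar>\<bar>"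
        using R by (simp add: right_diff_distrib[symmetric] abs_mult)
      also have "\<dots> \<le> R * \<bar>v (\<rho> s) - v (\<rho> t)\<bar>" using R by (intro mult_left_mono) auto
      finally have "\<bar>R * \<bar>v (\<rho> t)\<bar> - R * \<bar>v (\<rho> s)\<bar>\<bar> ^ (k + 1) \<le> (R * \<bar>v (\<rho> s) - v (\<rho> t)\<bar>) ^ (k + 1)"
        by (intro power_mono) auto
      also have "\<dots> \<le> I (\<rho> t) (\<rho> s) * (t - s) ^ k"
        using H[OF \<rho>(1)[OF t] le \<rho>(2)[OF st(1)]] \<rho>(3)[OF st(1)] \<rho>(3)[OF t] R by (simp only: power_mult_distrib)
      finally show "\<bar>R * \<bar>v (\<rho> t)\<bar> - R * \<bar>v (\<rho> s)\<bar>\<bar> ^ (k + 1) \<le> I (\<rho> t) (\<rho> s) * (t - s) ^ k" .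
    qed (use R I0 G0 in auto)
  qed
  have c0: "0 < ?c0" "?c0 \<le> 1"
  proof -
    have "1 * 1 \<le> real k * 4 ^ (k + 1)" using k by (intro mult_mono one_le_power) auto
    then show "0 < ?c0" "?c0 \<le> 1" using k by auto
  qed
  have "(\<integral>\<^sup>+ x\<in>ball 0 1. ennreal (exp (real CARD('n) * exp (c powr (1 / real k) * \<bar>u x\<bar> powr (real (k + 1) / real k)))) \<partial>lborel) =
     ennreal (unit_ball_vol (real CARD('n))) *
     (\<integral>\<^sup>+ t\<in>{0..}. ennreal (real CARD('n) * exp (- (real CARD('n) * t))) * ennreal (exp (real CARD('n) * exp (G (ln (1 + t))))) \<partial>lborel)"
  proof (rule nn_integral_ball_radial[OF uD(1)])
    show "(\<lambda>t. ennreal (exp (real CARD('n) * exp (G (ln (1 + t)))))) \<in> borel_measurable borel"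
      using Gm by measurable
    fix t :: real assume t: "0 < t"
    then have "\<rho> (ln (1 + t)) = exp (- t)" by (simp add: \<rho>_def)
    then show "ennreal (exp (real CARD('n) * exp (c powr (1 / real k) * \<bar>profile u (exp (- t))\<bar> powr (real (k + 1) / real k)))) =
       ennreal (exp (real CARD('n) * exp (G (ln (1 + t)))))"
      using t by (simp add: G_def v_def)
  qed
  also have "\<dots> \<le> ennreal (unit_ball_vol (real CARD('n))) * ennreal (real CARD('n) * exp (real CARD('n)) * (exp 1 + 32 / (real CARD('n) * ?c0)))"
  proof (intro mult_left_mono nn_integral_double_exp_le[OF c0 _ Gm])
    show "continuous_on {1..} G" using contG by (rule continuous_on_subset) auto
  qed (use Gle gap in auto)
  finally show ?thesis .
qed

text \<open>If |u| powr q is at most K + s / 2, its exponential is at most exp K * sqrt (1 + t),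
  which is bounded by a constant plus t / 2; the factor exp (- n * t) then dominates exp (t / 2).
  One approximant suffices, close enough for the remainder to have energy at most e.\<close>

lemma double_exp_integral_finite:
  fixes u :: "real ^ 'n \<Rightarrow> real"
  assumes nk: "CARD('n) = 2 * k" and u: "u \<in> Phi_0_rad_weighted k (log_weight k)"
  shows "(\<integral>\<^sup>+ x\<in>ball 0 1. ennreal (exp (exp (\<bar>u x\<bar> powr (real (k + 1) / real k)))) \<partial>lborel) < \<infinity>"
proof -
  define n where "n = CARD('n)"
  have "0 < CARD('n)" by (rule zero_less_card_finite)
  then have k: "1 \<le> k" using nk by linarith
  define c where "c = hessian_const TYPE('n) k"
  have c: "0 < c" unfolding c_def using k nk by (intro hessian_const_pos) auto
  define q where "q = real (k + 1) / real k"
  have q: "0 < q" using k by (simp add: q_def)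
  define v where "v = profile u"
  note uD = Phi_0_rad_weightedD[OF u]
  obtain U :: "nat \<Rightarrow> real ^ 'n \<Rightarrow> real" where U: "\<And>m. U m \<in> Phi_0_rad k"
    and lim: "(\<lambda>m. Phi_norm k (log_weight k) (\<lambda>x. U m x - u x)) \<longlonglongrightarrow> 0"
    using u by (auto simp: Phi_0_rad_weighted_def)
  \<comment> \<open>chosen so that \<open>2 powr q * \<delta> powr (1 / k) = 1 / 2\<close>\<close>
  define \<delta> where "\<delta> = (2 powr q * 2) powr - real k"
  have \<delta>: "0 < \<delta>" by (simp add: \<delta>_def)
  \<comment> \<open>The energy at which Hoelder's inequality reads |w| ^ (k + 1) \<le> \<delta> * s
    ^ k; b is the corresponding norm.\<close>
  define e where "e = c * \<delta>"
  have e: "0 < e" using c \<delta> by (simp add: e_def)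
  define b where "b = root (k + 1) e"
  have b: "0 < b" "b ^ (k + 1) = e" using e unfolding b_def by (auto simp del: power_Suc intro!: real_root_pow_pos2)
  have "\<forall>\<^sub>F m in sequentially. Phi_norm k (log_weight k) (\<lambda>x. U m x - u x) < ennreal b"
    using lim b by (intro order_tendstoD) auto
  then obtain m where m: "Phi_norm k (log_weight k) (\<lambda>x. U m x - u x) \<le> ennreal b"
    by (auto simp: eventually_sequentially intro: less_imp_le)
  define w where "w = (\<lambda>r. profile (U m) r - v r)"
  have wp: "w = profile (\<lambda>x. U m x - u x)" by (simp add: w_def v_def profile_diff)
  note UP = Phi_0_rad_profile[OF U[of m]]
  have en: "ennreal c * (\<integral>\<^sup>+ r\<in>{0<..<1}. ennreal (r ^ k * \<bar>deriv w r\<bar> ^ (k + 1) * (1 - ln r) ^ k) \<partial>lborel) \<le> ennreal e"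
    using Phi_energy_le_if_Phi_norm_le[OF m] b unfolding Phi_energy_log_weight[OF nk] c_def wp by simp
  have acw: "locally_absolutely_continuous_on_Ioo 0 1 w"
    unfolding w_def v_def by (rule locally_absolutely_continuous_diff[OF UP(1) uD(2)])
  have limw: "(w \<longlongrightarrow> 0) (at_left 1)"
    using tendsto_diff[OF UP(2) uD(3)] by (simp add: w_def v_def)
  obtain I :: "real \<Rightarrow> real \<Rightarrow> real" where I0: "\<And>a b. 0 \<le> I a b"
    and Isplit: "\<And>a b. 0 < a \<Longrightarrow> a \<le> b \<Longrightarrow> b < 1 \<Longrightarrow> I a b + I b 1 \<le> e"
    and "\<And>a b. 0 < a \<Longrightarrow> a \<le> b \<Longrightarrow> b < 1 \<Longrightarrow> c * \<bar>w b - w a\<bar> ^ (k + 1) \<le> I a b * (ln (1 - ln a) - ln (1 - ln b)) ^ k"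
    and H1: "\<And>a. 0 < a \<Longrightarrow> a < 1 \<Longrightarrow> c * \<bar>w a\<bar> ^ (k + 1) \<le> I a 1 * ln (1 - ln a) ^ k"
    using log_weighted_energy_bounds[OF c less_imp_le[OF e] acw limw en] by blast
  obtain M where M: "\<And>r. r \<in> {0..1} \<Longrightarrow> \<bar>profile (U m) r\<bar> \<le> M" using UP(3) by blast
  define K where "K = (2 * M) powr q"
  have vb: "\<bar>v (exp (- t))\<bar> powr q \<le> K + ln (1 + t) / 2" if t: "0 < t" for t
  proof -
    define r where "r = exp (- t)"
    have r: "0 < r" "r < 1" "ln (1 - ln r) = ln (1 + t)" using t by (auto simp: r_def)
    have "c * \<bar>w r\<bar> ^ (k + 1) \<le> I r 1 * ln (1 + t) ^ k" using H1[OF r(1,2)] r(3) by simp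
    also have "\<dots> \<le> e * ln (1 + t) ^ k"
      using Isplit[of r r] r I0[of r r] t by (intro mult_right_mono) auto
    finally have w1: "\<bar>w r\<bar> ^ (k + 1) \<le> \<delta> * ln (1 + t) ^ k" using c by (simp add: e_def)
    have w2: "\<bar>w r\<bar> powr q \<le> \<delta> powr (1 / real k) * ln (1 + t)"
    proof (rule le_if_power_le[of _ k])
      have "(\<delta> powr (1 / real k)) ^ k = \<delta>" using power_powr_divide[of \<delta> k 1, unfolded of_nat_1 power_one_right] \<delta> k by auto
      then show "(\<bar>w r\<bar> powr q) ^ k \<le> (\<delta> powr (1 / real k) * ln (1 + t)) ^ k"
        using w1 power_powr_divide[of "\<bar>w r\<bar>" k "k + 1"] k by (simp only: q_def power_mult_distrib abs_ge_zero)
    qed (use k t in auto)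
    have "\<delta> powr (1 / real k) = (2 powr q * 2) powr (- real k * (1 / real k))"
      by (simp only: \<delta>_def powr_powr)
    also have "- real k * (1 / real k) = - 1" using k by simp
    finally have "\<delta> powr (1 / real k) = inverse (2 powr q * 2)"
      by (simp only: powr_minus powr_one_gt_zero_iff) simp
    then have d2: "2 powr q * (\<delta> powr (1 / real k) * ln (1 + t)) = ln (1 + t) / 2" by (simp add: field_simps)
    have Mr: "\<bar>profile (U m) r\<bar> \<le> M" using M r by simp
    have "\<bar>v r\<bar> \<le> M + \<bar>w r\<bar>" using Mr by (simp add: w_def)
    \<comment> \<open>A sum is at most twice its larger term. Raised to the power q this costs the
      factor 2 powr q, which the choice of \<delta> compensates.\<close>
    also have "\<dots> \<le> max (2 * M) (2 * \<bar>w r\<bar>)" by simp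
    finally have "\<bar>v r\<bar> powr q \<le> max (2 * M) (2 * \<bar>w r\<bar>) powr q" using q by (intro powr_mono2) auto
    also have "\<dots> \<le> (2 * M) powr q + (2 * \<bar>w r\<bar>) powr q" by (simp add: max_def)
    also have "(2 * \<bar>w r\<bar>) powr q = 2 powr q * \<bar>w r\<bar> powr q" by (simp add: powr_mult)
    also have "2 powr q * \<bar>w r\<bar> powr q \<le> ln (1 + t) / 2"
      unfolding d2[symmetric] using w2 by (intro mult_left_mono) auto
    finally show ?thesis by (simp add: r_def K_def)
  qed
  define A where "A = exp ((exp K) ^ 2 / 2 + 1 / 2)"
  have expb: "exp (exp (\<bar>v (exp (- t))\<bar> powr q)) \<le> A * exp (t / 2)" if t: "0 < t" for t
  proof -
    have "exp (\<bar>v (exp (- t))\<bar> powr q) \<le> exp (K + ln (1 + t) / 2)" using vb[OF t] by simp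
    also have "\<dots> = exp K * sqrt (1 + t)"
      using t by (simp add: exp_add ln_sqrt[symmetric])
    \<comment> \<open>The inequality of arithmetic and geometric means trades the square root for
      the linear growth t / 2.\<close>
    also have "\<dots> \<le> ((exp K) ^ 2 + (sqrt (1 + t)) ^ 2) / 2"
      using sum_squares_bound[of "exp K" "sqrt (1 + t)"] by simp
    also have "\<dots> = (exp K) ^ 2 / 2 + 1 / 2 + t / 2" using t by (simp add: field_simps)
    finally show ?thesis by (simp add: A_def exp_add[symmetric])
  qed
  define F where "F t = ennreal (indicator {0<..} t * exp (exp (\<bar>v (exp (- t))\<bar> powr q)))" for t
  have contv: "continuous_on {0<..<1} v"
    using locally_absolutely_continuous_imp_continuous_on[OF uD(2)] by (simp add: v_def)
  have Fm: "F \<in> borel_measurable borel"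
  proof -
    have "continuous_on {0<..} (\<lambda>t. v (exp (- t)))"
      by (rule continuous_on_compose2[OF contv]) (auto intro!: continuous_intros)
    then have "continuous_on {0<..} (\<lambda>t. exp (exp (\<bar>v (exp (- t))\<bar> powr q)))"
      using q by (intro continuous_intros continuous_on_powr') auto
    then have "(\<lambda>t. indicator {0<..} t *\<^sub>R exp (exp (\<bar>v (exp (- t))\<bar> powr q))) \<in> borel_measurable borel"
      by (intro borel_measurable_continuous_on_indicator) auto
    then show ?thesis unfolding F_def by simp
  qed
  have "(\<integral>\<^sup>+ x\<in>ball 0 1. ennreal (exp (exp (\<bar>u x\<bar> powr q))) \<partial>lborel) =
     ennreal (unit_ball_vol (real n)) * (\<integral>\<^sup>+ t\<in>{0..}. ennreal (real n * exp (- (real n * t))) * F t \<partial>lborel)"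
    unfolding n_def by (rule nn_integral_ball_radial[OF uD(1) Fm]) (simp add: F_def v_def)
  also have "\<dots> \<le> ennreal (unit_ball_vol (real n)) * (\<integral>\<^sup>+ t. ennreal (real n * A) * ennreal (exp (- (1 * \<bar>t - 0\<bar>))) \<partial>lborel)"
  proof (intro mult_left_mono nn_integral_mono)
    fix t :: real
    show "ennreal (real n * exp (- (real n * t))) * F t * indicator {0..} t \<le> ennreal (real n * A) * ennreal (exp (- (1 * \<bar>t - 0\<bar>)))"
    proof (cases "0 < t")
      case True
      have "2 \<le> real n" using nk k by (simp add: n_def)
      then have "2 * t \<le> real n * t" using True by (intro mult_right_mono) auto
      then have "- (real n * t) + t / 2 \<le> - t" using True by linarith
      then have "exp (- (real n * t)) * exp (t / 2) \<le> exp (- t)" by (simp only: exp_add[symmetric] exp_le_cancel_iff)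
      then have "real n * A * (exp (- (real n * t)) * exp (t / 2)) \<le> real n * A * exp (- t)"
        by (intro mult_left_mono) (auto simp: A_def)
      moreover have "real n * exp (- (real n * t)) * exp (exp (\<bar>v (exp (- t))\<bar> powr q)) \<le>
          real n * exp (- (real n * t)) * (A * exp (t / 2))"
        using expb[OF True] by (intro mult_left_mono) auto
      ultimately have "real n * exp (- (real n * t)) * exp (exp (\<bar>v (exp (- t))\<bar> powr q)) \<le> real n * A * exp (- t)"
        by (simp add: mult_ac)
      then show ?thesis using True by (simp add: F_def ennreal_mult[symmetric] A_def)
    qed (auto simp: F_def)
  qed auto
  also have "\<dots> \<le> ennreal (unit_ball_vol (real n)) * (ennreal (real n * A) * ennreal (2 / 1))"
    using nn_integral_exp_neg_abs_le[of 1 0] by (subst nn_integral_cmult) (auto intro!: mult_left_mono)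
  also have "\<dots> < \<infinity>" by (simp add: ennreal_mult_less_top)
  finally show ?thesis by (simp add: q_def)
qed


section \<open>Extremal functions\<close>

text \<open>A regularization of \<open>ln (e / |x|)\<close> as a function of \<open>\<rho> = |x|^2\<close>, equal to 1 at \<open>\<rho> = 1\<close>.\<close>
definition reg_log :: "real \<Rightarrow> real \<Rightarrow> real"
  where "reg_log \<epsilon> \<rho> = 1 - ln ((\<rho> + \<epsilon>) / (1 + \<epsilon>)) / 2"

lemma reg_log_alt:
  assumes "0 < \<epsilon>" "0 \<le> \<rho>"
  shows "reg_log \<epsilon> \<rho> = 1 - ln (\<rho> + \<epsilon>) / 2 + ln (1 + \<epsilon>) / 2"
  using assms by (simp add: reg_log_def ln_div diff_divide_distrib)

lemma reg_log_antimono: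
  assumes "0 < \<epsilon>" "0 \<le> \<rho>" "\<rho> \<le> \<rho>'"
  shows "reg_log \<epsilon> \<rho>' \<le> reg_log \<epsilon> \<rho>"
  using assms by (simp add: reg_log_alt)

lemma reg_log_1 [simp]: "0 < \<epsilon> \<Longrightarrow> reg_log \<epsilon> 1 = 1"
  by (simp add: reg_log_def)

lemma reg_log_ge_1:
  assumes "0 < \<epsilon>" "0 \<le> \<rho>" "\<rho> \<le> 1"
  shows "1 \<le> reg_log \<epsilon> \<rho>"
  using reg_log_antimono[of \<epsilon> \<rho> 1] assms by simp

lemma DERIV_reg_log:
  assumes "0 < \<epsilon>" "0 \<le> \<rho>"
  shows "(reg_log \<epsilon> has_real_derivative - 1 / (2 * (\<rho> + \<epsilon>))) (at \<rho>)"
proof -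
  have "((\<lambda>\<rho>. 1 - ln ((\<rho> + \<epsilon>) / (1 + \<epsilon>)) / 2) has_real_derivative
      0 - 1 / ((\<rho> + \<epsilon>) / (1 + \<epsilon>)) * (1 / (1 + \<epsilon>)) / 2) (at \<rho>)"
    using assms by (intro DERIV_diff DERIV_const DERIV_cdivide DERIV_chain2[OF DERIV_ln_divide])
      (auto intro!: derivative_eq_intros)
  moreover have *: "0 - 1 / (a / b) * (1 / b) / 2 = - 1 / (2 * a)" if "a \<noteq> 0" "b \<noteq> 0" for a b :: real
    using that by (simp add: field_simps)
  have "0 - 1 / ((\<rho> + \<epsilon>) / (1 + \<epsilon>)) * (1 / (1 + \<epsilon>)) / 2 = - 1 / (2 * (\<rho> + \<epsilon>))"
    by (rule *) (use assms in auto)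
  ultimately show ?thesis unfolding reg_log_def[abs_def] by metis
qed

text \<open>With \<sigma> = \<rho> + \<epsilon>, the errors \<rho> * ln (\<sigma> / \<rho>) / 2 and
  \<epsilon> * ln \<sigma> / 2 are each at most \<epsilon> / 2, and the gain \<sigma> - \<rho> =
  \<epsilon> pays for both. The comparison will bound the energy density of a test function by a
  total derivative.\<close>

lemma weighted_log_le_reg_log:
  assumes e: "0 < \<epsilon>" "\<epsilon> \<le> 1" and r: "0 < r" "r < 1"
  shows "r\<^sup>2 * (1 - ln r) \<le> (r\<^sup>2 + \<epsilon>) * reg_log \<epsilon> (r\<^sup>2)"
proof -
  define \<rho> \<sigma> where "\<rho> = r\<^sup>2" and "\<sigma> = \<rho> + \<epsilon>"
  have \<rho>: "0 < \<rho>" "\<rho> < 1" using r by (auto simp: \<rho>_def power_less_one_iff)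
  have \<sigma>: "0 < \<sigma>" using \<rho> e by (simp add: \<sigma>_def)
  have lnr: "ln r = ln \<rho> / 2" using r by (simp add: \<rho>_def ln_realpow)
  have "ln (\<sigma> / \<rho>) \<le> \<sigma> / \<rho> - 1" using \<rho> \<sigma> by (intro ln_le_minus_one) auto
  then have "\<rho> * (ln \<sigma> - ln \<rho>) \<le> \<rho> * (\<sigma> / \<rho> - 1)" using \<rho> \<sigma> by (intro mult_left_mono) (auto simp: ln_div)
  also have "\<rho> * (\<sigma> / \<rho> - 1) = \<epsilon>" using \<rho> by (simp add: right_diff_distrib \<sigma>_def)
  finally have 1: "\<rho> * ln \<sigma> - \<rho> * ln \<rho> \<le> \<epsilon>" by (simp add: right_diff_distrib)
  have "ln \<sigma> \<le> \<sigma> - 1" using \<sigma> by (rule ln_le_minus_one)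
  then have "ln \<sigma> \<le> 1" using \<rho> e by (simp add: \<sigma>_def)
  then have 2: "\<epsilon> * ln \<sigma> \<le> \<epsilon>" using e by simp
  have 3: "0 \<le> \<sigma> * ln (1 + \<epsilon>)" using \<sigma> e by simp
  have 4: "\<sigma> * ln \<sigma> = \<rho> * ln \<sigma> + \<epsilon> * ln \<sigma>" by (simp add: \<sigma>_def algebra_simps)
  have "\<rho> * (1 - ln \<rho> / 2) \<le> \<sigma> * (1 - ln \<sigma> / 2 + ln (1 + \<epsilon>) / 2)"
  proof -
    have "\<rho> * (1 - ln \<rho> / 2) = \<rho> - \<rho> * ln \<rho> / 2" by (simp add: right_diff_distrib)
    moreover have "\<sigma> * (1 - ln \<sigma> / 2 + ln (1 + \<epsilon>) / 2) = \<sigma> - \<sigma> * ln \<sigma> / 2 + \<sigma> * ln (1 + \<epsilon>) / 2"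
      by (simp add: right_diff_distrib distrib_left)
    moreover have "\<sigma> = \<rho> + \<epsilon>" by (rule \<sigma>_def)
    ultimately show ?thesis using 1 2 3 4 e by linarith
  qed
  then show ?thesis using \<rho> e unfolding lnr by (simp add: \<sigma>_def \<rho>_def reg_log_alt)
qed

text \<open>A Moser-type function. It is negative inside because an admissible function has
  nonnegative Laplacian S_1 and so lies below its boundary value 0. The root normalizes the energy:
  ln (reg_log \<epsilon> 0) is the total rise of ln (reg_log \<epsilon> (|x|^2)) from the boundary
  to the centre.\<close>

definition extremal :: "nat \<Rightarrow> real \<Rightarrow> real \<Rightarrow> 'a::real_normed_vector \<Rightarrow> real"
  where "extremal k c \<epsilon> x =
    - root (k + 1) (1 / (c * ln (reg_log \<epsilon> 0))) * ln (reg_log \<epsilon> ((norm x)\<^sup>2))"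

context
  fixes k :: nat and c \<epsilon> M s :: real
  assumes k: "1 \<le> k" and c: "0 < c" and e: "0 < \<epsilon>" "\<epsilon> \<le> 1"
  defines "s \<equiv> ln (reg_log \<epsilon> 0)"
    and "M \<equiv> root (k + 1) (1 / (c * s))"
begin

lemma extremal_log_pos: "0 < s"
proof -
  have "ln \<epsilon> < ln (1 + \<epsilon>)" using e by simp
  then have "1 < reg_log \<epsilon> 0" using e by (simp add: reg_log_alt)
  then show ?thesis by (simp add: s_def)
qed

lemma extremal_coeff_nonneg: "0 \<le> M" and extremal_coeff_power: "c * M ^ (k + 1) = 1 / s"
proof -
  have *: "0 \<le> 1 / (c * s)" using extremal_log_pos c by simp
  then show "0 \<le> M" unfolding M_def by (rule real_root_ge_zero)
  have "M ^ (k + 1) = 1 / (c * s)" unfolding M_def using * by (intro real_root_pow_pos2) auto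
  then show "c * M ^ (k + 1) = 1 / s" using c by simp
qed

lemma extremal_eq: "extremal k c \<epsilon> x = - M * ln (reg_log \<epsilon> ((norm x)\<^sup>2))"
  by (simp add: extremal_def M_def s_def)

text \<open>The Hessian is a multiple of the identity plus a rank-one matrix, so the sign conditions
  for all j reduce to one. With \<Lambda> = reg_log \<epsilon> \<rho>, it holds because (\<rho> +
  \<epsilon>) * \<Lambda> - \<rho> * (\<Lambda> - 1 / 2) = \<epsilon> * \<Lambda> + \<rho> / 2 is
  positive.\<close>

lemma extremal_in_Phi_0_rad:
  assumes nk: "CARD('n) = 2 * k"
  shows "(extremal k c \<epsilon> :: real ^ 'n \<Rightarrow> real) \<in> Phi_0_rad k"
proof -
  let ?\<Lambda> = "reg_log \<epsilon>"
  let ?u = "extremal k c \<epsilon> :: real ^ 'n \<Rightarrow> real"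
  define f f1 f2 where "f \<rho> = - M * ln (?\<Lambda> \<rho>)" and "f1 \<rho> = M / (2 * ((\<rho> + \<epsilon>) * ?\<Lambda> \<rho>))"
    and "f2 \<rho> = - (M / 2) * (?\<Lambda> \<rho> - 1 / 2) / ((\<rho> + \<epsilon>) * ?\<Lambda> \<rho>)\<^sup>2" for \<rho>
  have u: "?u = (\<lambda>x. f ((norm x)\<^sup>2))" by (auto simp: extremal_eq f_def)
  have \<Lambda>: "0 < ?\<Lambda> \<rho>" "0 < \<rho> + \<epsilon>" if "0 \<le> \<rho>" "\<rho> \<le> 1" for \<rho>
    using reg_log_ge_1[OF e(1) that] that e by auto
  have d1: "(f has_real_derivative f1 \<rho>) (at \<rho>)" if "0 \<le> \<rho>" "\<rho> < 1" for \<rho>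
    unfolding f_def f1_def using that \<Lambda>[of \<rho>] e
    by (auto intro!: derivative_eq_intros DERIV_reg_log simp: field_simps)
  have d2: "(f1 has_real_derivative f2 \<rho>) (at \<rho>)" if \<rho>: "0 \<le> \<rho>" "\<rho> < 1" for \<rho>
  proof -
    have "((\<lambda>\<rho>. (\<rho> + \<epsilon>) * ?\<Lambda> \<rho>) has_real_derivative ?\<Lambda> \<rho> - 1 / 2) (at \<rho>)"
    proof -
      have "((\<lambda>\<rho>. (\<rho> + \<epsilon>) * ?\<Lambda> \<rho>) has_real_derivative 1 * ?\<Lambda> \<rho> + - 1 / (2 * (\<rho> + \<epsilon>)) * (\<rho> + \<epsilon>)) (at \<rho>)"
        using \<rho> e by (intro DERIV_mult DERIV_reg_log) (auto intro!: derivative_eq_intros)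
      moreover have *: "1 * b + - 1 / (2 * a) * a = b - 1 / 2" if "a \<noteq> 0" for a b :: real using that by simp
      have "1 * ?\<Lambda> \<rho> + - 1 / (2 * (\<rho> + \<epsilon>)) * (\<rho> + \<epsilon>) = ?\<Lambda> \<rho> - 1 / 2"
        by (rule *) (use \<Lambda>[of \<rho>] \<rho> in auto)
      ultimately show ?thesis by metis
    qed
    then have "((\<lambda>\<rho>. M / 2 * inverse ((\<rho> + \<epsilon>) * ?\<Lambda> \<rho>)) has_real_derivative
        M / 2 * - (inverse ((\<rho> + \<epsilon>) * ?\<Lambda> \<rho>) * (?\<Lambda> \<rho> - 1 / 2) * inverse ((\<rho> + \<epsilon>) * ?\<Lambda> \<rho>))) (at \<rho>)"
      using \<rho> \<Lambda>[of \<rho>] by (intro DERIV_cmult DERIV_inverse') auto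
    moreover have "(\<lambda>\<rho>. M / 2 * inverse ((\<rho> + \<epsilon>) * ?\<Lambda> \<rho>)) = f1" by (simp add: f1_def fun_eq_iff inverse_eq_divide)
    moreover have *: "M / 2 * - (inverse a * b * inverse a) = - (M / 2) * b / a\<^sup>2" if "a \<noteq> 0" for a b :: real
      using that by (simp add: field_simps power2_eq_square)
    have "M / 2 * - (inverse ((\<rho> + \<epsilon>) * ?\<Lambda> \<rho>) * (?\<Lambda> \<rho> - 1 / 2) * inverse ((\<rho> + \<epsilon>) * ?\<Lambda> \<rho>)) = f2 \<rho>"
      unfolding f2_def by (rule *) (use \<Lambda>[of \<rho>] \<rho> in auto)
    ultimately show ?thesis by metis
  qed
  have cont\<Lambda>: "continuous_on {0..1} ?\<Lambda>"
    by (rule continuous_at_imp_continuous_on) (auto intro!: DERIV_isCont DERIV_reg_log e)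
  have cont2: "continuous_on {0..<1} f2"
    unfolding f2_def
  proof (intro continuous_intros continuous_on_subset[OF cont\<Lambda>])
    show "\<forall>\<rho>\<in>{0..<1}. ((\<rho> + \<epsilon>) * ?\<Lambda> \<rho>)\<^sup>2 \<noteq> 0"
    proof
      fix \<rho> :: real assume "\<rho> \<in> {0..<1}"
      then show "((\<rho> + \<epsilon>) * ?\<Lambda> \<rho>)\<^sup>2 \<noteq> 0" using \<Lambda>[of \<rho>] by simp
    qed
  qed auto
  have C2: "C2_on (ball 0 1) ?u"
    by (rule radial_C2(1)[OF u _ _ cont2]) (fact d1 d2)+
  have H: "hessian ?u x = (\<chi> i j. (if i = j then 2 * f1 ((norm x)\<^sup>2) else 0) + 4 * f2 ((norm x)\<^sup>2) * x $ i * x $ j)"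
    if "x \<in> ball 0 1" for x
    by (rule radial_C2(2)[OF u _ _ cont2 that]) (fact d1 d2)+
  have "continuous_on (cball 0 1) ?u"
    unfolding u
  proof (rule continuous_on_compose2[where s="cball 0 1" and t="{0..1}" and g=f])
    show "continuous_on {0..1} f"
      unfolding f_def
    proof (intro continuous_intros cont\<Lambda> ballI)
      fix \<rho> :: real assume "\<rho> \<in> {0..1}"
      then show "?\<Lambda> \<rho> \<noteq> 0" using \<Lambda>[of \<rho>] by simp
    qed
    show "(\<lambda>x :: real ^ 'n. (norm x)\<^sup>2) ` cball 0 1 \<subseteq> {0..1}" by (auto simp: power_le_one)
  qed (intro continuous_intros)
  moreover have "0 \<le> S_minors j (hessian ?u x)" if j: "j \<in> {1..k}" and x: "x \<in> ball 0 1" for j x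
  proof -
    define \<rho> where "\<rho> = (norm x)\<^sup>2"
    have \<rho>: "0 \<le> \<rho>" "\<rho> < 1" using x by (auto simp: \<rho>_def power_less_one_iff)
    let ?\<sigma> = "\<rho> + \<epsilon>" and ?l = "?\<Lambda> \<rho>"
    have l: "0 < ?\<sigma>" "0 < ?l" using \<Lambda>[of \<rho>] \<rho> by auto
    have "2 * (2 * f1 \<rho>) + 4 * f2 \<rho> * \<rho> = 2 * M * (?\<sigma> * ?l - \<rho> * (?l - 1 / 2)) / (?\<sigma> * ?l)\<^sup>2"
    proof -
      have "f1 \<rho> = M / 2 * (?\<sigma> * ?l) / (?\<sigma> * ?l)\<^sup>2" using l by (simp add: f1_def power2_eq_square)
      then show ?thesis by (simp add: f2_def algebra_simps add_divide_distrib diff_divide_distrib)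
    qed
    also have "?\<sigma> * ?l - \<rho> * (?l - 1 / 2) = \<epsilon> * ?l + \<rho> / 2" by (simp add: algebra_simps)
    also have "0 \<le> 2 * M * (\<epsilon> * ?l + \<rho> / 2) / (?\<sigma> * ?l)\<^sup>2"
      using extremal_coeff_nonneg e l \<rho> by (intro divide_nonneg_nonneg mult_nonneg_nonneg add_nonneg_nonneg) auto
    finally have "0 \<le> 2 * (2 * f1 \<rho>) + 4 * f2 \<rho> * \<rho>" .
    moreover have "0 \<le> 2 * f1 \<rho>" using extremal_coeff_nonneg l by (simp add: f1_def)
    ultimately show ?thesis
      unfolding H[OF x] \<rho>_def[symmetric] using j nk
      by (intro S_minors_scalar_plus_rank_one_nonneg) (auto simp: \<rho>_def)
  qed
  ultimately have "k_admissible k ?u" using C2 by (simp add: k_admissible_def)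
  moreover have "radial_on (cball 0 1) ?u" by (auto simp: radial_on_def extremal_def)
  moreover have "\<forall>x\<in>sphere 0 1. ?u x = 0" using e by (auto simp: extremal_def)
  ultimately show ?thesis by (simp add: Phi_0_rad_def)
qed

text \<open>Let h be the derivative of - ln (reg_log \<epsilon> (r^2)). Since r * h r * (1 - ln r)
  \<le> 1 by the comparison of weights, the density is at most M ^ (k + 1) * h r. The integral of h
  is s, and M was chosen so that c * M ^ (k + 1) * s = 1.\<close>

lemma extremal_energy_le_1:
  assumes nk: "CARD('n) = 2 * k" and ch: "c = hessian_const TYPE('n) k"
  shows "Phi_energy k (log_weight k) (extremal k c \<epsilon> :: real ^ 'n \<Rightarrow> real) \<le> 1"
proof -
  let ?\<Lambda> = "reg_log \<epsilon>"
  let ?u = "extremal k c \<epsilon> :: real ^ 'n \<Rightarrow> real"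
  define h where "h r = r / ((r\<^sup>2 + \<epsilon>) * ?\<Lambda> (r\<^sup>2))" for r
  have \<Lambda>: "1 \<le> ?\<Lambda> (r\<^sup>2)" "0 < r\<^sup>2 + \<epsilon>" if "0 \<le> r" "r \<le> 1" for r
    using reg_log_ge_1[OF e(1), of "r\<^sup>2"] that e by (auto simp: power_le_one add_nonneg_pos)
  have DF: "((\<lambda>r. - ln (?\<Lambda> (r\<^sup>2))) has_real_derivative h r) (at r)" if r: "0 \<le> r" "r \<le> 1" for r
  proof -
    have "((\<lambda>r. ?\<Lambda> (r\<^sup>2)) has_real_derivative - 1 / (2 * (r\<^sup>2 + \<epsilon>)) * (2 * r)) (at r)"
      by (rule DERIV_chain2[OF DERIV_reg_log[OF e(1)]]) (auto intro!: derivative_eq_intros)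
    then have "((\<lambda>r. - ln (?\<Lambda> (r\<^sup>2))) has_real_derivative - (1 / ?\<Lambda> (r\<^sup>2) * (- 1 / (2 * (r\<^sup>2 + \<epsilon>)) * (2 * r)))) (at r)"
      using \<Lambda>[OF r] by (intro DERIV_minus DERIV_chain2[OF DERIV_ln_divide]) auto
    moreover have *: "- (1 / l * (- 1 / (2 * a) * (2 * r))) = r / (a * l)" if "a \<noteq> 0" "l \<noteq> 0" for a l :: real
      using that by (simp add: field_simps)
    have "- (1 / ?\<Lambda> (r\<^sup>2) * (- 1 / (2 * (r\<^sup>2 + \<epsilon>)) * (2 * r))) = h r"
      unfolding h_def by (rule *) (use \<Lambda>[OF r] in auto)
    ultimately show ?thesis by metis
  qed
  have dp: "deriv (profile ?u) r = M * h r" if r: "r \<in> {0<..<1}" for r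
  proof (rule DERIV_imp_deriv, rule has_field_derivative_transform_within_open)
    show "((\<lambda>r. M * - ln (?\<Lambda> (r\<^sup>2))) has_real_derivative M * h r) (at r)"
      using r by (intro DERIV_cmult DF) auto
    show "M * - ln (?\<Lambda> (r\<^sup>2)) = profile ?u r" if "r \<in> {0<..<1}" for r
      using that by (intro profile_cong[symmetric]) (auto simp: extremal_eq)
  qed (use r in auto)
  have pt: "r ^ k * \<bar>deriv (profile ?u) r\<bar> ^ (k + 1) * (1 - ln r) ^ k \<le> M ^ (k + 1) * h r" if r: "r \<in> {0<..<1}" for r
  proof -
    have r': "0 < r" "r < 1" using r by auto
    have pos: "0 < (r\<^sup>2 + \<epsilon>) * ?\<Lambda> (r\<^sup>2)" using \<Lambda>[of r] r' by (intro mult_pos_pos) auto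
    have h0: "0 \<le> h r" using pos r' by (simp add: h_def)
    have "ln r < 0" using r' by simp
    then have l0: "0 \<le> 1 - ln r" by linarith
    have "r * h r * (1 - ln r) = r\<^sup>2 * (1 - ln r) / ((r\<^sup>2 + \<epsilon>) * ?\<Lambda> (r\<^sup>2))" by (simp add: h_def power2_eq_square)
    also have "\<dots> \<le> 1" using weighted_log_le_reg_log[OF e r'] pos by simp
    finally have "(r * h r * (1 - ln r)) ^ k \<le> 1"
      using h0 l0 r' by (intro power_le_one mult_nonneg_nonneg) auto
    then have "(M ^ (k + 1) * h r) * (r * h r * (1 - ln r)) ^ k \<le> (M ^ (k + 1) * h r) * 1"
      using h0 extremal_coeff_nonneg by (intro mult_left_mono mult_nonneg_nonneg zero_le_power)
    moreover have "\<bar>deriv (profile ?u) r\<bar> = M * h r" unfolding dp[OF r] using h0 extremal_coeff_nonneg by (simp add: abs_mult)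
    then have eq: "r ^ k * \<bar>deriv (profile ?u) r\<bar> ^ (k + 1) * (1 - ln r) ^ k = (M ^ (k + 1) * h r) * (r * h r * (1 - ln r)) ^ k"
      by (simp only: power_mult_distrib power_add power_one_right mult_ac)
    ultimately show ?thesis unfolding eq by (simp only: mult_1_right)
  qed
  have FTC: "(\<integral>\<^sup>+ r. ennreal (h r) * indicator {0..1} r \<partial>lborel) = ennreal s"
  proof -
    have "(\<integral>\<^sup>+ r. ennreal (h r) * indicator {0..1} r \<partial>lborel) = ennreal (- ln (?\<Lambda> (1\<^sup>2)) - (- ln (?\<Lambda> (0\<^sup>2))))"
    proof (rule nn_integral_FTC_Icc)
      show "h \<in> borel_measurable borel" unfolding h_def[abs_def] reg_log_def by measurable
      show "0 \<le> h r" if "r \<in> {0..1}" for r using \<Lambda>[of r] that by (auto simp: h_def)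
    qed (use DF in auto)
    then show ?thesis using e by (simp add: s_def)
  qed
  have "(\<integral>\<^sup>+ r\<in>{0<..<1}. ennreal (r ^ k * \<bar>deriv (profile ?u) r\<bar> ^ (k + 1) * (1 - ln r) ^ k) \<partial>lborel)
     \<le> (\<integral>\<^sup>+ r. ennreal (M ^ (k + 1)) * (ennreal (h r) * indicator {0..1} r) \<partial>lborel)"
  proof (rule nn_integral_mono)
    fix r :: real
    show "ennreal (r ^ k * \<bar>deriv (profile ?u) r\<bar> ^ (k + 1) * (1 - ln r) ^ k) * indicator {0<..<1} r
       \<le> ennreal (M ^ (k + 1)) * (ennreal (h r) * indicator {0..1} r)"
    proof (cases "r \<in> {0<..<1}")
      case True
      have "ennreal (r ^ k * \<bar>deriv (profile ?u) r\<bar> ^ (k + 1) * (1 - ln r) ^ k) \<le> ennreal (M ^ (k + 1) * h r)"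
        by (rule ennreal_leI[OF pt[OF True]])
      also have "\<dots> = ennreal (M ^ (k + 1)) * ennreal (h r)" using extremal_coeff_nonneg by (intro ennreal_mult') auto
      finally show ?thesis using True by simp
    qed simp
  qed
  also have "\<dots> = ennreal (M ^ (k + 1)) * ennreal s"
    unfolding FTC[symmetric] by (rule nn_integral_cmult) (auto simp: h_def[abs_def] reg_log_def)
  finally have "Phi_energy k (log_weight k) ?u \<le> ennreal c * (ennreal (M ^ (k + 1)) * ennreal s)"
    unfolding Phi_energy_log_weight[OF nk] ch[symmetric] by (intro mult_left_mono) auto
  also have "\<dots> = ennreal (c * M ^ (k + 1) * s)"
    using c extremal_log_pos extremal_coeff_nonneg by (simp add: ennreal_mult[symmetric] mult.assoc)
  also have "\<dots> = 1" unfolding extremal_coeff_power using extremal_log_pos by simp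
  finally show ?thesis .
qed

text \<open>The loss must stay bounded as \<epsilon> tends to 0, since it is multiplied by a in an
  exponent. With \<eta> = 1 / \<Lambda>0, on the small ball l is within \<eta> of its central value
  s, the exponent B is at least s - 2 * \<eta>, and so exp B falls short of exp s = \<Lambda>0 by at
  most 2.\<close>

lemma exp_extremal_ge:
  assumes x: "(norm x)\<^sup>2 \<le> \<epsilon>"
  shows "- 1 - ln \<epsilon> / 2 \<le> exp (c powr (1 / real k) * \<bar>extremal k c \<epsilon> x\<bar> powr (real (k + 1) / real k))"
proof -
  let ?\<Lambda> = "reg_log \<epsilon>"
  define \<Lambda>0 l B where "\<Lambda>0 = ?\<Lambda> 0" and "l = ln (?\<Lambda> ((norm x)\<^sup>2))"
    and "B = c powr (1 / real k) * \<bar>extremal k c \<epsilon> x\<bar> powr (real (k + 1) / real k)"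
  define \<eta> where "\<eta> = 1 / \<Lambda>0"
  have \<Lambda>0: "1 \<le> \<Lambda>0" using reg_log_ge_1[of \<epsilon> 0] e by (simp add: \<Lambda>0_def)
  have \<Lambda>0': "\<Lambda>0 = 1 - ln \<epsilon> / 2 + ln (1 + \<epsilon>) / 2" using e by (simp add: \<Lambda>0_def reg_log_alt)
  \<comment> \<open>At \<rho> = \<epsilon> the argument of the logarithm is twice that at the
    centre, which costs ln 2 / 2 \<le> 1 / 2.\<close>
  have "ln (2 :: real) \<le> 1" using ln_le_minus_one[of 2] by simp
  moreover have "?\<Lambda> \<epsilon> = \<Lambda>0 - ln 2 / 2"
  proof -
    have "\<epsilon> + \<epsilon> = 2 * \<epsilon>" by simp
    then have "ln (\<epsilon> + \<epsilon>) = ln 2 + ln \<epsilon>" using ln_mult[of 2 \<epsilon>] e by simp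
    then show ?thesis using e by (simp add: \<Lambda>0' reg_log_alt add_divide_distrib)
  qed
  ultimately have "\<Lambda>0 - 1 / 2 \<le> ?\<Lambda> \<epsilon>" by simp
  also have "\<dots> \<le> ?\<Lambda> ((norm x)\<^sup>2)" using e x by (intro reg_log_antimono) auto
  finally have \<Lambda>x: "\<Lambda>0 - 1 / 2 \<le> ?\<Lambda> ((norm x)\<^sup>2)" .
  have "ln (\<Lambda>0 / (\<Lambda>0 - 1 / 2)) \<le> \<Lambda>0 / (\<Lambda>0 - 1 / 2) - 1" using \<Lambda>0 by (intro ln_le_minus_one) auto
  also have "\<dots> \<le> \<eta>" using \<Lambda>0 by (simp add: \<eta>_def field_simps)
  finally have "s - \<eta> \<le> ln (\<Lambda>0 - 1 / 2)" using \<Lambda>0 by (simp add: ln_div s_def \<Lambda>0_def)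
  also have "\<dots> \<le> l" unfolding l_def using \<Lambda>x \<Lambda>0 by (subst ln_le_cancel_iff) auto
  finally have l: "s - \<eta> \<le> l" .
  have l0: "0 \<le> l" unfolding l_def using x e by (intro ln_ge_zero reg_log_ge_1) auto
  have ux: "\<bar>extremal k c \<epsilon> x\<bar> = M * l" using l0 extremal_coeff_nonneg by (simp add: extremal_eq l_def abs_mult)
  have B0: "0 \<le> B" by (simp add: B_def)
  have Bk: "B ^ k = l ^ (k + 1) / s"
  proof -
    have "(c powr (1 / real k)) ^ k = c"
      using power_powr_divide[of c k 1, unfolded of_nat_1 power_one_right] c k by auto
    moreover have "((M * l) powr (real (k + 1) / real k)) ^ k = (M * l) ^ (k + 1)"
      using extremal_coeff_nonneg l0 k by (intro power_powr_divide) auto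
    ultimately have "B ^ k = (c * M ^ (k + 1)) * l ^ (k + 1)"
      unfolding B_def ux by (simp only: power_mult_distrib mult.assoc)
    then show ?thesis unfolding extremal_coeff_power by simp
  qed
  have "s - 2 * \<eta> \<le> B"
  proof (cases "s - 2 * \<eta> \<le> 0")
    case False
    have \<eta>: "0 < \<eta>" using \<Lambda>0 by (simp add: \<eta>_def)
    \<comment> \<open>One use of this inequality absorbs the division by s in B ^ k = l ^ (k + 1) /
      s; the remaining k - 1 factors are compared directly.\<close>
    have "s * (s - 2 * \<eta>) \<le> (s - \<eta>)\<^sup>2" by (simp add: power2_eq_square algebra_simps)
    then have "(s * (s - 2 * \<eta>)) * (s - 2 * \<eta>) ^ (k - 1) \<le> (s - \<eta>)\<^sup>2 * (s - \<eta>) ^ (k - 1)"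
      using False \<eta> by (intro mult_mono power_mono) auto
    moreover have "(s - 2 * \<eta>) ^ k = (s - 2 * \<eta>) * (s - 2 * \<eta>) ^ (k - 1)" using k by (simp add: power_eq_if)
    moreover have "(s - \<eta>)\<^sup>2 * (s - \<eta>) ^ (k - 1) = (s - \<eta>) ^ (k + 1)" using k by (simp add: power_add[symmetric])
    ultimately have "s * (s - 2 * \<eta>) ^ k \<le> (s - \<eta>) ^ (k + 1)" by (simp add: mult.assoc)
    also have "\<dots> \<le> l ^ (k + 1)" using l False \<eta> by (intro power_mono) auto
    also have "\<dots> = s * B ^ k" unfolding Bk using extremal_log_pos by simp
    finally have "(s - 2 * \<eta>) ^ k \<le> B ^ k" using extremal_log_pos by simp
    then show ?thesis by (rule le_if_power_le) (use B0 k in auto)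
  qed (use B0 in linarith)
  then have "exp (s - 2 * \<eta>) \<le> exp B" by simp
  moreover have "exp (s - 2 * \<eta>) = \<Lambda>0 * exp (- 2 * \<eta>)"
  proof -
    have "exp (s + - 2 * \<eta>) = exp s * exp (- 2 * \<eta>)" by (rule exp_add)
    moreover have "exp s = \<Lambda>0" using \<Lambda>0 by (simp add: s_def \<Lambda>0_def)
    ultimately show ?thesis by simp
  qed
  moreover have "\<Lambda>0 * (1 + - 2 * \<eta>) \<le> \<Lambda>0 * exp (- 2 * \<eta>)" using \<Lambda>0 by (intro mult_left_mono exp_ge_add_one_self) auto
  moreover have "\<Lambda>0 * (1 + - 2 * \<eta>) = \<Lambda>0 - 2" using \<Lambda>0 by (simp add: \<eta>_def field_simps)
  moreover have "- 1 - ln \<epsilon> / 2 \<le> \<Lambda>0 - 2" using e by (simp add: \<Lambda>0')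
  ultimately show ?thesis unfolding B_def by linarith
qed

end

text \<open>For \<epsilon> = exp (- 2 * j) the test function is large on the ball of radius exp (-
  j). The volume there is of order exp (- n * j), while the integrand is at least exp (a * (j -
  1)).\<close>

lemma extremal_double_exp_integral_ge:
  fixes j k :: nat
  defines "c \<equiv> hessian_const TYPE('n::finite) k"
  assumes nk: "CARD('n) = 2 * k" and a: "0 < a"
  shows "\<exists>u :: real ^ 'n \<Rightarrow> real. u \<in> Phi_0_rad_weighted k (log_weight k) \<and> Phi_norm k (log_weight k) u \<le> 1 \<and>
    ennreal (unit_ball_vol (real CARD('n)) * exp (- a) * exp ((a - real CARD('n)) * real j)) \<le>
    (\<integral>\<^sup>+ x\<in>ball 0 1. ennreal (exp (a * exp (c powr (1 / real k) * \<bar>u x\<bar> powr (real (k + 1) / real k)))) \<partial>lborel)"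
proof -
  have "0 < CARD('n)" by (rule zero_less_card_finite)
  then have k: "1 \<le> k" using nk by linarith
  have c: "0 < c" unfolding c_def using k nk by (intro hessian_const_pos) auto
  define \<epsilon> where "\<epsilon> = exp (- 2 * real j)"
  have e: "0 < \<epsilon>" "\<epsilon> \<le> 1" by (auto simp: \<epsilon>_def)
  let ?u = "extremal k c \<epsilon> :: real ^ 'n \<Rightarrow> real"
  have P: "?u \<in> Phi_0_rad k" by (rule extremal_in_Phi_0_rad[OF k c e nk])
  have "Phi_energy k (log_weight k) ?u \<le> 1"
    by (rule extremal_energy_le_1[OF k c e nk]) (simp add: c_def)
  then have N: "Phi_norm k (log_weight k) ?u \<le> 1" by (rule Phi_norm_le_1_if_Phi_energy_le_1)
  then have W: "?u \<in> Phi_0_rad_weighted k (log_weight k)"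
    using P by (intro Phi_0_rad_subset_weighted) (auto intro: le_less_trans)
  let ?V = "unit_ball_vol (real CARD('n))"
  let ?B = "ball (0 :: real ^ 'n) (exp (- real j))"
  have V: "0 \<le> ?V" by (rule unit_ball_vol_nonneg) simp
  have eq: "?V * exp (- a) * exp ((a - real CARD('n)) * real j) = exp (a * (real j - 1)) * (?V * exp (- real j) ^ CARD('n))"
    by (simp add: exp_of_nat_mult[symmetric] exp_add[symmetric] algebra_simps)
  have "ennreal (?V * exp (- a) * exp ((a - real CARD('n)) * real j)) =
      ennreal (exp (a * (real j - 1))) * ennreal (?V * exp (- real j) ^ CARD('n))"
    unfolding eq by (rule ennreal_mult) (use V in auto)
  also have "ennreal (?V * exp (- real j) ^ CARD('n)) = emeasure lborel ?B"
    by (subst emeasure_ball) auto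
  also have "ennreal (exp (a * (real j - 1))) * emeasure lborel ?B =
      (\<integral>\<^sup>+ x\<in>?B. ennreal (exp (a * (real j - 1))) \<partial>lborel)"
    by (simp add: nn_integral_cmult_indicator)
  also have "\<dots> \<le> (\<integral>\<^sup>+ x\<in>ball 0 1. ennreal (exp (a * exp (c powr (1 / real k) * \<bar>?u x\<bar> powr (real (k + 1) / real k)))) \<partial>lborel)"
  proof (rule nn_integral_mono)
    fix x :: "real ^ 'n"
    show "ennreal (exp (a * (real j - 1))) * indicator ?B x \<le>
      ennreal (exp (a * exp (c powr (1 / real k) * \<bar>?u x\<bar> powr (real (k + 1) / real k)))) * indicator (ball 0 1) x"
    proof (cases "x \<in> ?B")
      case True
      then have x: "norm x \<le> exp (- real j)" "norm x < exp (- real j)" by auto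
      have "exp (- real j) \<le> 1" by simp
      then have x1: "x \<in> ball 0 1" using x(2) unfolding mem_ball dist_0_norm by (rule less_le_trans[rotated])
      have "(norm x)\<^sup>2 \<le> (exp (- real j))\<^sup>2" using x by (intro power_mono) auto
      also have "\<dots> = \<epsilon>" by (simp add: \<epsilon>_def exp_double[symmetric])
      finally have "- 1 - ln \<epsilon> / 2 \<le> exp (c powr (1 / real k) * \<bar>?u x\<bar> powr (real (k + 1) / real k))"
        by (rule exp_extremal_ge[OF k c e])
      then have "real j - 1 \<le> exp (c powr (1 / real k) * \<bar>?u x\<bar> powr (real (k + 1) / real k))" by (simp add: \<epsilon>_def)
      then have "a * (real j - 1) \<le> a * exp (c powr (1 / real k) * \<bar>?u x\<bar> powr (real (k + 1) / real k))"
        using a by (intro mult_left_mono) auto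
      then show ?thesis using True x1 by (simp add: ennreal_leI)
    qed simp
  qed
  finally show ?thesis using W N by blast
qed

theorem theorem1p3:
  fixes n k :: nat and w\<^sub>1 :: "real ^ 'n \<Rightarrow> real"
  assumes "n = CARD('n)" and "n \<ge> 2" and "even n" and "k = n div 2"
    and "w\<^sub>1 = (\<lambda>x. ln (exp 1 / norm x) powr (real n / 2))"
  shows "(\<forall>u \<in> Phi_0_rad_weighted k w\<^sub>1.
            (\<integral>\<^sup>+ x\<in>ball 0 1. ennreal (exp (exp (\<bar>u x\<bar> powr ((real n + 2) / real n)))) \<partial>lborel) < \<infinity>)
       \<and> (\<forall>a :: real.
            (SUP u \<in> {u \<in> Phi_0_rad_weighted k w\<^sub>1. Phi_norm k w\<^sub>1 u \<le> 1}.
               \<integral>\<^sup>+ x\<in>ball 0 1. ennreal (exp (a * exp (hessian_const TYPE('n) k powr (2 / real n)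
                 * \<bar>u x\<bar> powr ((real n + 2) / real n)))) \<partial>lborel) < \<infinity>
            \<longleftrightarrow> a \<le> real n)"
proof -
  have nk: "CARD('n) = 2 * k" and n2: "n = 2 * k" using assms by auto
  have k: "1 \<le> k" using n2 assms(2) by linarith
  \<comment> \<open>With n = 2 * k the exponents n / 2, 2 / n and (n + 2) / n become k, 1 / k and (k
    + 1) / k.\<close>
  have w: "w\<^sub>1 = log_weight k" by (auto simp: assms(5) log_weight_def n2)
  have e1: "(real n + 2) / real n = real (k + 1) / real k" using k by (simp add: n2 field_simps)
  have e2: "2 / real n = 1 / real k" using k by (simp add: n2)
  let ?\<Sigma> = "{u \<in> Phi_0_rad_weighted k (log_weight k :: real ^ 'n \<Rightarrow> real). Phi_norm k (log_weight k) u \<le> 1}"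
  let ?I = "\<lambda>a (u :: real ^ 'n \<Rightarrow> real). \<integral>\<^sup>+ x\<in>ball 0 1. ennreal (exp (a * exp (hessian_const TYPE('n) k powr (1 / real k)
                 * \<bar>u x\<bar> powr (real (k + 1) / real k)))) \<partial>lborel"
  have "(SUP u\<in>?\<Sigma>. ?I a u) < \<infinity>" if a: "a \<le> real n" for a
  proof -
    \<comment> \<open>The integrand increases with a, so the critical case covers every smaller a,
      negative ones included.\<close>
    have "?I a u \<le> ?I (real CARD('n)) u" for u
      using a assms(1) by (intro nn_integral_mono mult_right_mono ennreal_leI) auto
    then have "(SUP u\<in>?\<Sigma>. ?I a u) \<le> ennreal (unit_ball_vol (real CARD('n))) * ennreal (real CARD('n) * exp (real CARD('n)) *
        (exp 1 + 32 / (real CARD('n) * (1 / (real k * 4 ^ (k + 1))))))"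
      using double_exp_integral_le[OF nk] by (intro SUP_least order_trans[OF _ double_exp_integral_le[OF nk]]) auto
    also have "\<dots> < \<infinity>" by (simp add: ennreal_mult_less_top)
    finally show ?thesis .
  qed
  moreover have "a \<le> real n" if fin: "(SUP u\<in>?\<Sigma>. ?I a u) < \<infinity>" for a
  proof (rule ccontr)
    assume na: "\<not> a \<le> real n"
    then have a: "0 < a" by (simp add: not_le order.strict_trans1[OF of_nat_0_le_iff])
    define K where "K = unit_ball_vol (real CARD('n)) * exp (- a)"
    have K: "0 < K" unfolding K_def by (intro mult_pos_pos unit_ball_vol_pos) auto
    define C where "C = enn2real (SUP u\<in>?\<Sigma>. ?I a u)"
    have C: "0 \<le> C" "(SUP u\<in>?\<Sigma>. ?I a u) = ennreal C"
      unfolding C_def using fin by (simp_all only: enn2real_nonneg ennreal_enn2real infinity_ennreal_def)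
    have le: "K * exp ((a - real n) * real j) \<le> C" for j
    proof -
      obtain u where u: "u \<in> ?\<Sigma>" "ennreal (K * exp ((a - real n) * real j)) \<le> ?I a u"
        using extremal_double_exp_integral_ge[OF nk a, of j] unfolding K_def assms(1) by blast
      note u(2)
      also have "?I a u \<le> ennreal C" unfolding C(2)[symmetric] using u(1) by (rule SUP_upper)
      finally show ?thesis using C(1) by simp
    qed
    \<comment> \<open>Since a > n, the lower bound grows without limit along the test functions; the
      linear part of the exponential already exceeds C / K.\<close>
    obtain j :: nat where j: "C / K < (a - real n) * real j"
      using reals_Archimedean3[of "a - real n"] na by (auto simp: mult.commute)
    have "C / K < exp ((a - real n) * real j)"
      using j exp_ge_add_one_self[of "(a - real n) * real j"] by linarith
    then show False using le[of j] K by (simp add: divide_less_eq mult.commute)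
  qed
  ultimately have "\<forall>a. (SUP u\<in>?\<Sigma>. ?I a u) < \<infinity> \<longleftrightarrow> a \<le> real n" by blast
  then show ?thesis unfolding w e1 e2 using double_exp_integral_finite[OF nk] by blast
qed

end
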